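(* Let $\Omega$ be a domain in the hemisphere $\mathbb{S}^2_+$. For $p\in\{2,3\}$ let $0<\Lambda_1(\Omega)\le\Lambda_2(\Omega)\le\cdots$ be the eigenvalues (counted with multiplicity) of the Dirichlet problem for $(-\Delta)^p$ on $\Omega$, and let $R_1^{p,D}(z)=\sum_j(z-\Lambda_j(\Omega))_+$. Then for all $z\ge0$ $$ R_1^{2,D}(z)\leq\frac{|\Omega|}{6\pi}z^{\frac32}\qquad\text{and}\qquad R_1^{3,D}(z)\leq\frac{3|\Omega|}{16\pi}z^{\frac43}. $$
   Context: $\mathbb{S}^2_+=\mathbb{S}^2\cap\{x_3>0\}$ is the open hemisphere of the round unit sphere $\mathbb{S}^2\subset\mathbb{R}^3$. A domain is an open connected set; $|\Omega|$ is its surface measure; $a_+=\max(a,0)$. The Dirichlet problem for $(-\Delta)^p$ is $(-\Delta)^pu=\Lambda u$ in $\Omega$, $u=\partial_\nu u=\cdots=\partial^{p-1}_{\nu^{p-1}}u=0$ on $\partial\Omega$, understood weakly: find $\Lambda\in\mathbb{R}$ and $0\neq u\in H^p_0(\Omega)$ (closure of $C_c^\infty(\Omega)$ in $H^p(\Omega)$) such that, for all $\phi\in H_0^p(\Omega)$, $\int_\Omega\Delta u\,\Delta\phi=\Lambda\int_\Omega u\phi$ if $p=2$, and $\int_\Omega\nabla\Delta u\cdot\nabla\Delta\phi=\Lambda\int_\Omega u\phi$ if $p=3$. *)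

theory Defs
  imports "HOL-Analysis.Analysis"
begin

section \<open>The round sphere\<close>

definition S2 :: "(real^3) set" where
  "S2 = sphere 0 1"

definition S2_plus :: "(real^3) set" where
  "S2_plus = {x \<in> S2. x $ 3 > 0}"

text \<open>
  Surface measure: \<open>|A| = 3 vol {r x | 0 < r < 1, x \<in> A}\<close> for Borel \<open>A \<subseteq> S2\<close>, i.e. the measure
  \<open>\<sigma>\<close> of the polar coordinate formula \<open>dx = r\<^sup>2 dr d\<sigma>\<close>. It is a Borel measure on the ambient
  space that is concentrated on \<^term>\<open>S2\<close> (the origin is a null set).
\<close>

definition surf :: "(real^3) measure" where
  "surf = distr (density lborel (\<lambda>x. 3 * indicator (ball 0 1) x)) borel (\<lambda>x. x /\<^sub>R norm x)"

text \<open>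
  Functions on subsets of the sphere are represented by functions on the ambient space of which
  only the values on the sphere matter. Differentiability refers to the extension that is constant
  along rays. On the sphere, the \<open>i\<close>-th partial derivative of this extension is the \<open>i\<close>-th component
  of the surface gradient, because the radial derivative of the extension vanishes.
\<close>

definition radial_ext :: "(real^3 \<Rightarrow> real) \<Rightarrow> real^3 \<Rightarrow> real" where
  "radial_ext f x = f (x /\<^sub>R norm x)"

definition sderiv :: "3 \<Rightarrow> (real^3 \<Rightarrow> real) \<Rightarrow> real^3 \<Rightarrow> real" where
  "sderiv i f x = frechet_derivative (radial_ext f) (at x) (axis i 1)"

text \<open>\<open>C\<^sup>k\<close> and \<open>C\<^sup>\<infinity>\<close> functions on an open set.\<close>

primrec Ck_on :: "nat \<Rightarrow> 'a::euclidean_space set \<Rightarrow> ('a \<Rightarrow> real) \<Rightarrow> bool" where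
  "Ck_on 0 S f \<longleftrightarrow> continuous_on S f"
| "Ck_on (Suc k) S f \<longleftrightarrow> f differentiable_on S \<and>
     (\<forall>b\<in>Basis. Ck_on k S (\<lambda>x. frechet_derivative f (at x) b))"

definition smooth_on :: "'a::euclidean_space set \<Rightarrow> ('a \<Rightarrow> real) \<Rightarrow> bool" where
  "smooth_on S f \<longleftrightarrow> (\<forall>k. Ck_on k S f)"

text \<open>\<open>C\<^sub>c\<^sup>\<infinity>(\<Omega>)\<close>, extended by zero to the whole sphere.\<close>

definition test_fun :: "(real^3) set \<Rightarrow> (real^3 \<Rightarrow> real) set" where
  "test_fun \<Omega> = {\<phi>. smooth_on (- {0}) (radial_ext \<phi>) \<and>
     (\<exists>K. compact K \<and> K \<subseteq> \<Omega> \<and> (\<forall>x \<in> S2 - K. \<phi> x = 0))}"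


section \<open>Sobolev spaces on the sphere\<close>

definition L2 :: "(real^3) set \<Rightarrow> (real^3 \<Rightarrow> real) set" where
  "L2 \<Omega> = {u. set_borel_measurable surf \<Omega> u \<and> set_integrable surf \<Omega> (\<lambda>x. (u x)\<^sup>2)}"

text \<open>
  Weak surface derivative. The term with \<open>x $ i\<close> comes from the divergence theorem on the unit
  sphere, whose mean curvature is \<open>2\<close>: for smooth \<open>f\<close> compactly supported in \<open>\<Omega>\<close>, the integral of
  \<open>sderiv i f\<close> equals that of \<open>2 x\<^sub>i f\<close>; apply this to \<open>f = u \<phi>\<close>.
\<close>

definition has_weak_deriv ::
    "(real^3) set \<Rightarrow> 3 \<Rightarrow> (real^3 \<Rightarrow> real) \<Rightarrow> (real^3 \<Rightarrow> real) \<Rightarrow> bool" where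
  "has_weak_deriv \<Omega> i u v \<longleftrightarrow> u \<in> L2 \<Omega> \<and> v \<in> L2 \<Omega> \<and>
     (\<forall>\<phi> \<in> test_fun \<Omega>.
        (LINT x:\<Omega>|surf. u x * sderiv i \<phi> x) =
          - (LINT x:\<Omega>|surf. v x * \<phi> x) + 2 * (LINT x:\<Omega>|surf. u x * \<phi> x * x $ i))"

text \<open>A representative of the (almost everywhere unique) weak derivative, if there is one.\<close>

definition wderiv :: "(real^3) set \<Rightarrow> 3 \<Rightarrow> (real^3 \<Rightarrow> real) \<Rightarrow> real^3 \<Rightarrow> real" where
  "wderiv \<Omega> i u = (SOME v. has_weak_deriv \<Omega> i u v)"

text \<open>\<open>H\<^sup>p(\<Omega>)\<close>: all iterated weak derivatives of order at most \<open>p\<close> exist in \<open>L\<^sup>2(\<Omega>)\<close>.\<close>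

primrec Sob :: "nat \<Rightarrow> (real^3) set \<Rightarrow> (real^3 \<Rightarrow> real) set" where
  "Sob 0 \<Omega> = L2 \<Omega>"
| "Sob (Suc p) \<Omega> = {u \<in> L2 \<Omega>. \<forall>i. \<exists>v \<in> Sob p \<Omega>. has_weak_deriv \<Omega> i u v}"

primrec Sob_norm_sq :: "nat \<Rightarrow> (real^3) set \<Rightarrow> (real^3 \<Rightarrow> real) \<Rightarrow> real" where
  "Sob_norm_sq 0 \<Omega> u = (LINT x:\<Omega>|surf. (u x)\<^sup>2)"
| "Sob_norm_sq (Suc p) \<Omega> u =
     (LINT x:\<Omega>|surf. (u x)\<^sup>2) + (\<Sum>i\<in>UNIV. Sob_norm_sq p \<Omega> (wderiv \<Omega> i u))"

definition Sob_norm :: "nat \<Rightarrow> (real^3) set \<Rightarrow> (real^3 \<Rightarrow> real) \<Rightarrow> real" where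
  "Sob_norm p \<Omega> u = sqrt (Sob_norm_sq p \<Omega> u)"

definition Sob0 :: "nat \<Rightarrow> (real^3) set \<Rightarrow> (real^3 \<Rightarrow> real) set" where
  "Sob0 p \<Omega> = {u \<in> Sob p \<Omega>. \<exists>\<phi>. (\<forall>n. \<phi> n \<in> test_fun \<Omega>) \<and>
     (\<lambda>n. Sob_norm p \<Omega> (\<lambda>x. u x - \<phi> n x)) \<longlonglongrightarrow> 0}"

definition wgrad :: "(real^3) set \<Rightarrow> (real^3 \<Rightarrow> real) \<Rightarrow> real^3 \<Rightarrow> real^3" where
  "wgrad \<Omega> u x = (\<chi> i. wderiv \<Omega> i u x)"

text \<open>Laplace-Beltrami operator, as the surface divergence of the surface gradient.\<close>

definition wlap :: "(real^3) set \<Rightarrow> (real^3 \<Rightarrow> real) \<Rightarrow> real^3 \<Rightarrow> real" where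
  "wlap \<Omega> u x = (\<Sum>i\<in>UNIV. wderiv \<Omega> i (wderiv \<Omega> i u) x)"


section \<open>The Dirichlet problem for powers of the Laplacian\<close>

definition dirichlet_form ::
    "nat \<Rightarrow> (real^3) set \<Rightarrow> (real^3 \<Rightarrow> real) \<Rightarrow> (real^3 \<Rightarrow> real) \<Rightarrow> real" where
  "dirichlet_form p \<Omega> u v =
     (let \<Delta> = wlap \<Omega> ^^ (p div 2) in
      if even p then LINT x:\<Omega>|surf. \<Delta> u x * \<Delta> v x
      else LINT x:\<Omega>|surf. wgrad \<Omega> (\<Delta> u) x \<bullet> wgrad \<Omega> (\<Delta> v) x)"

lemma dirichlet_form_2:
  "dirichlet_form 2 \<Omega> u v = (LINT x:\<Omega>|surf. wlap \<Omega> u x * wlap \<Omega> v x)"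
  by (simp add: dirichlet_form_def Let_def)

lemma dirichlet_form_3:
  "dirichlet_form 3 \<Omega> u v = (LINT x:\<Omega>|surf. wgrad \<Omega> (wlap \<Omega> u) x \<bullet> wgrad \<Omega> (wlap \<Omega> v) x)"
  by (simp add: dirichlet_form_def Let_def)

definition eigenspace :: "nat \<Rightarrow> (real^3) set \<Rightarrow> real \<Rightarrow> (real^3 \<Rightarrow> real) set" where
  "eigenspace p \<Omega> \<Lambda> = {u \<in> Sob0 p \<Omega>. \<forall>\<phi> \<in> Sob0 p \<Omega>.
     dirichlet_form p \<Omega> u \<phi> = \<Lambda> * (LINT x:\<Omega>|surf. u x * \<phi> x)}"

definition dirichlet_eigenvalue :: "nat \<Rightarrow> (real^3) set \<Rightarrow> real \<Rightarrow> bool" where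
  "dirichlet_eigenvalue p \<Omega> \<Lambda> \<longleftrightarrow>
     (\<exists>u \<in> eigenspace p \<Omega> \<Lambda>. \<not> (AE x in surf. x \<in> \<Omega> \<longrightarrow> u x = 0))"

text \<open>Linear independence of \<open>n\<close> functions modulo equality almost everywhere on \<open>\<Omega>\<close>.\<close>

definition independent_ae :: "(real^3) set \<Rightarrow> nat \<Rightarrow> (nat \<Rightarrow> real^3 \<Rightarrow> real) \<Rightarrow> bool" where
  "independent_ae \<Omega> n u \<longleftrightarrow>
     (\<forall>c. (AE x in surf. x \<in> \<Omega> \<longrightarrow> (\<Sum>i<n. c i * u i x) = 0) \<longrightarrow> (\<forall>i<n. c i = 0))"

text \<open>Dimension of the eigenspace as a subspace of \<open>L\<^sup>2(\<Omega>)\<close>.\<close>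

definition eig_mult :: "nat \<Rightarrow> (real^3) set \<Rightarrow> real \<Rightarrow> enat" where
  "eig_mult p \<Omega> \<Lambda> =
     Sup {enat n | n. \<exists>u. (\<forall>i<n. u i \<in> eigenspace p \<Omega> \<Lambda>) \<and> independent_ae \<Omega> n u}"

text \<open>
  Each eigenvalue contributes as many summands as its multiplicity. The value in \<^typ>\<open>ennreal\<close>
  makes this meaningful without assuming beforehand that the spectrum is discrete.
\<close>

definition riesz_mean :: "nat \<Rightarrow> (real^3) set \<Rightarrow> real \<Rightarrow> ennreal" where
  "riesz_mean p \<Omega> z =
     (\<Sum>\<^sub>\<infinity>(\<Lambda>, k) \<in> {(\<Lambda>, k). dirichlet_eigenvalue p \<Omega> \<Lambda> \<and> enat k < eig_mult p \<Omega> \<Lambda>}.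
        ennreal (max (z - \<Lambda>) 0))"

text \<open>
  For any enumeration of the eigenvalues in nondecreasing order, counted with multiplicity, this
  is the sum over the enumeration.
\<close>

definition eigenvalue_sequence :: "nat \<Rightarrow> (real^3) set \<Rightarrow> (nat \<Rightarrow> real) \<Rightarrow> bool" where
  "eigenvalue_sequence p \<Omega> \<Lambda> \<longleftrightarrow> mono \<Lambda> \<and> (\<forall>j. dirichlet_eigenvalue p \<Omega> (\<Lambda> j)) \<and>
     (\<forall>\<mu>. dirichlet_eigenvalue p \<Omega> \<mu> \<longrightarrow>
        finite {j. \<Lambda> j = \<mu>} \<and> enat (card {j. \<Lambda> j = \<mu>}) = eig_mult p \<Omega> \<mu>)"

lemma riesz_mean_eq_suminf:
  assumes "eigenvalue_sequence p \<Omega> \<Lambda>"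
  shows "riesz_mean p \<Omega> z = (\<Sum>j. ennreal (max (z - \<Lambda> j) 0))"
proof -
  define J where "J = {(\<mu>, k). dirichlet_eigenvalue p \<Omega> \<mu> \<and> enat k < eig_mult p \<Omega> \<mu>}"
  define r where "r j = card {i. i < j \<and> \<Lambda> i = \<Lambda> j}" for j
  have ev: "dirichlet_eigenvalue p \<Omega> (\<Lambda> j)" for j
    using assms by (simp add: eigenvalue_sequence_def)
  have fin: "finite {j. \<Lambda> j = \<mu>}" and mult: "enat (card {j. \<Lambda> j = \<mu>}) = eig_mult p \<Omega> \<mu>"
    if "dirichlet_eigenvalue p \<Omega> \<mu>" for \<mu>
    using assms that by (simp_all add: eigenvalue_sequence_def)
  have r_less: "r i < r j" if "i < j" "\<Lambda> i = \<Lambda> j" for i j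
    unfolding r_def using that by (intro psubset_card_mono) auto
  have r_bound: "r j < card {i. \<Lambda> i = \<Lambda> j}" for j
    unfolding r_def using fin[OF ev[of j]] by (intro psubset_card_mono) auto
  have inj_r: "inj_on r {j. \<Lambda> j = \<mu>}" for \<mu>
    by (rule linorder_inj_onI') (use r_less in fastforce)
  have img_r: "r ` {j. \<Lambda> j = \<mu>} = {..<card {j. \<Lambda> j = \<mu>}}"
    if "dirichlet_eigenvalue p \<Omega> \<mu>" for \<mu>
    using r_bound inj_r by (intro card_subset_eq) (auto simp: card_image)
  have "bij_betw (\<lambda>j. (\<Lambda> j, r j)) UNIV J"
  proof (rule bij_betwI')
    fix i j show "(\<Lambda> i, r i) = (\<Lambda> j, r j) \<longleftrightarrow> i = j"
      using inj_r[of "\<Lambda> j"] by (auto simp: inj_on_def)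
  next
    fix j show "(\<Lambda> j, r j) \<in> J"
      using r_bound[of j] ev[of j] by (auto simp: J_def simp flip: mult)
  next
    fix y assume "y \<in> J"
    then obtain \<mu> k where y: "y = (\<mu>, k)" and \<mu>: "dirichlet_eigenvalue p \<Omega> \<mu>"
      and "enat k < eig_mult p \<Omega> \<mu>"
      by (auto simp: J_def)
    then have "k \<in> r ` {j. \<Lambda> j = \<mu>}"
      by (simp add: img_r flip: mult)
    then show "\<exists>j\<in>UNIV. y = (\<Lambda> j, r j)"
      using y by auto
  qed
  from infsum_reindex_bij_betw[OF this, of "\<lambda>(\<mu>, k). ennreal (max (z - \<mu>) 0)"]
  have "riesz_mean p \<Omega> z = (\<Sum>\<^sub>\<infinity>j. ennreal (max (z - \<Lambda> j) 0))"
    by (simp add: riesz_mean_def J_def)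
  also have "\<dots> = (\<Sum>j. ennreal (max (z - \<Lambda> j) 0))"
    by (intro sums_unique has_sum_imp_sums has_sum_infsum nonneg_summable_on_complete) simp
  finally show ?thesis .
qed

end

theory Submission
  imports Defs
begin

text \<open>
  Write \<open>\<lambda>\<^sub>l = l (l + 1)\<close> and let \<open>\<Pi>\<^sub>l\<close> be the orthogonal projection of \<open>L\<^sup>2\<close> of the sphere onto
  the spherical harmonics of degree \<open>l\<close>. Its kernel is \<open>(2 l + 1) / (4 \<pi>)\<close> times the Legendre
  polynomial \<open>P\<^sub>l\<close> of \<open>x \<bullet> y\<close>, which on the diagonal is the constant \<open>(2 l + 1) / (4 \<pi>)\<close>. Extend the
  eigenfunctions by zero to the sphere. By Bessel's inequality, applied to the kernel at each point,
  every orthonormal family \<open>u\<^sub>j\<close> of \<open>L\<^sup>2(\<Omega>)\<close> satisfies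
  \<open>\<Sum>\<^sub>j \<parallel>\<Pi>\<^sub>l u\<^sub>j\<parallel>\<^sup>2 \<le> (2 l + 1) |\<Omega>| / (4 \<pi>)\<close> (\<open>trace_bound\<close>).

  For a single \<open>u\<close> the quantity \<open>z \<parallel>u\<parallel>\<^sup>2\<close> minus the energy of \<open>u\<close> is the sum of
  \<open>(z - \<lambda>\<^sub>l\<^sup>p) \<parallel>\<Pi>\<^sub>l u\<parallel>\<^sup>2\<close>, by Parseval's identity. Dropping the negative terms bounds the Riesz mean
  by \<open>|\<Omega>| / (4 \<pi>)\<close> times the sum of \<open>(2 l + 1) (z - \<lambda>\<^sub>l\<^sup>p)\<^sub>+\<close>. As \<open>2 l + 1\<close> is half the distance
  from \<open>\<lambda>\<^sub>l\<^sub>-\<^sub>1\<close> to \<open>\<lambda>\<^sub>l\<^sub>+\<^sub>1\<close>, this sum is the trapezoidal rule with nodes \<open>\<lambda>\<^sub>l\<close> for the integral of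
  \<open>(z - s\<^sup>p)\<^sub>+\<close>. The integral is the Weyl term of the theorem, but the rule overestimates it on the
  one interval in which the function has its kink.

  The hemisphere removes this excess. Since \<open>\<Omega>\<close> and \<open>-\<Omega>\<close> are disjoint, \<open>u\<close> is orthogonal to
  \<open>u \<circ> (-1)\<close>, that is, the alternating sum of \<open>\<parallel>\<Pi>\<^sub>l u\<parallel>\<^sup>2\<close> vanishes, and any multiple \<open>\<mu>\<close> of it may be
  added (\<open>spectral_inequality\<close>). Let \<open>\<lambda>\<^sub>M\<^sup>p\<close> be the level nearest to \<open>z\<close> and choose \<open>\<mu>\<close> so that the
  coefficient of degree \<open>M\<close> becomes zero; the other coefficients keep their signs because their
  distance to zero was at least \<open>|\<mu>|\<close>. The alternating sum of the \<open>2 l + 1\<close> over \<open>l < M\<close> is \<open>M\<close> up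
  to sign, so what remains is exactly the trapezoidal rule on \<open>[0, \<lambda>\<^sub>M]\<close> for the function
  \<open>z - s\<^sup>p\<close>, without positive part. This function is concave, so the rule is at most its integral
  over \<open>[0, \<lambda>\<^sub>M]\<close>, which is at most the integral up to its zero (\<open>cutoff_exists\<close>).

  The remaining work is to make these identities available for weak eigenfunctions. Differentiating
  the rotation invariance of the surface measure yields the divergence theorem \<open>int_S2_sderiv\<close> and
  Green's formula; Legendre's equation and rotation invariance yield the reproducing property
  \<open>legendre_poly_reproducing\<close>; the kernels \<open>((1 + x \<bullet> y) / 2)\<^sup>n\<close> form an approximate identity and yield
  \<open>parseval\<close>. Uniqueness of weak derivatives (\<open>fundamental_lemma\<close>) makes the forms bilinear on
  Sobolev functions, so that the inequality passes from test functions to linear combinations of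
  eigenfunctions (\<open>approximable_spectral\<close>), in particular to orthonormal ones.
\<close>

section \<open>Smooth functions on open sets\<close>

text \<open>
  The iterated derivatives are taken at all points but enter only at points of the open set.
\<close>

lemma Ck_on_cong:
  assumes "open S" "\<And>x. x \<in> S \<Longrightarrow> f x = g x" "Ck_on k S f"
  shows "Ck_on k S g"
  using assms(2,3)
proof (induction k arbitrary: f g)
  case 0 then show ?case using continuous_on_cong by fastforce
next
  case (Suc k)
  have eq: "frechet_derivative f (at x) = frechet_derivative g (at x)" if "x \<in> S" for x
    using Suc.prems that assms(1)
    by (intro frechet_derivative_transform_within_open[of f x S])
      (auto simp: differentiable_on_def at_within_open[OF _ assms(1)])
  have "g differentiable_on S"
    using Suc.prems by (fastforce simp: differentiable_on_def intro: differentiable_transform_within[where d = 1])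
  moreover have "Ck_on k S (\<lambda>x. frechet_derivative g (at x) b)" if "b \<in> Basis" for b
    by (rule Suc.IH[where f = "\<lambda>x. frechet_derivative f (at x) b"]) (use Suc.prems that eq in auto)
  ultimately show ?case by simp
qed

lemma Ck_on_SucI:
  assumes "open S" "\<And>x. x \<in> S \<Longrightarrow> (f has_derivative D x) (at x)"
    and "\<And>b. b \<in> Basis \<Longrightarrow> Ck_on k S (\<lambda>x. D x b)"
  shows "Ck_on (Suc k) S f"
proof -
  have "f differentiable_on S"
    using assms(2) differentiable_at_imp_differentiable_on differentiable_def by blast
  moreover have "Ck_on k S (\<lambda>x. frechet_derivative f (at x) b)" if "b \<in> Basis" for b
    by (rule Ck_on_cong[OF assms(1) _ assms(3)[OF that]])
      (use frechet_derivative_at[OF assms(2)] in simp)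
  ultimately show ?thesis by simp
qed

lemma Ck_on_SucD:
  assumes "open S" "Ck_on (Suc k) S f"
  shows "x \<in> S \<Longrightarrow> (f has_derivative frechet_derivative f (at x)) (at x)"
    and "b \<in> Basis \<Longrightarrow> Ck_on k S (\<lambda>x. frechet_derivative f (at x) b)"
proof -
  assume x: "x \<in> S"
  then have "f differentiable (at x)"
    using assms(2) at_within_open[OF x assms(1)] by (auto simp: differentiable_on_def)
  then show "(f has_derivative frechet_derivative f (at x)) (at x)"
    by (simp add: frechet_derivative_works)
qed (use assms in simp)

lemma Ck_on_lower: "Ck_on (Suc k) S f \<Longrightarrow> Ck_on k S f"
  by (induction k arbitrary: f) (auto simp: differentiable_imp_continuous_on)

lemma Ck_on_const: "open S \<Longrightarrow> Ck_on k S (\<lambda>x. c)"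
proof (induction k arbitrary: c)
  case (Suc k)
  show ?case by (rule Ck_on_SucI[where D = "\<lambda>x h. 0"]) (use Suc in auto)
qed simp

lemma Ck_on_add:
  assumes "open S" "Ck_on k S f" "Ck_on k S g"
  shows "Ck_on k S (\<lambda>x. f x + g x)"
  using assms(2,3)
proof (induction k arbitrary: f g)
  case (Suc k)
  show ?case
  proof (rule Ck_on_SucI[where D = "\<lambda>x h. frechet_derivative f (at x) h + frechet_derivative g (at x) h"])
    fix x assume x: "x \<in> S"
    show "((\<lambda>x. f x + g x) has_derivative (\<lambda>h. frechet_derivative f (at x) h +
        frechet_derivative g (at x) h)) (at x)"
      by (rule has_derivative_add) (rule Ck_on_SucD(1)[OF assms(1)], fact, fact)+
  next
    fix b :: 'a assume b: "b \<in> Basis"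
    show "Ck_on k S (\<lambda>x. frechet_derivative f (at x) b + frechet_derivative g (at x) b)"
      by (intro Suc.IH Ck_on_SucD(2)[OF assms(1)] Suc.prems b)
  qed (rule assms(1))
qed (auto intro: continuous_intros)

lemma Ck_on_mult:
  assumes "open S" "Ck_on k S f" "Ck_on k S g"
  shows "Ck_on k S (\<lambda>x. f x * g x)"
  using assms(2,3)
proof (induction k arbitrary: f g)
  case (Suc k)
  show ?case
  proof (rule Ck_on_SucI[where D = "\<lambda>x h. f x * frechet_derivative g (at x) h + frechet_derivative f (at x) h * g x"])
    fix b :: 'a assume b: "b \<in> Basis"
    show "Ck_on k S (\<lambda>x. f x * frechet_derivative g (at x) b + frechet_derivative f (at x) b * g x)"
      by (intro Ck_on_add[OF assms(1)] Suc.IH Ck_on_SucD(2)[OF assms(1)] Suc.prems b)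
        (rule Ck_on_lower, rule Suc.prems)+
  next
    fix x assume x: "x \<in> S"
    show "((\<lambda>x. f x * g x) has_derivative (\<lambda>h. f x * frechet_derivative g (at x) h +
        frechet_derivative f (at x) h * g x)) (at x)"
      by (rule has_derivative_mult) (rule Ck_on_SucD(1)[OF assms(1)], fact, fact)+
  qed (rule assms(1))
qed (auto intro: continuous_intros)

text \<open>
  A one-variable smooth function is given by the sequence of its derivatives, so that one
  induction covers all of them.
\<close>

lemma Ck_on_compose:
  fixes h :: "nat \<Rightarrow> real \<Rightarrow> real"
  assumes "open S" "\<And>n s. s \<in> U \<Longrightarrow> (h n has_real_derivative h (Suc n) s) (at s)"
    and "f ` S \<subseteq> U" "Ck_on k S f"
  shows "Ck_on k S (\<lambda>x. h n (f x))"
  using assms(4)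
proof (induction k arbitrary: n)
  case 0
  have "continuous_on U (h n)"
    using assms(2) DERIV_isCont continuous_at_imp_continuous_on by blast
  then show ?case using 0 assms(3) continuous_on_compose2 by auto
next
  case (Suc k)
  show ?case
  proof (rule Ck_on_SucI[where D = "\<lambda>x b. h (Suc n) (f x) * frechet_derivative f (at x) b"])
    fix x assume x: "x \<in> S"
    show "((\<lambda>x. h n (f x)) has_derivative (\<lambda>b. h (Suc n) (f x) * frechet_derivative f (at x) b)) (at x)"
      using has_derivative_compose[OF Ck_on_SucD(1)[OF assms(1) Suc.prems x], of "h n" "\<lambda>y. h (Suc n) (f x) * y"]
        assms(2)[of "f x" n] assms(3) x by (auto simp: has_field_derivative_def)
  next
    fix b :: 'a assume b: "b \<in> Basis"
    have "Ck_on k S f" by (rule Ck_on_lower[OF Suc.prems])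
    then have "Ck_on k S (\<lambda>x. h (Suc n) (f x))" by (rule Suc.IH)
    moreover have "Ck_on k S (\<lambda>x. frechet_derivative f (at x) b)"
      by (rule Ck_on_SucD(2)[OF assms(1) Suc.prems b])
    ultimately show "Ck_on k S (\<lambda>x. h (Suc n) (f x) * frechet_derivative f (at x) b)"
      by (rule Ck_on_mult[OF assms(1)])
  qed (rule assms(1))
qed

lemma smooth_on_cong:
  "open S \<Longrightarrow> (\<And>x. x \<in> S \<Longrightarrow> f x = g x) \<Longrightarrow> smooth_on S f \<Longrightarrow> smooth_on S g"
  unfolding smooth_on_def by (metis Ck_on_cong)

lemma smooth_on_const: "open S \<Longrightarrow> smooth_on S (\<lambda>x. c)"
  by (simp add: smooth_on_def Ck_on_const)

lemma smooth_on_add: "open S \<Longrightarrow> smooth_on S f \<Longrightarrow> smooth_on S g \<Longrightarrow> smooth_on S (\<lambda>x. f x + g x)"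
  by (simp add: smooth_on_def Ck_on_add)

lemma smooth_on_mult: "open S \<Longrightarrow> smooth_on S f \<Longrightarrow> smooth_on S g \<Longrightarrow> smooth_on S (\<lambda>x. f x * g x)"
  by (simp add: smooth_on_def Ck_on_mult)

lemma smooth_on_compose:
  fixes h :: "nat \<Rightarrow> real \<Rightarrow> real"
  assumes "open S" "\<And>n s. s \<in> U \<Longrightarrow> (h n has_real_derivative h (Suc n) s) (at s)"
    and "f ` S \<subseteq> U" "smooth_on S f"
  shows "smooth_on S (\<lambda>x. h n (f x))"
    unfolding smooth_on_def
proof
  fix k
  show "Ck_on k S (\<lambda>x. h n (f x))"
    by (rule Ck_on_compose[where h = h and U = U]) (use assms in \<open>auto simp: smooth_on_def\<close>)
qed

lemma smooth_on_bounded_linear: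
  assumes "open S" "bounded_linear f" shows "smooth_on S f"
proof -
  have "Ck_on k S f" for k
  proof (cases k)
    case 0 then show ?thesis using assms by (simp add: linear_continuous_on)
  next
    case (Suc j)
    show ?thesis unfolding Suc
      by (rule Ck_on_SucI[where D = "\<lambda>x. f"])
        (use assms bounded_linear_imp_has_derivative Ck_on_const in auto)
  qed
  then show ?thesis by (simp add: smooth_on_def)
qed

lemma smooth_on_has_derivative:
  "open S \<Longrightarrow> smooth_on S f \<Longrightarrow> x \<in> S \<Longrightarrow> (f has_derivative frechet_derivative f (at x)) (at x)"
  unfolding smooth_on_def using Ck_on_SucD(1) by blast

lemma smooth_on_frechet_derivative:
  "open S \<Longrightarrow> smooth_on S f \<Longrightarrow> b \<in> Basis \<Longrightarrow> smooth_on S (\<lambda>x. frechet_derivative f (at x) b)"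
  unfolding smooth_on_def using Ck_on_SucD(2) by blast

lemma smooth_on_continuous: "smooth_on S f \<Longrightarrow> continuous_on S f"
  unfolding smooth_on_def using Ck_on.simps(1) by blast

lemma smooth_on_sum:
  "open S \<Longrightarrow> (\<And>i. i \<in> I \<Longrightarrow> smooth_on S (f i)) \<Longrightarrow> smooth_on S (\<lambda>x. \<Sum>i\<in>I. f i x)"
  by (induction I rule: infinite_finite_induct) (auto simp: smooth_on_const smooth_on_add)

text \<open>
  The function is a power of the quadratic form \<open>x \<bullet> x\<close>; powers of positive numbers have all
  derivatives explicitly.
\<close>

lemma smooth_on_norm_powr: "smooth_on (- {0}) (\<lambda>x::'a::euclidean_space. norm x powr a)"
proof -
  define h :: "nat \<Rightarrow> real \<Rightarrow> real" where "h n s = (\<Prod>i<n. a / 2 - real i) * s powr (a / 2 - real n)" for n s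
  have h: "(h n has_real_derivative h (Suc n) s) (at s)" if "s \<in> {0<..}" for n s
  proof -
    have "((\<lambda>s. (\<Prod>i<n. a / 2 - real i) * s powr (a / 2 - real n)) has_real_derivative
       (\<Prod>i<n. a / 2 - real i) * ((a / 2 - real n) * s powr (a / 2 - real n - 1))) (at s)"
      using that by (intro DERIV_cmult has_real_derivative_powr) auto
    then show ?thesis unfolding h_def by (simp add: algebra_simps)
  qed
  have sq: "smooth_on (- {0}) (\<lambda>x::'a. \<Sum>b\<in>Basis. (x \<bullet> b) * (x \<bullet> b))"
    by (intro smooth_on_sum smooth_on_mult smooth_on_bounded_linear bounded_linear_inner_left) auto
  have "smooth_on (- {0}) (\<lambda>x::'a. h 0 (\<Sum>b\<in>Basis. (x \<bullet> b) * (x \<bullet> b)))"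
    by (rule smooth_on_compose[where h = h and U = "{0<..}"])
      (use h sq in \<open>auto simp: euclidean_inner[symmetric] dot_square_norm\<close>)
  moreover have "h 0 (\<Sum>b\<in>Basis. (x \<bullet> b) * (x \<bullet> b)) = norm x powr a" if "x \<noteq> 0" for x :: 'a
  proof -
    have "(\<Sum>b\<in>Basis. (x \<bullet> b) * (x \<bullet> b)) = (norm x)\<^sup>2"
      by (simp add: euclidean_inner[symmetric] dot_square_norm)
    then show ?thesis using powr_powr[of "norm x" 2 "a / 2"] that by (simp add: h_def)
  qed
  ultimately show ?thesis
    by (intro smooth_on_cong[where f = "\<lambda>x. h 0 (\<Sum>b\<in>Basis. (x \<bullet> b) * (x \<bullet> b))" and g = "\<lambda>x. norm x powr a"]) auto
qed

section \<open>Integration over the sphere\<close>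

lemma S2_iff: "x \<in> S2 \<longleftrightarrow> norm x = 1"
  by (simp add: S2_def)

lemma proj_S2: "x \<noteq> 0 \<Longrightarrow> x /\<^sub>R norm x \<in> S2"
  by (simp add: S2_iff)

lemma compact_S2: "compact S2"
  by (simp add: S2_def)

lemma S2_borel [measurable]: "S2 \<in> sets borel"
  by (simp add: S2_def)

lemma space_surf [simp]: "space surf = UNIV" and sets_surf [measurable_cong, simp]: "sets surf = sets borel"
  by (simp_all add: surf_def)

lemma radial_proj_measurable [measurable]: "(\<lambda>x. x /\<^sub>R norm x) \<in> borel_measurable (borel :: (real^3) measure)"
  by measurable

lemma radial_preimage_borel:
  assumes "A \<in> sets borel"
  shows "{x \<in> ball 0 1. (x::real^3) /\<^sub>R norm x \<in> A} \<in> sets borel"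
proof -
  have "{x \<in> ball 0 1. (x::real^3) /\<^sub>R norm x \<in> A} = ball 0 1 \<inter> ((\<lambda>x. x /\<^sub>R norm x) -` A \<inter> space borel)" by auto
  then show ?thesis using measurable_sets[OF radial_proj_measurable assms] by simp
qed

lemma emeasure_surf:
  assumes [measurable]: "A \<in> sets borel"
  shows "emeasure surf A = 3 * emeasure lborel {x \<in> ball 0 1. x /\<^sub>R norm x \<in> A}"
proof -
  define B where "B = {x \<in> ball 0 1. (x::real^3) /\<^sub>R norm x \<in> A}"
  have [measurable]: "B \<in> sets borel"
    unfolding B_def by (rule radial_preimage_borel[OF assms])
  have "emeasure surf A = emeasure (density lborel (\<lambda>x. 3 * indicator (ball 0 1) x)) ((\<lambda>x. x /\<^sub>R norm x) -` A)"
    unfolding surf_def by (subst emeasure_distr) auto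
  also have "\<dots> = (\<integral>\<^sup>+x. 3 * indicator (ball 0 1) x * indicator ((\<lambda>x. x /\<^sub>R norm x) -` A) x \<partial>lborel)"
    using measurable_sets[OF radial_proj_measurable assms] by (subst emeasure_density) (auto simp: indicator_def)
  also have "\<dots> = (\<integral>\<^sup>+x. 3 * indicator B x \<partial>lborel)"
    by (intro nn_integral_cong) (auto simp: B_def indicator_def)
  also have "\<dots> = 3 * emeasure lborel B"
    by (subst nn_integral_cmult) auto
  finally show ?thesis by (simp add: B_def)
qed

text \<open>
  The factor \<open>3\<close> in the definition turns the volume \<open>4 \<pi> / 3\<close> of the unit ball into the area.
\<close>

lemma emeasure_surf_UNIV: "emeasure surf UNIV = ennreal (4 * pi)"
proof -
  have "emeasure surf UNIV = 3 * emeasure lborel (ball (0::real^3) 1)"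
    by (subst emeasure_surf) (simp_all add: ball_def)
  also have "\<dots> = 3 * ennreal (4 / 3 * pi)"
  proof -
    have "unit_ball_vol 3 * 3 = pi * 4"
      using unit_ball_vol_odd'[of 1] by (simp add: pochhammer_rec numeral_3_eq_3 eval_nat_numeral)
    then have v: "unit_ball_vol 3 = 4 / 3 * pi" by simp
    show ?thesis by (simp add: emeasure_ball v)
  qed
  also have "\<dots> = ennreal 3 * ennreal (4 / 3 * pi)" by simp
  also have "\<dots> = ennreal (4 * pi)"
    by (subst ennreal_mult[symmetric]) auto
  finally show ?thesis .
qed

lemma finite_measure_surf: "finite_measure surf"
  by standard (simp add: emeasure_surf_UNIV)

interpretation surf: finite_measure surf by (rule finite_measure_surf)

lemma measure_surf_UNIV: "measure surf UNIV = 4 * pi"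
  by (simp add: measure_def emeasure_surf_UNIV)

lemma AE_S2: "AE x in surf. x \<in> S2"
proof (rule AE_I[of _ _ "-S2"])
  have "{x \<in> ball 0 1. x /\<^sub>R norm x \<in> - S2} \<subseteq> {0 :: real^3}"
    using proj_S2 by auto
  then have "emeasure lborel {x \<in> ball 0 1. (x::real^3) /\<^sub>R norm x \<in> - S2} = 0"
    by (intro null_setsD1 finite_imp_null_set_lborel) (rule finite_subset, auto)
  then show "emeasure surf (- S2) = 0"
    by (subst emeasure_surf) (auto simp: sets.compl_sets)
qed (auto simp: S2_borel)

text \<open>The cone over a relatively open set contains a nonempty open set of the ball.\<close>

lemma emeasure_surf_open_pos:
  assumes "open U" "U \<inter> S2 \<noteq> {}"
  shows "emeasure surf U > 0"
proof -
  obtain w where w: "w \<in> U" "norm w = 1" using assms by (auto simp: S2_iff)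
  have o: "open {x \<in> ball 0 1 - {0}. x /\<^sub>R norm x \<in> U}"
  proof -
    have "continuous_on (ball 0 1 - {0}) (\<lambda>x::real^3. x /\<^sub>R norm x)"
      by (intro continuous_intros) auto
    from continuous_open_preimage[OF this _ assms(1)] show ?thesis
      by (simp add: open_delete vimage_def Int_def conj_commute)
  qed
  have "w /\<^sub>R 2 \<in> {x \<in> ball 0 1 - {0}. x /\<^sub>R norm x \<in> U}" using w by auto
  then have nn: "\<not> negligible {x \<in> ball 0 1 - {0}. x /\<^sub>R norm x \<in> U}"
    using o open_not_negligible by blast
  have "emeasure surf U \<noteq> 0"
  proof
    assume "emeasure surf U = 0"
    then have "emeasure lborel {x \<in> ball 0 1. x /\<^sub>R norm x \<in> U} = 0"
      using assms(1) by (simp add: emeasure_surf)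
    then have "{x \<in> ball 0 1. x /\<^sub>R norm x \<in> U} \<in> null_sets lborel"
      using radial_preimage_borel[of U] assms(1) by (auto simp: null_sets_def)
    then have "negligible {x \<in> ball 0 1. x /\<^sub>R norm x \<in> U}"
      by (simp add: negligible_iff_null_sets null_sets_completionI)
    then have "negligible {x \<in> ball 0 1 - {0}. x /\<^sub>R norm x \<in> U}"
      by (rule negligible_subset) auto
    then show False using nn by simp
  qed
  then show ?thesis by (simp add: zero_less_iff_neq_zero)
qed

text \<open>
  Radial projection commutes with linear isometries, and these preserve Lebesgue measure.
\<close>

lemma distr_surf_orth:
  assumes "orthogonal_transformation T"
  shows "distr surf borel T = surf"
proof (rule measure_eqI)
  have lin: "linear T" and nT: "norm (T x) = norm x" for x
    using assms by (auto simp: orthogonal_transformation)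
  have [measurable]: "T \<in> borel_measurable borel"
    using lin by (simp add: borel_measurable_continuous_onI linear_continuous_on linear_conv_bounded_linear)
  fix A assume "A \<in> sets (distr surf borel T)"
  then have A[measurable]: "A \<in> sets borel" by simp
  define B where "B A = {x \<in> ball 0 1. (x::real^3) /\<^sub>R norm x \<in> A}" for A
  have TA: "T -` A \<in> sets borel"
    using measurable_sets[OF \<open>T \<in> borel_measurable borel\<close> A] by simp
  have Bm: "B A \<in> sets borel" if "A \<in> sets borel" for A
    unfolding B_def by (rule radial_preimage_borel[OF that])
  have lm: "B A \<in> lmeasurable" if "A \<in> sets borel" for A
    by (rule fmeasurableI2[of "ball 0 1"]) (use Bm[OF that] in \<open>auto simp: B_def\<close>)
  have em: "emeasure lborel (B A) = ennreal (measure lebesgue (B A))" if "A \<in> sets borel" for A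
  proof -
    have "emeasure lborel (B A) = emeasure lebesgue (B A)"
      using Bm[OF that] by simp
    also have "\<dots> = ennreal (measure lebesgue (B A))"
      by (rule emeasure_eq_measure2[OF lm[OF that]])
    finally show ?thesis .
  qed
  have "B A = T ` B (T -` A)"
  proof (intro equalityI subsetI)
    fix y assume y: "y \<in> B A"
    obtain x where "y = T x" using assms orthogonal_transformation_surj by blast
    then show "y \<in> T ` B (T -` A)" using y nT lin by (auto simp: B_def linear_scale)
  next
    fix y assume "y \<in> T ` B (T -` A)"
    then show "y \<in> B A" using nT lin by (auto simp: B_def linear_scale)
  qed
  then have "measure lebesgue (B A) = measure lebesgue (B (T -` A))"
    using measure_orthogonal_image[OF assms lm[OF TA]] by simp
  then have "emeasure surf (T -` A) = emeasure surf A"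
    unfolding emeasure_surf[OF A] emeasure_surf[OF TA] B_def[symmetric] em[OF A] em[OF TA] by simp
  then show "emeasure (distr surf borel T) A = emeasure surf A"
    by (simp add: emeasure_distr)
qed simp

definition int_S2 :: "(real^3 \<Rightarrow> real) \<Rightarrow> real" where
  "int_S2 f = (LINT x:S2|surf. f x)"

lemma int_S2_cong: "(\<And>x. x \<in> S2 \<Longrightarrow> f x = g x) \<Longrightarrow> int_S2 f = int_S2 g"
  unfolding int_S2_def by (rule set_lebesgue_integral_cong) auto

lemma S2_set_measurable:
  "continuous_on S2 f \<Longrightarrow> set_borel_measurable surf S2 (f :: real^3 \<Rightarrow> real)"
  unfolding set_borel_measurable_def
  using borel_measurable_continuous_on_indicator[OF S2_borel, of f]
  by (simp add: measurable_cong_sets[OF sets_surf refl])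

lemma S2_set_integrable:
  assumes "continuous_on S2 f"
  shows "set_integrable surf S2 (f :: real^3 \<Rightarrow> real)"
proof -
  obtain B where B: "\<And>x. x \<in> S2 \<Longrightarrow> norm (f x) \<le> B"
    using compact_continuous_image[OF assms compact_S2] compact_imp_bounded
    by (metis bounded_iff imageI)
  show ?thesis unfolding set_integrable_def
  proof (rule surf.integrable_const_bound[of _ "\<bar>B\<bar>"])
    show "AE x in surf. norm (indicat_real S2 x *\<^sub>R f x) \<le> \<bar>B\<bar>"
      using B by (force simp: indicator_def)
  qed (use S2_set_measurable[OF assms] in \<open>simp add: set_borel_measurable_def\<close>)
qed

lemma int_S2_add: "continuous_on S2 f \<Longrightarrow> continuous_on S2 g \<Longrightarrow> int_S2 (\<lambda>x. f x + g x) = int_S2 f + int_S2 g"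
  unfolding int_S2_def by (intro set_integral_add S2_set_integrable)

lemma int_S2_diff: "continuous_on S2 f \<Longrightarrow> continuous_on S2 g \<Longrightarrow> int_S2 (\<lambda>x. f x - g x) = int_S2 f - int_S2 g"
  unfolding int_S2_def by (intro set_integral_diff S2_set_integrable)

lemma int_S2_cmult: "int_S2 (\<lambda>x. c * f x) = c * int_S2 f"
  unfolding int_S2_def by simp

lemma int_S2_uminus: "int_S2 (\<lambda>x. - f x) = - int_S2 f"
  using int_S2_cmult[of "-1" f] by simp

lemma int_S2_sum: "(\<And>i. i \<in> I \<Longrightarrow> continuous_on S2 (f i)) \<Longrightarrow> int_S2 (\<lambda>x. \<Sum>i\<in>I. f i x) = (\<Sum>i\<in>I. int_S2 (f i))"
proof (induction I rule: infinite_finite_induct)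
  case (insert i I)
  then show ?case by (simp add: int_S2_add continuous_on_sum)
qed (simp_all add: int_S2_def)

lemma int_S2_mono:
  assumes "continuous_on S2 f" "continuous_on S2 g" "\<And>x. x \<in> S2 \<Longrightarrow> f x \<le> g x"
  shows "int_S2 f \<le> int_S2 g"
  using S2_set_integrable[OF assms(1)] S2_set_integrable[OF assms(2)] assms(3)
  unfolding int_S2_def by (rule set_integral_mono)

lemma int_S2_nonneg: "(\<And>x. x \<in> S2 \<Longrightarrow> 0 \<le> f x) \<Longrightarrow> 0 \<le> int_S2 f"
  unfolding int_S2_def set_lebesgue_integral_def by (rule integral_nonneg_AE) (auto simp: indicator_def)

lemma int_S2_const: "int_S2 (\<lambda>x. c) = 4 * pi * c"
proof -
  have "measure surf S2 = measure surf UNIV"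
    by (rule measure_eq_AE) (use AE_S2 in auto)
  then show ?thesis
    by (simp add: int_S2_def set_lebesgue_integral_def measure_surf_UNIV)
qed

lemma int_S2_orth:
  assumes "orthogonal_transformation T" "continuous_on S2 f"
  shows "int_S2 (\<lambda>x. f (T x)) = int_S2 f"
proof -
  have nT: "norm (T x) = norm x" and lin: "linear T" for x
    using assms(1) by (auto simp: orthogonal_transformation)
  have Tm: "T \<in> measurable surf borel"
    using lin by (simp add: measurable_cong_sets[OF sets_surf refl] borel_measurable_continuous_onI
        linear_continuous_on linear_conv_bounded_linear)
  have "int_S2 f = integral\<^sup>L (distr surf borel T) (\<lambda>x. indicator S2 x *\<^sub>R f x)"
    by (simp add: distr_surf_orth[OF assms(1)] int_S2_def set_lebesgue_integral_def)
  also have "\<dots> = (\<integral>x. indicator S2 (T x) *\<^sub>R f (T x) \<partial>surf)"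
    by (rule integral_distr[OF Tm])
      (rule borel_measurable_continuous_on_indicator[OF S2_borel assms(2)])
  also have "\<dots> = int_S2 (\<lambda>x. f (T x))"
    by (simp add: int_S2_def set_lebesgue_integral_def S2_iff nT indicator_def)
  finally show ?thesis by simp
qed

lemma int_S2_eq_0_imp:
  assumes "continuous_on S2 f" "\<And>x. x \<in> S2 \<Longrightarrow> 0 \<le> f x" "int_S2 f = 0" "x \<in> S2"
  shows "f x = 0"
proof (rule ccontr)
  assume "f x \<noteq> 0"
  then have "0 < f x" using assms by force
  have "openin (top_of_set S2) (S2 \<inter> f -` {f x / 2<..})"
    using continuous_openin_preimage_gen[OF assms(1)] by auto
  then obtain U where U: "open U" "S2 \<inter> f -` {f x / 2<..} = S2 \<inter> U"
    by (auto simp: openin_open)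
  have "x \<in> U \<inter> S2" using U \<open>0 < f x\<close> assms(4) by auto
  then have pos: "emeasure surf U > 0" using emeasure_surf_open_pos[OF U(1)] by blast
  have "AE y in surf. indicator S2 y *\<^sub>R f y = 0"
  proof -
    have "AE y in surf. 0 \<le> indicator S2 y *\<^sub>R f y" using assms(2) by (auto simp: indicator_def)
    then show ?thesis
      using integral_nonneg_eq_0_iff_AE[of surf "\<lambda>y. indicator S2 y *\<^sub>R f y"] assms(3) S2_set_integrable[OF assms(1)]
      by (simp add: int_S2_def set_lebesgue_integral_def set_integrable_def)
  qed
  then have "AE y in surf. y \<notin> U"
    using AE_S2
  proof eventually_elim
    case (elim y)
    have "f x / 2 < f y" if "y \<in> U"
    proof -
      have "y \<in> S2 \<inter> f -` {f x / 2<..}" using that U(2) elim by auto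
      then show ?thesis by auto
    qed
    then show ?case using \<open>0 < f x\<close> elim by (auto simp: indicator_def)
  qed
  then have "emeasure surf U = 0"
    using AE_iff_measurable[of U surf "\<lambda>y. y \<notin> U"] U(1) by simp
  then show False using pos by simp
qed

lemma int_S2_limit:
  assumes "\<And>n. continuous_on S2 (f n)" "continuous_on S2 g"
    and "\<And>x. x \<in> S2 \<Longrightarrow> (\<lambda>n. f n x) \<longlonglongrightarrow> g x"
    and "\<And>n x. x \<in> S2 \<Longrightarrow> \<bar>f n x\<bar> \<le> B"
  shows "(\<lambda>n. int_S2 (f n)) \<longlonglongrightarrow> int_S2 g"
  unfolding int_S2_def set_lebesgue_integral_def
proof (rule integral_dominated_convergence[where w = "\<lambda>x. \<bar>B\<bar>"])
  show "(\<lambda>x. indicator S2 x *\<^sub>R g x) \<in> borel_measurable surf"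
    "(\<lambda>x. indicator S2 x *\<^sub>R f n x) \<in> borel_measurable surf" for n
    using S2_set_measurable[OF assms(1)] S2_set_measurable[OF assms(2)]
    by (auto simp: set_borel_measurable_def)
  show "AE x in surf. (\<lambda>n. indicator S2 x *\<^sub>R f n x) \<longlonglongrightarrow> indicator S2 x *\<^sub>R g x"
    by (rule AE_I2) (use assms(3) in \<open>auto simp: indicator_def\<close>)
  show "AE x in surf. norm (indicator S2 x *\<^sub>R f n x) \<le> \<bar>B\<bar>" for n
    by (rule AE_I2) (use assms(4)[of _ n] in \<open>force simp: indicator_def\<close>)
qed simp

section \<open>Differential calculus on the sphere\<close>

text \<open>
  Smoothness of the restriction to the sphere, expressed by the extension that is constant
  along rays.
\<close>

definition smooth_S2 :: "(real^3 \<Rightarrow> real) \<Rightarrow> bool" where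
  "smooth_S2 f \<longleftrightarrow> smooth_on (- {0}) (radial_ext f)"

lemma radial_ext_S2: "x \<in> S2 \<Longrightarrow> radial_ext f x = f x"
  by (simp add: radial_ext_def S2_iff)

lemma radial_ext_scale:
  assumes "c > 0" shows "radial_ext f (c *\<^sub>R x) = radial_ext f x"
proof -
  have "inverse (norm (c *\<^sub>R x)) * c = inverse (norm x)"
    using assms by (simp add: field_simps)
  then have "(c *\<^sub>R x) /\<^sub>R norm (c *\<^sub>R x) = x /\<^sub>R norm x" by (metis scaleR_scaleR)
  then show ?thesis by (simp only: radial_ext_def)
qed

lemma open_punctured: "open (- {0::real^3})"
  by (simp add: open_Compl)

lemma smooth_S2_const: "smooth_S2 (\<lambda>x. c)"
  by (simp add: smooth_S2_def radial_ext_def[abs_def] smooth_on_const[OF open_punctured])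

lemma smooth_S2_add: "smooth_S2 f \<Longrightarrow> smooth_S2 g \<Longrightarrow> smooth_S2 (\<lambda>x. f x + g x)"
  using smooth_on_add[OF open_punctured, of "radial_ext f" "radial_ext g"]
  by (simp add: smooth_S2_def radial_ext_def[abs_def])

lemma smooth_S2_mult: "smooth_S2 f \<Longrightarrow> smooth_S2 g \<Longrightarrow> smooth_S2 (\<lambda>x. f x * g x)"
  using smooth_on_mult[OF open_punctured, of "radial_ext f" "radial_ext g"]
  by (simp add: smooth_S2_def radial_ext_def[abs_def])

lemma smooth_S2_cmult: "smooth_S2 f \<Longrightarrow> smooth_S2 (\<lambda>x. c * f x)"
  by (intro smooth_S2_mult smooth_S2_const)

lemma smooth_S2_diff: "smooth_S2 f \<Longrightarrow> smooth_S2 g \<Longrightarrow> smooth_S2 (\<lambda>x. f x - g x)"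
  using smooth_S2_add[of f "\<lambda>x. - 1 * g x"] smooth_S2_cmult[of g "-1"] by simp

lemma smooth_S2_sum: "(\<And>i. i \<in> I \<Longrightarrow> smooth_S2 (f i)) \<Longrightarrow> smooth_S2 (\<lambda>x. \<Sum>i\<in>I. f i x)"
  by (induction I rule: infinite_finite_induct) (auto simp: smooth_S2_const smooth_S2_add)

lemma smooth_S2_prod: "(\<And>i. i \<in> I \<Longrightarrow> smooth_S2 (f i)) \<Longrightarrow> smooth_S2 (\<lambda>x. \<Prod>i\<in>I. f i x)"
  by (induction I rule: infinite_finite_induct) (auto simp: smooth_S2_const smooth_S2_mult)

lemma smooth_S2_compose:
  fixes h :: "nat \<Rightarrow> real \<Rightarrow> real"
  assumes "\<And>n s. (h n has_real_derivative h (Suc n) s) (at s)" "smooth_S2 f"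
  shows "smooth_S2 (\<lambda>x. h n (f x))"
  using smooth_on_compose[where h = h and U = UNIV and f = "radial_ext f", OF open_punctured] assms
  by (simp add: smooth_S2_def radial_ext_def[abs_def])

lemma smooth_S2_inner: "smooth_S2 (\<lambda>x. x \<bullet> w)"
proof -
  have "smooth_on (- {0}) (\<lambda>x::real^3. norm x powr (-1) * (x \<bullet> w))"
    by (intro smooth_on_mult smooth_on_norm_powr smooth_on_bounded_linear bounded_linear_inner_left) auto
  then show ?thesis unfolding smooth_S2_def
    by (rule smooth_on_cong[rotated 2]) (auto simp: radial_ext_def powr_minus)
qed

lemma smooth_S2_component: "smooth_S2 (\<lambda>x. x $ i)"
  using smooth_S2_inner[of "axis i 1"] by (simp add: inner_axis)

lemma smooth_S2_continuous:
  assumes "smooth_S2 f" shows "continuous_on S2 f"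
proof -
  have "continuous_on S2 (radial_ext f)"
    using smooth_on_continuous[of "- {0}" "radial_ext f"] assms
    by (rule_tac continuous_on_subset) (auto simp: smooth_S2_def S2_iff)
  then show ?thesis using radial_ext_S2 continuous_on_cong by fastforce
qed

lemma smooth_S2_has_derivative:
  assumes "smooth_S2 f" "x \<noteq> 0"
  shows "(radial_ext f has_derivative (\<lambda>h. \<Sum>i\<in>UNIV. h $ i * sderiv i f x)) (at x)"
proof -
  have D: "(radial_ext f has_derivative frechet_derivative (radial_ext f) (at x)) (at x)"
    using assms by (intro smooth_on_has_derivative[of "- {0}"]) (auto simp: smooth_S2_def)
  have lin: "linear (frechet_derivative (radial_ext f) (at x))"
    using D has_derivative_linear by blast
  have "frechet_derivative (radial_ext f) (at x) h = (\<Sum>i\<in>UNIV. h $ i * sderiv i f x)" for h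
  proof -
    have "h = (\<Sum>i\<in>UNIV. h $ i *\<^sub>R axis i 1)"
      using basis_expansion[of h] by (simp add: scalar_mult_eq_scaleR)
    then have "frechet_derivative (radial_ext f) (at x) h =
        frechet_derivative (radial_ext f) (at x) (\<Sum>i\<in>UNIV. h $ i *\<^sub>R axis i 1)" by simp
    also have "\<dots> = (\<Sum>i\<in>UNIV. h $ i * sderiv i f x)"
      by (simp add: linear_sum[OF lin] linear_scale[OF lin] sderiv_def)
    finally show ?thesis .
  qed
  then show ?thesis using D by presburger
qed

lemma sderivI:
  "(radial_ext f has_derivative D) (at x) \<Longrightarrow> sderiv i f x = D (axis i 1)"
  unfolding sderiv_def using frechet_derivative_at by metis

lemma sderiv_add:
  "smooth_S2 f \<Longrightarrow> smooth_S2 g \<Longrightarrow> x \<in> S2 \<Longrightarrow> sderiv i (\<lambda>x. f x + g x) x = sderiv i f x + sderiv i g x"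
proof -
  assume *: "smooth_S2 f" "smooth_S2 g" "x \<in> S2"
  then have x: "x \<noteq> 0" by (auto simp: S2_iff)
  have "(radial_ext (\<lambda>x. f x + g x) has_derivative
      (\<lambda>h. (\<Sum>i\<in>UNIV. h $ i * sderiv i f x) + (\<Sum>i\<in>UNIV. h $ i * sderiv i g x))) (at x)"
    using has_derivative_add[OF smooth_S2_has_derivative[OF *(1) x] smooth_S2_has_derivative[OF *(2) x]]
    by (simp add: radial_ext_def[abs_def])
  from sderivI[OF this, of i] show ?thesis by (simp add: axis_def if_distrib[of "\<lambda>x. x * _"] cong: if_cong)
qed

lemma sderiv_mult:
  "smooth_S2 f \<Longrightarrow> smooth_S2 g \<Longrightarrow> x \<in> S2 \<Longrightarrow>
    sderiv i (\<lambda>x. f x * g x) x = f x * sderiv i g x + sderiv i f x * g x"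
proof -
  assume *: "smooth_S2 f" "smooth_S2 g" "x \<in> S2"
  then have x: "x \<noteq> 0" by (auto simp: S2_iff)
  have "(radial_ext (\<lambda>x. f x * g x) has_derivative
      (\<lambda>h. f x * (\<Sum>i\<in>UNIV. h $ i * sderiv i g x) + (\<Sum>i\<in>UNIV. h $ i * sderiv i f x) * g x)) (at x)"
    using has_derivative_mult[OF smooth_S2_has_derivative[OF *(1) x] smooth_S2_has_derivative[OF *(2) x]] *(3)
    by (simp add: radial_ext_S2) (simp add: radial_ext_def[abs_def])
  from sderivI[OF this, of i] show ?thesis by (simp add: axis_def if_distrib[of "\<lambda>x. x * _"] cong: if_cong)
qed

lemma sderiv_const [simp]: "sderiv i (\<lambda>x. c) x = 0"
  by (simp add: sderiv_def radial_ext_def[abs_def])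

lemma sderiv_cmult: "smooth_S2 f \<Longrightarrow> x \<in> S2 \<Longrightarrow> sderiv i (\<lambda>x. c * f x) x = c * sderiv i f x"
  using sderiv_mult[OF smooth_S2_const, of f x i c] by simp

lemma sderiv_diff:
  assumes "smooth_S2 f" "smooth_S2 g" "x \<in> S2"
  shows "sderiv i (\<lambda>x. f x - g x) x = sderiv i f x - sderiv i g x"
  using sderiv_add[OF assms(1) smooth_S2_cmult[OF assms(2), of "-1"] assms(3), of i]
    sderiv_cmult[OF assms(2,3), of i "-1"] by simp

lemma sderiv_sum:
  "(\<And>j. j \<in> I \<Longrightarrow> smooth_S2 (f j)) \<Longrightarrow> x \<in> S2 \<Longrightarrow>
    sderiv i (\<lambda>x. \<Sum>j\<in>I. f j x) x = (\<Sum>j\<in>I. sderiv i (f j) x)"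
  by (induction I rule: infinite_finite_induct) (auto simp: sderiv_add smooth_S2_sum)

lemma sderiv_compose:
  assumes "smooth_S2 f" "x \<in> S2" "(h has_real_derivative h') (at (f x))"
  shows "sderiv i (\<lambda>x. h (f x)) x = h' * sderiv i f x"
proof -
  have x: "x \<noteq> 0" using assms by (auto simp: S2_iff)
  have "(h has_derivative (\<lambda>y. h' * y)) (at (radial_ext f x))"
    using assms by (simp add: radial_ext_S2 has_field_derivative_def)
  from has_derivative_compose[OF smooth_S2_has_derivative[OF assms(1) x] this]
  have "(radial_ext (\<lambda>x. h (f x)) has_derivative (\<lambda>y. h' * (\<Sum>i\<in>UNIV. y $ i * sderiv i f x))) (at x)"
    by (simp add: radial_ext_def[abs_def])
  from sderivI[OF this, of i] show ?thesis by (simp add: axis_def if_distrib[of "\<lambda>x. x * _"] cong: if_cong)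
qed

lemma sderiv_cong:
  assumes "\<And>y. y \<in> S2 \<Longrightarrow> f y = g y" "x \<in> S2" "smooth_S2 f"
  shows "sderiv i f x = sderiv i g x"
proof -
  have x: "x \<noteq> 0" using assms by (auto simp: S2_iff)
  have "(radial_ext g has_derivative (\<lambda>h. \<Sum>i\<in>UNIV. h $ i * sderiv i f x)) (at x)"
    by (rule has_derivative_transform_within_open[OF smooth_S2_has_derivative[OF assms(3) x], of "- {0}"])
      (use x assms(1) proj_S2 in \<open>auto simp: radial_ext_def\<close>)
  from sderivI[OF this, of i] show ?thesis by (simp add: axis_def if_distrib[of "\<lambda>x. x * _"] cong: if_cong)
qed

text \<open>
  The extension is constant along rays, so its derivative in the radial direction vanishes.
\<close>

lemma euler_sderiv:
  assumes "smooth_S2 f" "x \<in> S2"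
  shows "(\<Sum>i\<in>UNIV. x $ i * sderiv i f x) = 0"
proof -
  have x: "x \<noteq> 0" using assms by (auto simp: S2_iff)
  have "((\<lambda>t. t *\<^sub>R x) has_derivative (\<lambda>h. h *\<^sub>R x)) (at 1)"
    by (auto intro!: derivative_eq_intros)
  from has_derivative_compose[OF this, of "radial_ext f" "\<lambda>h. \<Sum>i\<in>UNIV. h $ i * sderiv i f x"] smooth_S2_has_derivative[OF assms(1) x]
  have "((\<lambda>t. radial_ext f (t *\<^sub>R x)) has_derivative (\<lambda>h. \<Sum>i\<in>UNIV. (h *\<^sub>R x) $ i * sderiv i f x)) (at 1)"
    by simp
  then have "((\<lambda>t. radial_ext f x) has_derivative (\<lambda>h. \<Sum>i\<in>UNIV. (h *\<^sub>R x) $ i * sderiv i f x)) (at 1)"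
    by (rule has_derivative_transform_within_open[of _ _ _ _ "{0<..}"])
      (auto simp: radial_ext_scale)
  then have "(\<lambda>h. \<Sum>i\<in>UNIV. (h *\<^sub>R x) $ i * sderiv i f x) = (\<lambda>h::real. 0)"
    using has_derivative_unique[OF _ has_derivative_const] by blast
  from fun_cong[OF this, of 1] show ?thesis by simp
qed

text \<open>
  The gradient of the extension is homogeneous of degree \<open>-1\<close>; multiplication by the norm
  turns its components into extensions that are constant along rays.
\<close>

lemma smooth_S2_sderiv:
  assumes "smooth_S2 f" shows "smooth_S2 (sderiv i f)"
proof -
  let ?F = "radial_ext f"
  have ax: "axis i 1 \<in> (Basis :: (real^3) set)" by (simp add: axis_in_Basis_iff)
  have sm: "smooth_on (- {0}) (\<lambda>x. norm x powr 1 * frechet_derivative ?F (at x) (axis i 1))"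
    using assms unfolding smooth_S2_def
    by (intro smooth_on_mult smooth_on_norm_powr smooth_on_frechet_derivative ax) auto
  have "norm x powr 1 * frechet_derivative ?F (at x) (axis i 1) = radial_ext (sderiv i f) x" if "x \<noteq> 0" for x
  proof -
    let ?c = "inverse (norm x)"
    have c: "?c > 0" using that by simp
    have d: "((\<lambda>y. ?c *\<^sub>R y) has_derivative (\<lambda>h. ?c *\<^sub>R h)) (at x)"
      by (auto intro!: derivative_eq_intros)
    have "?c *\<^sub>R x \<noteq> 0" using that by simp
    from has_derivative_compose[OF d smooth_S2_has_derivative[OF assms this]]
    have "(?F has_derivative (\<lambda>h. \<Sum>j\<in>UNIV. (?c *\<^sub>R h) $ j * sderiv j f (?c *\<^sub>R x))) (at x)"
      by (rule has_derivative_transform_within_open[of _ _ _ _ UNIV]) (use c in \<open>auto simp: radial_ext_scale simp del: scaleR_conv_of_real\<close>)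
    from sderivI[OF this, of i]
    have "sderiv i f x = ?c * sderiv i f (?c *\<^sub>R x)"
      by (simp add: axis_def if_distrib[of "\<lambda>x. x * _"] if_distrib[of "\<lambda>x. _ * x"] cong: if_cong)
    then show ?thesis using that by (simp add: radial_ext_def sderiv_def)
  qed
  then show ?thesis
    unfolding smooth_S2_def by (intro smooth_on_cong[OF _ _ sm]) auto
qed

lemma sderiv_inner:
  assumes "x \<in> S2"
  shows "sderiv i (\<lambda>x. x \<bullet> w) x = w $ i - (x \<bullet> w) * x $ i"
proof -
  have x: "x \<noteq> 0" "norm x = 1" using assms by (auto simp: S2_iff)
  have "((\<lambda>x. inverse (norm x) * (x \<bullet> w)) has_derivative
      (\<lambda>h. h \<bullet> w - (x \<bullet> h) * (x \<bullet> w))) (at x)"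
    using x has_derivative_norm[OF x(1)] by (auto intro!: derivative_eq_intros simp: sgn_div_norm inner_commute fun_eq_iff)
  then have "(radial_ext (\<lambda>x. x \<bullet> w) has_derivative (\<lambda>h. h \<bullet> w - (x \<bullet> h) * (x \<bullet> w))) (at x)"
    by (simp add: radial_ext_def[abs_def])
  from sderivI[OF this, of i] show ?thesis by (simp add: inner_axis inner_axis' mult.commute)
qed

lemma sderiv_component:
  assumes "x \<in> S2"
  shows "sderiv i (\<lambda>x. x $ j) x = (if i = j then 1 else 0) - x $ i * x $ j"
  using sderiv_inner[OF assms, of i "axis j 1"] by (simp add: inner_axis) (simp add: axis_def)

lemma sum_squares_S2: "x \<in> S2 \<Longrightarrow> (\<Sum>i\<in>UNIV. (x $ i)\<^sup>2) = 1"
  by (simp add: S2_iff norm_vec_def L2_set_def real_sqrt_eq_1_iff)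

section \<open>Rotation invariance and Green's formula\<close>

definition rotation :: "3 \<Rightarrow> 3 \<Rightarrow> real \<Rightarrow> real^3 \<Rightarrow> real^3" where
  "rotation i j t x = (\<chi> k. if k = i then cos t * x $ i - sin t * x $ j
                     else if k = j then cos t * x $ j + sin t * x $ i else x $ k)"

lemma orthogonal_rotation:
  assumes "i \<noteq> j"
  shows "orthogonal_transformation (rotation i j t)"
  unfolding orthogonal_transformation_def
proof (intro conjI allI)
  show "linear (rotation i j t)"
    by (rule linearI) (auto simp: rotation_def vec_eq_iff algebra_simps)
  fix v w :: "real^3"
  have "(cos t * v $ i - sin t * v $ j) * (cos t * w $ i - sin t * w $ j) +
        (cos t * v $ j + sin t * v $ i) * (cos t * w $ j + sin t * w $ i)
      = ((cos t)\<^sup>2 + (sin t)\<^sup>2) * (v $ i * w $ i + v $ j * w $ j)"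
    by algebra
  then have *: "(cos t * v $ i - sin t * v $ j) * (cos t * w $ i - sin t * w $ j) +
        (cos t * v $ j + sin t * v $ i) * (cos t * w $ j + sin t * w $ i)
      = v $ i * w $ i + v $ j * w $ j" by (simp only: sin_cos_squared_add2 mult_1)
  have "rotation i j t v \<bullet> rotation i j t w = (\<Sum>k\<in>UNIV. rotation i j t v $ k * rotation i j t w $ k)"
    by (simp add: inner_vec_def)
  also have "\<dots> = rotation i j t v $ i * rotation i j t w $ i + rotation i j t v $ j * rotation i j t w $ j +
      (\<Sum>k\<in>UNIV - {i} - {j}. rotation i j t v $ k * rotation i j t w $ k)"
    using assms by (simp add: sum.remove[of UNIV i] sum.remove[of "UNIV - {i}" j])
  also have "\<dots> = v $ i * w $ i + v $ j * w $ j + (\<Sum>k\<in>UNIV - {i} - {j}. v $ k * w $ k)"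
    using * assms by (auto simp: rotation_def intro!: sum.cong)
  also have "\<dots> = v \<bullet> w"
    using assms by (simp add: inner_vec_def sum.remove[of UNIV i] sum.remove[of "UNIV - {i}" j])
  finally show "rotation i j t v \<bullet> rotation i j t w = v \<bullet> w" .
qed

lemma rotation_S2: "i \<noteq> j \<Longrightarrow> x \<in> S2 \<Longrightarrow> rotation i j t x \<in> S2"
  using orthogonal_rotation by (simp add: S2_iff orthogonal_transformation)

lemma rotation_0: "rotation i j 0 x = x"
  by (simp add: rotation_def vec_eq_iff)

text \<open>
  Rotations form a one-parameter group, so the velocity is the rotation field at the current
  position.
\<close>

lemma rotation_deriv:
  assumes "i \<noteq> j"
  shows "((\<lambda>t. rotation i j t x) has_vector_derivative
     (rotation i j t x $ i *\<^sub>R axis j 1 - rotation i j t x $ j *\<^sub>R axis i 1)) (at t)"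
proof -
  have 1: "((\<lambda>t. x + (cos t - 1) *\<^sub>R (x $ i *\<^sub>R axis i 1 + x $ j *\<^sub>R axis j 1)
           + sin t *\<^sub>R (x $ i *\<^sub>R axis j 1 - x $ j *\<^sub>R axis i 1)) has_vector_derivative
     ((- sin t) *\<^sub>R (x $ i *\<^sub>R axis i 1 + x $ j *\<^sub>R axis j 1)
           + cos t *\<^sub>R (x $ i *\<^sub>R axis j 1 - x $ j *\<^sub>R axis i 1))) (at t)"
    by (auto intro!: derivative_eq_intros)
  have 2: "(\<lambda>t. x + (cos t - 1) *\<^sub>R (x $ i *\<^sub>R axis i 1 + x $ j *\<^sub>R axis j 1)
           + sin t *\<^sub>R (x $ i *\<^sub>R axis j 1 - x $ j *\<^sub>R axis i 1)) = (\<lambda>t. rotation i j t x)"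
    using assms by (auto simp: fun_eq_iff vec_eq_iff rotation_def axis_def algebra_simps)
  have 3: "(- sin t) *\<^sub>R (x $ i *\<^sub>R axis i 1 + x $ j *\<^sub>R axis j 1)
           + cos t *\<^sub>R (x $ i *\<^sub>R axis j 1 - x $ j *\<^sub>R axis i 1)
     = rotation i j t x $ i *\<^sub>R axis j 1 - rotation i j t x $ j *\<^sub>R axis i 1"
    using assms by (auto simp: vec_eq_iff rotation_def axis_def algebra_simps)
  show ?thesis using 1 unfolding 2 3 .
qed

text \<open>
  The integral of \<open>f\<close> over rotated copies of the sphere is constant; its derivative at angle
  zero is the integral of the rotation field applied to \<open>f\<close>.
\<close>

lemma int_S2_rotation_field:
  assumes f: "smooth_S2 f"
  shows "int_S2 (\<lambda>x. x $ i * sderiv j f x - x $ j * sderiv i f x) = 0"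
proof (cases "i = j")
  case True then show ?thesis by (simp add: int_S2_def)
next
  case ij: False
  define L where "L x = x $ i * sderiv j f x - x $ j * sderiv i f x" for x
  have Lc: "continuous_on S2 L" unfolding L_def
    by (intro smooth_S2_continuous smooth_S2_diff smooth_S2_mult smooth_S2_component smooth_S2_sderiv f)
  have fc: "continuous_on S2 f" by (rule smooth_S2_continuous[OF f])
  obtain B where B: "\<And>x. x \<in> S2 \<Longrightarrow> \<bar>L x\<bar> \<le> B"
    using compact_continuous_image[OF Lc compact_S2] compact_imp_bounded
    by (metis bounded_iff imageI real_norm_def)
  have rc: "continuous_on S2 (\<lambda>x. f (rotation i j t x))" for t
  proof (rule continuous_on_compose2[OF fc])
    show "continuous_on S2 (rotation i j t)"
      using orthogonal_rotation[OF ij] by (intro linear_continuous_on)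
        (simp add: linear_conv_bounded_linear[symmetric] orthogonal_transformation_linear)
  qed (use rotation_S2[OF ij] in auto)
  have der: "((\<lambda>t. f (rotation i j t x)) has_real_derivative L (rotation i j t x)) (at t)" if x: "x \<in> S2" for x t
  proof -
    have r: "rotation i j t x \<in> S2" for t using rotation_S2[OF ij x] .
    then have r0: "rotation i j t x \<noteq> 0" by (metis S2_iff norm_zero zero_neq_one)
    have "((\<lambda>t. radial_ext f (rotation i j t x)) has_derivative
        (\<lambda>h. \<Sum>k\<in>UNIV. (h *\<^sub>R (rotation i j t x $ i *\<^sub>R axis j 1 - rotation i j t x $ j *\<^sub>R axis i 1)) $ k
            * sderiv k f (rotation i j t x))) (at t)"
      by (rule has_derivative_compose[OF rotation_deriv[OF ij, unfolded has_vector_derivative_def]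
            smooth_S2_has_derivative[OF f r0]])
    moreover have "(\<lambda>h. \<Sum>k\<in>UNIV. (h *\<^sub>R (rotation i j t x $ i *\<^sub>R axis j 1 - rotation i j t x $ j *\<^sub>R axis i 1)) $ k
            * sderiv k f (rotation i j t x)) = (\<lambda>h. L (rotation i j t x) * h)"
      by (simp add: fun_eq_iff L_def axis_def left_diff_distrib right_diff_distrib sum_subtractf
          if_distrib[of "\<lambda>x. x * _"] if_distrib[of "\<lambda>x. _ * x"] mult_ac cong: if_cong)
    ultimately show ?thesis using r
      by (simp add: radial_ext_S2 has_field_derivative_def)
  qed
  \<comment> \<open>Difference quotients along a sequence of angles; dominated convergence needs sequences.\<close>
  define t where "t n = 1 / (real n + 1)" for n
  have t: "t n > 0" for n by (simp add: t_def)
  define q where "q n x = (f (rotation i j (t n) x) - f x) / t n" for n x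
  have "(\<lambda>n. int_S2 (q n)) \<longlonglongrightarrow> int_S2 L"
  proof (rule int_S2_limit[where B = B])
    show "continuous_on S2 (q n)" for n
      unfolding q_def using t[of n] by (intro continuous_intros rc fc) auto
    fix x assume x: "x \<in> S2"
    have "t \<longlonglongrightarrow> 0"
      using LIMSEQ_inverse_real_of_nat unfolding t_def by (simp add: inverse_eq_divide add.commute)
    then have t0: "filterlim t (at 0) sequentially"
      unfolding filterlim_at using t by (auto simp: less_imp_neq[symmetric] intro!: always_eventually)
    have "((\<lambda>h. (f (rotation i j h x) - f x) / h) \<longlongrightarrow> L x) (at 0)"
      using der[OF x, of 0] by (simp add: DERIV_def rotation_0)
    from filterlim_compose[OF this t0] show "(\<lambda>n. q n x) \<longlonglongrightarrow> L x"
      by (simp add: q_def)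
    fix n
    obtain s where "f (rotation i j (t n) x) - f (rotation i j 0 x) = (t n - 0) * L (rotation i j s x)"
      using MVT2[OF t[of n], of "\<lambda>t. f (rotation i j t x)" "\<lambda>t. L (rotation i j t x)"] der[OF x] by blast
    then have "q n x = L (rotation i j s x)" using t[of n] by (simp add: q_def rotation_0 field_simps)
    then show "\<bar>q n x\<bar> \<le> B" using B[OF rotation_S2[OF ij x]] by simp
  qed (rule Lc)
  moreover have "int_S2 (q n) = 0" for n
  proof -
    have "int_S2 (q n) = inverse (t n) * int_S2 (\<lambda>x. f (rotation i j (t n) x) - f x)"
      unfolding q_def by (simp add: int_S2_cmult[symmetric] divide_inverse mult.commute)
    also have "\<dots> = 0"
      using int_S2_orth[OF orthogonal_rotation[OF ij] fc] by (simp add: int_S2_diff[OF rc fc])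
    finally show ?thesis .
  qed
  ultimately show ?thesis
    unfolding L_def[symmetric] using LIMSEQ_unique[of "\<lambda>n. int_S2 (q n)"] by auto
qed

text \<open>
  On the sphere the \<open>i\<close>-th component of the surface gradient is the sum over \<open>j\<close> of \<open>x\<^sub>j\<close>
  times the rotation field in the plane \<open>(j, i)\<close>. Moving \<open>x\<^sub>j\<close> under the field leaves
  integrals that vanish and a zeroth order term \<open>2 x\<^sub>i\<close>.
\<close>

theorem int_S2_sderiv:
  assumes f: "smooth_S2 f"
  shows "int_S2 (sderiv i f) = 2 * int_S2 (\<lambda>x. f x * x $ i)"
proof -
  let ?g = "\<lambda>j x. x $ j * f x"
  have g: "smooth_S2 (?g j)" for j by (intro smooth_S2_mult smooth_S2_component f)
  have pt: "(\<Sum>j\<in>UNIV. x $ j * sderiv i (?g j) x - x $ i * sderiv j (?g j) x)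
      = sderiv i f x - 2 * (f x * x $ i)" if x: "x \<in> S2" for x
  proof -
    have e: "sderiv k (?g j) x = x $ j * sderiv k f x + ((if k = j then 1 else 0) - x $ k * x $ j) * f x" for k j
      by (simp add: sderiv_mult[OF smooth_S2_component f x] sderiv_component[OF x])
    have "(\<Sum>j\<in>UNIV. x $ j * sderiv i (?g j) x - x $ i * sderiv j (?g j) x)
      = (\<Sum>j\<in>UNIV. (x $ j)\<^sup>2 * sderiv i f x + (if i = j then x $ j * f x else 0) - x $ i * (x $ j * sderiv j f x)
            - x $ i * f x)"
      unfolding e by (intro sum.cong refl) (simp add: algebra_simps power2_eq_square)
    also have "\<dots> = (\<Sum>j\<in>UNIV. (x $ j)\<^sup>2) * sderiv i f x + x $ i * f x
         - x $ i * (\<Sum>j\<in>UNIV. x $ j * sderiv j f x) - 3 * (x $ i * f x)"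
      by (simp add: sum.distrib sum_subtractf sum_distrib_left sum_distrib_right)
    also have "\<dots> = sderiv i f x - 2 * (f x * x $ i)"
      by (simp add: sum_squares_S2[OF x] euler_sderiv[OF f x])
    finally show ?thesis .
  qed
  have c: "continuous_on S2 (\<lambda>x. x $ j * sderiv i (?g j) x - x $ i * sderiv j (?g j) x)" for j
    by (intro smooth_S2_continuous smooth_S2_diff smooth_S2_mult smooth_S2_component smooth_S2_sderiv f)
  have "0 = (\<Sum>j\<in>UNIV. int_S2 (\<lambda>x. x $ j * sderiv i (?g j) x - x $ i * sderiv j (?g j) x))"
    by (simp add: int_S2_rotation_field[OF g])
  also have "\<dots> = int_S2 (\<lambda>x. \<Sum>j\<in>UNIV. x $ j * sderiv i (?g j) x - x $ i * sderiv j (?g j) x)"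
    by (rule int_S2_sum[symmetric]) (rule c)
  also have "\<dots> = int_S2 (\<lambda>x. sderiv i f x - 2 * (f x * x $ i))"
    by (rule int_S2_cong) (rule pt)
  also have "\<dots> = int_S2 (sderiv i f) - 2 * int_S2 (\<lambda>x. f x * x $ i)"
    by (subst int_S2_diff) (auto intro!: smooth_S2_continuous smooth_S2_mult smooth_S2_const smooth_S2_sderiv f smooth_S2_component
        simp: int_S2_cmult)
  finally show ?thesis by simp
qed

definition lap_S2 :: "(real^3 \<Rightarrow> real) \<Rightarrow> real^3 \<Rightarrow> real" where
  "lap_S2 f x = (\<Sum>i\<in>UNIV. sderiv i (sderiv i f) x)"

lemma smooth_S2_lap_S2: "smooth_S2 f \<Longrightarrow> smooth_S2 (lap_S2 f)"
  unfolding lap_S2_def[abs_def] by (intro smooth_S2_sum smooth_S2_sderiv)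

text \<open>
  The divergence theorem for \<open>f\<close> times the gradient of \<open>g\<close>; the curvature term vanishes
  because that field is tangential.
\<close>

lemma int_S2_green:
  assumes f: "smooth_S2 f" and g: "smooth_S2 g"
  shows "int_S2 (\<lambda>x. f x * lap_S2 g x) = - int_S2 (\<lambda>x. \<Sum>i\<in>UNIV. sderiv i f x * sderiv i g x)"
proof -
  let ?h = "\<lambda>i x. f x * sderiv i g x"
  have h: "smooth_S2 (?h i)" for i by (intro smooth_S2_mult smooth_S2_sderiv f g)
  have "int_S2 (\<lambda>x. f x * lap_S2 g x + (\<Sum>i\<in>UNIV. sderiv i f x * sderiv i g x))
      = int_S2 (\<lambda>x. \<Sum>i\<in>UNIV. sderiv i (?h i) x)"
    by (rule int_S2_cong) (simp add: lap_S2_def sderiv_mult[OF f smooth_S2_sderiv[OF g]] sum_distrib_left sum.distrib)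
  also have "\<dots> = (\<Sum>i\<in>UNIV. int_S2 (sderiv i (?h i)))"
    by (rule int_S2_sum) (intro smooth_S2_continuous smooth_S2_sderiv h)
  also have "\<dots> = 2 * (\<Sum>i\<in>UNIV. int_S2 (\<lambda>x. ?h i x * x $ i))"
    by (simp add: int_S2_sderiv[OF h] sum_distrib_left)
  also have "(\<Sum>i\<in>UNIV. int_S2 (\<lambda>x. ?h i x * x $ i)) = int_S2 (\<lambda>x. \<Sum>i\<in>UNIV. ?h i x * x $ i)"
    by (rule int_S2_sum[symmetric]) (intro smooth_S2_continuous smooth_S2_mult smooth_S2_component h smooth_S2_sderiv f g)
  also have "\<dots> = int_S2 (\<lambda>x. 0)"
  proof (rule int_S2_cong)
    fix x assume x: "x \<in> S2"
    have "(\<Sum>i\<in>UNIV. ?h i x * x $ i) = f x * (\<Sum>i\<in>UNIV. x $ i * sderiv i g x)"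
      by (simp add: sum_distrib_left mult_ac)
    then show "(\<Sum>i\<in>UNIV. ?h i x * x $ i) = 0" by (simp add: euler_sderiv[OF g x])
  qed
  finally have "int_S2 (\<lambda>x. f x * lap_S2 g x + (\<Sum>i\<in>UNIV. sderiv i f x * sderiv i g x)) = 0"
    by (simp add: int_S2_def)
  moreover have "int_S2 (\<lambda>x. f x * lap_S2 g x + (\<Sum>i\<in>UNIV. sderiv i f x * sderiv i g x)) =
      int_S2 (\<lambda>x. f x * lap_S2 g x) + int_S2 (\<lambda>x. \<Sum>i\<in>UNIV. sderiv i f x * sderiv i g x)"
    by (rule int_S2_add) (intro smooth_S2_continuous smooth_S2_mult smooth_S2_sum smooth_S2_lap_S2 smooth_S2_sderiv f g)+
  ultimately show ?thesis by simp
qed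

lemma int_S2_lap_S2_sym:
  assumes "smooth_S2 f" "smooth_S2 g"
  shows "int_S2 (\<lambda>x. f x * lap_S2 g x) = int_S2 (\<lambda>x. lap_S2 f x * g x)"
  using int_S2_green[OF assms] int_S2_green[OF assms(2,1)] by (simp add: mult.commute)

section \<open>Legendre polynomials and zonal functions\<close>

text \<open>Legendre polynomials, by Bonnet's recursion.\<close>

fun legendre_poly :: "nat \<Rightarrow> real poly" where
  "legendre_poly 0 = 1"
| "legendre_poly (Suc 0) = [:0, 1:]"
| "legendre_poly (Suc (Suc n)) = smult (1 / (real n + 2))
     (smult (2 * real n + 3) ([:0, 1:] * legendre_poly (Suc n)) - smult (real n + 1) (legendre_poly n))"

abbreviation legendre :: "nat \<Rightarrow> real \<Rightarrow> real" where "legendre l t \<equiv> poly (legendre_poly l) t"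

lemma legendre_poly_rec: "(real n + 2) * legendre (Suc (Suc n)) t = (2 * real n + 3) * t * legendre (Suc n) t - (real n + 1) * legendre n t"
  by (simp add: field_simps)

lemma legendre_poly_rec': "(real n + 1) * legendre (Suc n) t = (2 * real n + 1) * t * legendre n t - real n * legendre (n - 1) t"
  by (cases n) (use legendre_poly_rec in \<open>auto simp: algebra_simps simp del: legendre_poly.simps(3)\<close>)

declare legendre_poly.simps(3) [simp del]

lemma legendre_poly_1: "legendre l 1 = 1"
proof (induction l rule: legendre_poly.induct)
  case (3 n)
  have "(real n + 2) * legendre (Suc (Suc n)) 1 = (real n + 2) * 1"
    using legendre_poly_rec[of n 1] 3 by simp
  then show ?case by (metis add_pos_nonneg mult_cancel_left of_nat_0_le_iff zero_less_numeral add.commute less_irrefl)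
qed auto

lemma legendre_poly_minus: "legendre l (- t) = (-1) ^ l * legendre l t"
proof (induction l rule: legendre_poly.induct)
  case (3 n)
  define r :: real where "r = (-1) ^ n"
  have "legendre (Suc n) (-t) = - (r * legendre (Suc n) t)" "legendre n (-t) = r * legendre n t"
    using 3 by (simp_all add: r_def)
  then have "(real n + 2) * legendre (Suc (Suc n)) (-t) = (real n + 2) * (r * legendre (Suc (Suc n)) t)"
    using legendre_poly_rec[of n "-t"] legendre_poly_rec[of n t] by algebra
  then have "legendre (Suc (Suc n)) (-t) = r * legendre (Suc (Suc n)) t"
    by (simp add: add_eq_0_iff)
  then show ?case by (simp add: r_def)
qed auto

text \<open>The two relations have to be proved together: each induction step uses both.\<close>

lemma legendre_poly_deriv_rec:
  "poly (pderiv (legendre_poly (Suc n))) t = t * poly (pderiv (legendre_poly n)) t + (real n + 1) * legendre n t"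
  "t * poly (pderiv (legendre_poly (Suc n))) t = poly (pderiv (legendre_poly n)) t + (real n + 1) * legendre (Suc n) t"
proof (induction n)
  case 0
  { case 1 show ?case by (simp add: pderiv_pCons) }
  { case 2 show ?case by (simp add: pderiv_pCons) }
next
  case (Suc n)
  let ?D = "\<lambda>n. poly (pderiv (legendre_poly n)) t"
  note a = Suc.IH(1) and b = Suc.IH(2)
  have "(real n + 2) * ?D (Suc (Suc n)) = (2 * real n + 3) * (legendre (Suc n) t + t * ?D (Suc n)) - (real n + 1) * ?D n"
  proof -
    have e: "pderiv (legendre_poly (Suc (Suc n))) = smult (1 / (real n + 2))
       (smult (2 * real n + 3) (legendre_poly (Suc n) + [:0, 1:] * pderiv (legendre_poly (Suc n))) - smult (real n + 1) (pderiv (legendre_poly n)))"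
      by (simp add: legendre_poly.simps(3) pderiv_smult pderiv_diff pderiv_mult pderiv_pCons add.commute smult_add_right)
    have "real n + 2 \<noteq> 0" by linarith
    then show ?thesis unfolding e by (simp del: of_nat_add)
  qed
  also have "\<dots> = (real n + 2) * (t * ?D (Suc n) + (real n + 2) * legendre (Suc n) t)"
    using b by algebra
  finally have A: "?D (Suc (Suc n)) = t * ?D (Suc n) + (real n + 2) * legendre (Suc n) t"
    by (simp add: add_eq_0_iff)
  { case 1 show ?case using A by simp }
  { case 2
    have "t * ?D (Suc (Suc n)) = ?D (Suc n) + (real n + 2) * legendre (Suc (Suc n)) t"
      using A legendre_poly_rec[of n t] a b by algebra
    then show ?case by (simp add: add.commute) }
qed

lemma legendre_poly_ode:
  "(1 - t\<^sup>2) * poly (pderiv (pderiv (legendre_poly l))) t - 2 * t * poly (pderiv (legendre_poly l)) t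
     = - (real l * (real l + 1)) * legendre l t"
proof (cases l)
  case 0 then show ?thesis by simp
next
  case (Suc n)
  have "[:-1, 0, 1:] * pderiv (legendre_poly (Suc n)) = smult (real n + 1) ([:0, 1:] * legendre_poly (Suc n) - legendre_poly n)"
  proof (rule poly_eq_poly_eq_iff[THEN iffD1], rule ext)
    fix t
    show "poly ([:-1, 0, 1:] * pderiv (legendre_poly (Suc n))) t = poly (smult (real n + 1) ([:0, 1:] * legendre_poly (Suc n) - legendre_poly n)) t"
    proof -
      have "(t * t - 1) * poly (pderiv (legendre_poly (Suc n))) t = (real n + 1) * (t * legendre (Suc n) t - legendre n t)"
        using legendre_poly_deriv_rec[where n = n and t = t] by algebra
      then show ?thesis by (simp add: algebra_simps)
    qed
  qed
  from arg_cong[OF this, of "\<lambda>p. poly (pderiv p) t"]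
  have "(t * t - 1) * poly (pderiv (pderiv (legendre_poly (Suc n)))) t + 2 * t * poly (pderiv (legendre_poly (Suc n))) t
      = (real n + 1) * (legendre (Suc n) t + t * poly (pderiv (legendre_poly (Suc n))) t - poly (pderiv (legendre_poly n)) t)"
    by (simp add: pderiv_mult pderiv_pCons pderiv_smult pderiv_diff algebra_simps)
  then have "(1 - t\<^sup>2) * poly (pderiv (pderiv (legendre_poly (Suc n)))) t - 2 * t * poly (pderiv (legendre_poly (Suc n))) t
     = - ((real n + 1) * ((real n + 1) + 1)) * legendre (Suc n) t"
    using legendre_poly_deriv_rec(2)[where n = n and t = t] by algebra
  then show ?thesis unfolding Suc by (simp add: add.commute)
qed

text \<open>
  Linear span of the Legendre polynomials, as an induction principle for statements that are
  linear in a polynomial.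
\<close>

inductive legendre_span :: "real poly \<Rightarrow> bool" where
  "legendre_span (legendre_poly j)"
| "legendre_span p \<Longrightarrow> legendre_span q \<Longrightarrow> legendre_span (p + q)"
| "legendre_span p \<Longrightarrow> legendre_span (smult c p)"

text \<open>
  Bonnet's recursion shows that the span is closed under multiplication by the variable.
\<close>

lemma legendre_span_all: "legendre_span q"
proof -
  have X: "legendre_span ([:0, 1:] * p)" if "legendre_span p" for p
    using that
  proof induction
    case (1 j)
    have eq: "[:0, 1:] * legendre_poly j = smult ((real j + 1) / (2 * real j + 1)) (legendre_poly (Suc j))
         + smult (real j / (2 * real j + 1)) (legendre_poly (j - 1))"
    proof (rule poly_eq_poly_eq_iff[THEN iffD1], rule ext)
      fix t show "poly ([:0, 1:] * legendre_poly j) t = poly (smult ((real j + 1) / (2 * real j + 1)) (legendre_poly (Suc j))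
         + smult (real j / (2 * real j + 1)) (legendre_poly (j - 1))) t"
      proof -
        have "(2 * real j + 1) * (t * legendre j t) = (real j + 1) * legendre (Suc j) t + real j * legendre (j - 1) t"
          using legendre_poly_rec'[of j t] by algebra
        moreover have "2 * real j + 1 \<noteq> 0" by linarith
        ultimately have "t * legendre j t = ((real j + 1) * legendre (Suc j) t + real j * legendre (j - 1) t) / (2 * real j + 1)"
          by (metis nonzero_mult_div_cancel_left)
        then show ?thesis by (simp add: add_divide_distrib algebra_simps)
      qed
    qed
    show ?case unfolding eq by (intro legendre_span.intros)
  next
    case (2 p q)
    then show ?case by (metis legendre_span.intros(2) distrib_left)
  next
    case (3 p c)
    then show ?case by (metis legendre_span.intros(3) mult_smult_right)
  qed
  show ?thesis
  proof (induction q)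
    case 0
    show ?case using legendre_span.intros(3)[OF legendre_span.intros(1)[of 0], of 0] by simp
  next
    case (pCons a p)
    have "pCons a p = smult a (legendre_poly 0) + [:0, 1:] * p" by simp
    then show ?case using legendre_span.intros X[OF pCons.IH] by presburger
  qed
qed

lemma legendre_poly_expansion: "\<exists>c n. q = (\<Sum>j<n. smult (c j) (legendre_poly j))"
  using legendre_span_all[of q]
proof induction
  case (1 j)
  have "legendre_poly j = (\<Sum>i<Suc j. smult (if i = j then 1 else 0) (legendre_poly i))"
    by (simp add: if_distrib[of "\<lambda>c. smult c _"] cong: if_cong)
  then show ?case by metis
next
  case (2 p q)
  then obtain c n d m where "p = (\<Sum>j<n. smult (c j) (legendre_poly j))" "q = (\<Sum>j<m. smult (d j) (legendre_poly j))" by blast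
  moreover have "(\<Sum>j<n. smult (c j) (legendre_poly j)) = (\<Sum>j<max n m. smult (if j < n then c j else 0) (legendre_poly j))"
    by (intro sum.mono_neutral_cong_left) auto
  moreover have "(\<Sum>j<m. smult (d j) (legendre_poly j)) = (\<Sum>j<max n m. smult (if j < m then d j else 0) (legendre_poly j))"
    by (intro sum.mono_neutral_cong_left) auto
  ultimately have "p + q = (\<Sum>j<max n m. smult ((if j < n then c j else 0) + (if j < m then d j else 0)) (legendre_poly j))"
    by (simp add: sum.distrib[symmetric] smult_add_left)
  then show ?case by metis
next
  case (3 p c)
  then obtain d n where "p = (\<Sum>j<n. smult (d j) (legendre_poly j))" by blast
  moreover have "smult c (\<Sum>j<n. smult (d j) (legendre_poly j)) = (\<Sum>j<n. smult (c * d j) (legendre_poly j))"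
    by (induction n) (simp_all add: smult_add_right)
  ultimately have "smult c p = (\<Sum>j<n. smult (c * d j) (legendre_poly j))" by simp
  then show ?case by metis
qed

lemma smooth_S2_zonal: "smooth_S2 (\<lambda>x. poly q (x \<bullet> w))"
  using smooth_S2_compose[where h = "\<lambda>n. poly ((pderiv ^^ n) q)" and n = 0, OF _ smooth_S2_inner[of w]]
  by (simp add: poly_DERIV)

lemma sderiv_zonal:
  assumes "x \<in> S2"
  shows "sderiv i (\<lambda>x. poly q (x \<bullet> w)) x = poly (pderiv q) (x \<bullet> w) * (w $ i - (x \<bullet> w) * x $ i)"
  using sderiv_compose[OF smooth_S2_inner assms poly_DERIV] by (simp add: sderiv_inner[OF assms])

text \<open>
  In terms of \<open>t = x \<bullet> w\<close> the Laplacian of a zonal function is the Legendre operator: the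
  gradient of \<open>t\<close> has square length \<open>1 - t\<^sup>2\<close>, and the Laplacian of \<open>t\<close> is \<open>-2 t\<close>.
\<close>

lemma lap_S2_zonal:
  assumes x: "x \<in> S2" and w: "w \<in> S2"
  shows "lap_S2 (\<lambda>x. poly q (x \<bullet> w)) x =
    (1 - (x \<bullet> w)\<^sup>2) * poly (pderiv (pderiv q)) (x \<bullet> w) - 2 * (x \<bullet> w) * poly (pderiv q) (x \<bullet> w)"
proof -
  let ?t = "x \<bullet> w"
  let ?v = "\<lambda>i x. w $ i - (x \<bullet> w) * x $ i"
  have sv: "smooth_S2 (?v i)" for i
    by (intro smooth_S2_diff smooth_S2_const smooth_S2_mult smooth_S2_inner smooth_S2_component)
  have s2: "sderiv i (sderiv i (\<lambda>x. poly q (x \<bullet> w))) x =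
      poly (pderiv (pderiv q)) ?t * (?v i x)\<^sup>2 - poly (pderiv q) ?t * (?v i x * x $ i + ?t * (1 - (x $ i)\<^sup>2))" for i
  proof -
    have "sderiv i (sderiv i (\<lambda>x. poly q (x \<bullet> w))) x = sderiv i (\<lambda>x. poly (pderiv q) (x \<bullet> w) * ?v i x) x"
      by (rule sderiv_cong[OF _ x smooth_S2_sderiv[OF smooth_S2_zonal]]) (rule sderiv_zonal)
    also have "\<dots> = poly (pderiv q) ?t * sderiv i (?v i) x + sderiv i (\<lambda>x. poly (pderiv q) (x \<bullet> w)) x * ?v i x"
      by (rule sderiv_mult[OF smooth_S2_zonal sv x])
    also have "sderiv i (?v i) x = - (?t * sderiv i (\<lambda>x. x $ i) x + sderiv i (\<lambda>x. x \<bullet> w) x * x $ i)"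
      using sderiv_diff[OF smooth_S2_const[of "w $ i"] smooth_S2_mult[OF smooth_S2_inner[of w] smooth_S2_component[of i]] x, of i]
        sderiv_mult[OF smooth_S2_inner[of w] smooth_S2_component[of i] x, of i] by simp
    finally show ?thesis
      by (simp add: sderiv_zonal[OF x] sderiv_component[OF x] sderiv_inner[OF x] power2_eq_square algebra_simps)
  qed
  have xx: "(\<Sum>i\<in>UNIV. (x $ i)\<^sup>2) = 1" and ww: "(\<Sum>i\<in>UNIV. (w $ i)\<^sup>2) = 1"
    using sum_squares_S2 x w by auto
  have xw: "(\<Sum>i\<in>UNIV. w $ i * x $ i) = ?t" by (simp add: inner_vec_def mult.commute)
  have v2: "(\<Sum>i\<in>UNIV. (?v i x)\<^sup>2) = 1 - ?t\<^sup>2"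
  proof -
    have "(\<Sum>i\<in>UNIV. (?v i x)\<^sup>2) = (\<Sum>i\<in>UNIV. (w $ i)\<^sup>2) - 2 * ?t * (\<Sum>i\<in>UNIV. w $ i * x $ i) + ?t\<^sup>2 * (\<Sum>i\<in>UNIV. (x $ i)\<^sup>2)"
      by (simp add: sum_distrib_left sum_subtractf[symmetric] sum.distrib[symmetric] power2_eq_square algebra_simps del: xw)
    then show ?thesis unfolding xx ww xw by (simp add: power2_eq_square)
  qed
  have vx: "(\<Sum>i\<in>UNIV. ?v i x * x $ i) = 0"
  proof -
    have "(\<Sum>i\<in>UNIV. ?v i x * x $ i) = (\<Sum>i\<in>UNIV. w $ i * x $ i) - ?t * (\<Sum>i\<in>UNIV. (x $ i)\<^sup>2)"
      by (simp add: sum_distrib_left sum_subtractf[symmetric] power2_eq_square algebra_simps)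
    then show ?thesis by (simp add: xx xw)
  qed
  have "lap_S2 (\<lambda>x. poly q (x \<bullet> w)) x = poly (pderiv (pderiv q)) ?t * (\<Sum>i\<in>UNIV. (?v i x)\<^sup>2)
      - poly (pderiv q) ?t * ((\<Sum>i\<in>UNIV. ?v i x * x $ i) + ?t * (3 - (\<Sum>i\<in>UNIV. (x $ i)\<^sup>2)))"
    unfolding lap_S2_def s2
    by (simp add: sum_subtractf sum_distrib_left[symmetric] sum.distrib)
  then show ?thesis unfolding v2 vx xx by simp
qed

lemma lap_S2_legendre_poly: "x \<in> S2 \<Longrightarrow> w \<in> S2 \<Longrightarrow> lap_S2 (\<lambda>x. legendre l (x \<bullet> w)) x = - (real l * (real l + 1)) * legendre l (x \<bullet> w)"
  using lap_S2_zonal[of x w "legendre_poly l"] legendre_poly_ode[of "x \<bullet> w" l] by simp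

lemma zonal_continuous [continuous_intros]: "continuous_on S2 (\<lambda>x. poly q (x \<bullet> w))"
  by (rule smooth_S2_continuous[OF smooth_S2_zonal])

lemma zonal_continuous' [continuous_intros]: "continuous_on S2 (\<lambda>x. poly q (w \<bullet> x))"
  using zonal_continuous[of q w] by (simp only: inner_commute[of w])

text \<open>
  The Laplacian is symmetric and has different eigenvalues on the two functions. The axes may
  differ, which is used for the composition of kernels.
\<close>

lemma legendre_poly_orthogonal:
  assumes "w \<in> S2" "w' \<in> S2" "l \<noteq> k"
  shows "int_S2 (\<lambda>x. legendre l (x \<bullet> w) * legendre k (x \<bullet> w')) = 0"
proof -
  define I where "I = int_S2 (\<lambda>x. legendre l (x \<bullet> w) * legendre k (x \<bullet> w'))"
  have 1: "int_S2 (\<lambda>x. legendre l (x \<bullet> w) * lap_S2 (\<lambda>x. legendre k (x \<bullet> w')) x) = - (real k * (real k + 1)) * I"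
    unfolding int_S2_cmult[symmetric] I_def by (rule int_S2_cong) (simp add: lap_S2_legendre_poly assms)
  have 2: "int_S2 (\<lambda>x. lap_S2 (\<lambda>x. legendre l (x \<bullet> w)) x * legendre k (x \<bullet> w')) = - (real l * (real l + 1)) * I"
    unfolding int_S2_cmult[symmetric] I_def by (rule int_S2_cong) (simp add: lap_S2_legendre_poly assms)
  have "- (real k * (real k + 1)) * I = - (real l * (real l + 1)) * I"
    using int_S2_lap_S2_sym[OF smooth_S2_zonal[of "legendre_poly l" w] smooth_S2_zonal[of "legendre_poly k" w']] unfolding 1 2 .
  then have "(real k - real l) * ((real k + real l + 1) * I) = 0"
    by (simp add: algebra_simps)
  moreover have "real k - real l \<noteq> 0" "real k + real l + 1 \<noteq> 0" using assms(3) by (simp, linarith)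
  ultimately have "I = 0" by (simp only: mult_eq_0_iff simp_thms)
  then show ?thesis by (simp add: I_def)
qed

text \<open>
  Multiplying Bonnet's recursion by a neighbouring polynomial and integrating expresses the
  norms of consecutive polynomials by the same mixed integral.
\<close>

lemma legendre_poly_norm:
  assumes w: "w \<in> S2"
  shows "int_S2 (\<lambda>x. (legendre l (x \<bullet> w))\<^sup>2) = 4 * pi / (2 * real l + 1)"
proof (induction l)
  case 0 show ?case by (simp add: int_S2_const)
next
  case (Suc n)
  let ?J = "int_S2 (\<lambda>x. (x \<bullet> w) * legendre (Suc n) (x \<bullet> w) * legendre n (x \<bullet> w))"
  let ?N = "\<lambda>l. int_S2 (\<lambda>x. (legendre l (x \<bullet> w))\<^sup>2)"
  have ci: "continuous_on S2 (\<lambda>x. x \<bullet> w)" by (intro continuous_intros)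
  have "(real n + 2) * int_S2 (\<lambda>x. legendre (Suc (Suc n)) (x \<bullet> w) * legendre n (x \<bullet> w))
     = int_S2 (\<lambda>x. (2 * real n + 3) * ((x \<bullet> w) * legendre (Suc n) (x \<bullet> w) * legendre n (x \<bullet> w)) - (real n + 1) * (legendre n (x \<bullet> w))\<^sup>2)"
    unfolding int_S2_cmult[symmetric] proof (rule int_S2_cong)
    fix x
    show "(real n + 2) * (legendre (Suc (Suc n)) (x \<bullet> w) * legendre n (x \<bullet> w)) =
         (2 * real n + 3) * (x \<bullet> w * legendre (Suc n) (x \<bullet> w) * legendre n (x \<bullet> w)) - (real n + 1) * (legendre n (x \<bullet> w))\<^sup>2"
      using legendre_poly_rec[of n "x \<bullet> w"] by algebra
  qed
  also have "\<dots> = (2 * real n + 3) * ?J - (real n + 1) * ?N n"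
    by (subst int_S2_diff) (auto intro!: continuous_intros ci simp: int_S2_cmult)
  finally have 1: "(2 * real n + 3) * ?J = (real n + 1) * ?N n"
    by (simp add: legendre_poly_orthogonal[OF w w])
  have "(real n + 1) * ?N (Suc n)
     = int_S2 (\<lambda>x. (2 * real n + 1) * ((x \<bullet> w) * legendre (Suc n) (x \<bullet> w) * legendre n (x \<bullet> w)) - real n * (legendre (Suc n) (x \<bullet> w) * legendre (n - 1) (x \<bullet> w)))"
    unfolding int_S2_cmult[symmetric] proof (rule int_S2_cong)
    fix x
    show "(real n + 1) * (legendre (Suc n) (x \<bullet> w))\<^sup>2 =
         (2 * real n + 1) * (x \<bullet> w * legendre (Suc n) (x \<bullet> w) * legendre n (x \<bullet> w)) - real n * (legendre (Suc n) (x \<bullet> w) * legendre (n - 1) (x \<bullet> w))"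
      using legendre_poly_rec'[of n "x \<bullet> w"] by algebra
  qed
  also have "\<dots> = (2 * real n + 1) * ?J - real n * int_S2 (\<lambda>x. legendre (Suc n) (x \<bullet> w) * legendre (n - 1) (x \<bullet> w))"
    by (subst int_S2_diff) (auto intro!: continuous_intros ci simp: int_S2_cmult)
  also have "\<dots> = (2 * real n + 1) * ?J"
    by (simp add: legendre_poly_orthogonal[OF w w])
  finally have 2: "(real n + 1) * ?N (Suc n) = (2 * real n + 1) * ?J" .
  have "(real n + 1) * ((2 * real n + 3) * ?N (Suc n)) = (2 * real n + 1) * ((2 * real n + 3) * ?J)"
    using 2 by algebra
  also have "\<dots> = (real n + 1) * (4 * pi)"
    unfolding 1 Suc.IH by (simp add: field_simps)
  finally have "(real n + 1) * ((2 * real n + 3) * ?N (Suc n)) = (real n + 1) * (4 * pi)" .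
  moreover have "real n + 1 \<noteq> 0" by linarith
  ultimately have "(2 * real n + 3) * ?N (Suc n) = 4 * pi"
    by (metis mult_left_cancel)
  then show ?case by (simp add: field_simps)
qed

section \<open>The reproducing property of zonal kernels\<close>

lemma S2_bounded_above:
  assumes "continuous_on S2 (f :: real^3 \<Rightarrow> real)"
  obtains B where "B \<ge> 0" "\<And>x. x \<in> S2 \<Longrightarrow> \<bar>f x\<bar> \<le> B"
proof -
  obtain B where B: "\<And>x. x \<in> S2 \<Longrightarrow> norm (f x) \<le> B"
    using compact_continuous_image[OF assms compact_S2] compact_imp_bounded
    by (metis bounded_iff imageI)
  show ?thesis by (rule that[of "\<bar>B\<bar>"]) (use B in force)+
qed

lemma S2xS2_bounded:
  assumes "continuous_on (S2 \<times> S2) (\<lambda>p. h (fst p) (snd p) :: real)"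
  obtains B where "B \<ge> 0" "\<And>x y. x \<in> S2 \<Longrightarrow> y \<in> S2 \<Longrightarrow> \<bar>h x y\<bar> \<le> B"
proof -
  have "bounded ((\<lambda>p. h (fst p) (snd p)) ` (S2 \<times> S2))"
    using compact_continuous_image[OF assms compact_Times[OF compact_S2 compact_S2]] compact_imp_bounded by blast
  then obtain B where B: "\<forall>v \<in> (\<lambda>p. h (fst p) (snd p)) ` (S2 \<times> S2). norm v \<le> B"
    unfolding bounded_iff by blast
  have "\<bar>h x y\<bar> \<le> \<bar>B\<bar>" if "x \<in> S2" "y \<in> S2" for x y
  proof -
    have "(x, y) \<in> S2 \<times> S2" using that by simp
    from B[rule_format, OF imageI[OF this]] show ?thesis by simp
  qed
  then show ?thesis by (intro that[of "\<bar>B\<bar>"]) auto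
qed

lemma continuous_on_section:
  assumes "continuous_on (S2 \<times> S2) (\<lambda>p. h (fst p) (snd p))" "x \<in> S2"
  shows "continuous_on S2 (h x)" "continuous_on S2 (\<lambda>y. h y x)"
proof -
  show "continuous_on S2 (h x)"
    by (rule continuous_on_compose2[OF assms(1), of S2 "\<lambda>y. (x, y)", simplified])
      (use assms(2) continuous_on_Pair[OF continuous_on_const continuous_on_id] in auto)
  show "continuous_on S2 (\<lambda>y. h y x)"
    by (rule continuous_on_compose2[OF assms(1), of S2 "\<lambda>y. (y, x)", simplified])
      (use assms(2) continuous_on_Pair[OF continuous_on_id continuous_on_const] in auto)
qed

lemma int_S2_fubini_on:
  assumes cont: "continuous_on (S2 \<times> S2) (\<lambda>p. h (fst p) (snd p))"
    and A: "A \<in> sets borel" "A \<subseteq> S2"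
  shows "int_S2 (\<lambda>x. LINT y:A|surf. h x y) = (LINT y:A|surf. int_S2 (\<lambda>x. h x y))"
proof -
  interpret pair_sigma_finite surf surf ..
  interpret p: finite_measure "surf \<Otimes>\<^sub>M surf"
    by (intro finite_measure_pair_measure finite_measure_surf)
  define H where "H x y = indicator S2 x * (indicator A y * h x y)" for x y
  obtain B where B: "B \<ge> 0" "\<And>x y. x \<in> S2 \<Longrightarrow> y \<in> S2 \<Longrightarrow> \<bar>h x y\<bar> \<le> B"
    using S2xS2_bounded[OF cont] by blast
  have cl: "S2 \<times> S2 \<in> sets (borel :: ((real^3) \<times> (real^3)) measure)"
    using compact_S2 by (intro borel_closed closed_Times compact_imp_closed)
  have A': "UNIV \<times> A \<in> sets (borel :: ((real^3) \<times> (real^3)) measure)"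
    unfolding borel_prod[symmetric] using A by (intro pair_measureI) auto
  have "(\<lambda>p. indicator (UNIV \<times> A) p * (indicator (S2 \<times> S2) p *\<^sub>R h (fst p) (snd p))) \<in> borel_measurable borel"
    by (rule borel_measurable_times[OF _ borel_measurable_continuous_on_indicator[OF cl cont]]) (rule borel_measurable_indicator[OF A'])
  moreover have "(\<lambda>p. indicator (UNIV \<times> A) p * (indicator (S2 \<times> S2) p *\<^sub>R h (fst p) (snd p))) = case_prod H"
    using A(2) by (intro ext) (auto simp: H_def indicator_def split_beta mem_Times_iff)
  moreover have sts: "sets (surf \<Otimes>\<^sub>M surf) = sets (borel :: ((real^3) \<times> (real^3)) measure)"
    unfolding borel_prod[symmetric] by (rule sets_pair_measure_cong[OF sets_surf sets_surf])
  ultimately have "case_prod H \<in> borel_measurable (surf \<Otimes>\<^sub>M surf)"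
    unfolding measurable_cong_sets[OF sts refl] by simp
  moreover have "norm (case_prod H p) \<le> B" for p
    using B A(2) by (cases p) (auto simp: H_def indicator_def)
  ultimately have "integrable (surf \<Otimes>\<^sub>M surf) (case_prod H)"
    by (intro p.integrable_const_bound[where B = B]) auto
  from Fubini_integral[OF this] have fub: "(\<integral>y. (\<integral>x. H x y \<partial>surf) \<partial>surf) = (\<integral>x. (\<integral>y. H x y \<partial>surf) \<partial>surf)" .
  have r1: "(\<integral>y. H x y \<partial>surf) = indicator S2 x * (LINT y:A|surf. h x y)" for x
    by (simp add: H_def set_lebesgue_integral_def)
  have "H x y = indicator A y * (indicator S2 x * h x y)" for x y by (simp add: H_def)
  then have r2: "(\<integral>x. H x y \<partial>surf) = indicator A y * int_S2 (\<lambda>x. h x y)" for y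
    by (simp add: int_S2_def set_lebesgue_integral_def)
  have r: "int_S2 g = (\<integral>x. indicator S2 x * g x \<partial>surf)" for g
    by (simp add: int_S2_def set_lebesgue_integral_def)
  have l: "(LINT y:A|surf. int_S2 (\<lambda>x. h x y)) = (\<integral>y. indicator A y * int_S2 (\<lambda>x. h x y) \<partial>surf)"
    by (simp add: set_lebesgue_integral_def)
  show ?thesis
    unfolding l r[of "\<lambda>x. LINT y:A|surf. h x y"] using fub unfolding r1 r2 by simp
qed

lemma int_S2_fubini:
  assumes "continuous_on (S2 \<times> S2) (\<lambda>p. h (fst p) (snd p))"
  shows "int_S2 (\<lambda>x. int_S2 (\<lambda>y. h x y)) = int_S2 (\<lambda>y. int_S2 (\<lambda>x. h x y))"
  using int_S2_fubini_on[OF assms S2_borel order_refl] by (simp add: int_S2_def)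

lemma int_S2_param_continuous:
  assumes "continuous_on (S2 \<times> S2) (\<lambda>p. h (fst p) (snd p))"
  shows "continuous_on S2 (\<lambda>x. int_S2 (h x))"
  unfolding continuous_on_sequentially comp_def
proof (intro allI ballI impI)
  fix u a assume a: "a \<in> S2" and u: "(\<forall>n. u n \<in> S2) \<and> u \<longlonglongrightarrow> a"
  obtain B where B: "B \<ge> 0" "\<And>x y. x \<in> S2 \<Longrightarrow> y \<in> S2 \<Longrightarrow> \<bar>h x y\<bar> \<le> B"
    using S2xS2_bounded[OF assms] by blast
  show "(\<lambda>n. int_S2 (h (u n))) \<longlonglongrightarrow> int_S2 (h a)"
  proof (rule int_S2_limit[where B = B])
    fix y assume y: "y \<in> S2"
    show "(\<lambda>n. h (u n) y) \<longlonglongrightarrow> h a y"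
      using continuous_on_section(2)[OF assms y] a u unfolding continuous_on_sequentially comp_def by blast
  qed (use B u a continuous_on_section(1)[OF assms] in auto)
qed

lemma continuous_on_kernel:
  assumes "continuous_on S2 f" "continuous_on S2 g"
  shows "continuous_on (S2 \<times> S2) (\<lambda>p. g (fst p) * (poly q (fst p \<bullet> snd p) * f (snd p)))"
proof -
  have "continuous_on (S2 \<times> S2) (\<lambda>p. f (snd p))" "continuous_on (S2 \<times> S2) (\<lambda>p. g (fst p))"
    by (auto intro!: continuous_on_compose2[OF assms(1)] continuous_on_compose2[OF assms(2)] continuous_intros)
  then show ?thesis by (intro continuous_intros)
qed

text \<open>Reflection in the plane orthogonal to the difference of the two vectors.\<close>

lemma reflection_exists:
  fixes w w' :: "real^3"
  assumes "norm w = norm w'"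
  obtains T where "orthogonal_transformation T" "T w = w'" "T w' = w" "\<And>v. v \<bullet> w = v \<bullet> w' \<Longrightarrow> T v = v"
proof (cases "w = w'")
  case True
  then show ?thesis by (intro that[of "\<lambda>x. x"]) auto
next
  case False
  define n where "n = w - w'"
  define T where "T v = v - (2 * (v \<bullet> n) / (n \<bullet> n)) *\<^sub>R n" for v
  have nn: "n \<bullet> n \<noteq> 0" using False by (simp add: n_def)
  have ww: "w \<bullet> w = w' \<bullet> w'" using assms by (simp add: norm_eq)
  have "linear T"
  proof (rule linearI)
    show "T (u + v) = T u + T v" for u v
      by (simp add: T_def inner_add_left distrib_left add_divide_distrib scaleR_add_left)
    show "T (c *\<^sub>R v) = c *\<^sub>R T v" for c v
      by (simp add: T_def scaleR_diff_right mult.left_commute)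
  qed
  moreover have "T v \<bullet> T u = v \<bullet> u" for v u
  proof -
    define a b where "a = 2 * (v \<bullet> n) / (n \<bullet> n)" and "b = 2 * (u \<bullet> n) / (n \<bullet> n)"
    have ab: "a * (n \<bullet> n) = 2 * (v \<bullet> n)" "b * (n \<bullet> n) = 2 * (u \<bullet> n)" using nn by (simp_all add: a_def b_def)
    have "T v \<bullet> T u = v \<bullet> u - b * (v \<bullet> n) - a * (u \<bullet> n) + a * (b * (n \<bullet> n))"
    proof -
      have T': "T v = v - a *\<^sub>R n" "T u = u - b *\<^sub>R n" by (simp_all add: T_def a_def b_def)
      show ?thesis unfolding T'
        by (simp add: inner_diff_left inner_diff_right inner_commute[of n u] right_diff_distrib)
    qed
    then show ?thesis using ab by algebra
  qed
  ultimately have "orthogonal_transformation T" by (simp add: orthogonal_transformation_def)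
  moreover have "T w = w'"
  proof -
    have "2 * (w \<bullet> n) = n \<bullet> n" using ww by (simp add: n_def inner_diff_left inner_diff_right inner_commute)
    then show ?thesis using nn by (simp add: T_def) (simp add: n_def)
  qed
  moreover have "T w' = w"
  proof -
    have "2 * (w' \<bullet> n) = - (n \<bullet> n)" using ww by (simp add: n_def inner_diff_left inner_diff_right inner_commute)
    then show ?thesis using nn by (simp add: T_def) (simp add: n_def)
  qed
  moreover have "T v = v" if "v \<bullet> w = v \<bullet> w'" for v
    using that by (simp add: T_def n_def inner_diff_right)
  ultimately show ?thesis by (rule that)
qed

text \<open>
  A continuous function of \<open>x \<bullet> w\<close> is a uniform limit of polynomials in \<open>x \<bullet> w\<close>, to which the
  function is orthogonal by hypothesis; hence it is orthogonal to itself.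
\<close>

lemma zonal_zero:
  assumes x: "x \<in> S2" and D: "continuous_on S2 D"
    and zon: "\<And>w w'. w \<in> S2 \<Longrightarrow> w' \<in> S2 \<Longrightarrow> x \<bullet> w = x \<bullet> w' \<Longrightarrow> D w = D w'"
    and orth: "\<And>j. int_S2 (\<lambda>w. D w * legendre j (x \<bullet> w)) = 0"
    and w: "w \<in> S2"
  shows "D w = 0"
proof -
  have xx: "x \<bullet> x = 1" using x by (simp add: S2_iff norm_eq_1)
  obtain y0 :: "real^3" where y0: "y0 \<noteq> 0" "orthogonal x y0"
    using orthogonal_to_vector_exists[of x] by auto
  define y where "y = y0 /\<^sub>R norm y0"
  have y: "x \<bullet> y = 0" "y \<bullet> y = 1" using y0 by (auto simp: y_def orthogonal_def dot_square_norm power2_eq_square)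
  \<comment> \<open>A meridian through \<open>x\<close>: one point for each value of the inner product with \<open>x\<close>.\<close>
  define g where "g t = t *\<^sub>R x + sqrt (1 - t\<^sup>2) *\<^sub>R y" for t
  have gS: "g t \<in> S2" and xg: "x \<bullet> g t = t" if "t \<in> {-1..1}" for t
  proof -
    have "t\<^sup>2 \<le> 1" using that by (simp add: abs_square_le_1 abs_le_iff)
    then show "g t \<in> S2" "x \<bullet> g t = t" using xx y
      by (simp_all add: S2_iff norm_eq_1 g_def inner_add_left inner_add_right inner_commute[of y x] power2_eq_square)
  qed
  have d: "continuous_on {-1..1} (\<lambda>t. D (g t))"
    by (rule continuous_on_compose2[OF D]) (use gS in \<open>auto simp: g_def intro!: continuous_intros\<close>)
  have rng: "x \<bullet> w \<in> {-1..1}" if "w \<in> S2" for w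
    using Cauchy_Schwarz_ineq2[of x w] x that by (simp add: S2_iff abs_le_iff)
  have Dg: "D w = D (g (x \<bullet> w))" if "w \<in> S2" for w
    using zon[OF that gS[OF rng[OF that]]] xg[OF rng[OF that]] by simp
  obtain M where M: "M \<ge> 0" "\<And>w. w \<in> S2 \<Longrightarrow> \<bar>D w\<bar> \<le> M" using S2_bounded_above[OF D] by blast
  have orthq: "int_S2 (\<lambda>w. D w * poly q (x \<bullet> w)) = 0" for q
    using legendre_span_all[of q]
  proof induction
    case (2 p q)
    have "int_S2 (\<lambda>w. D w * poly (p + q) (x \<bullet> w)) = int_S2 (\<lambda>w. D w * poly p (x \<bullet> w) + D w * poly q (x \<bullet> w))"
      by (simp add: algebra_simps)
    also have "\<dots> = 0"
      by (subst int_S2_add) (auto intro!: continuous_intros D simp: 2)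
    finally show ?case .
  next
    case (3 p c)
    then show ?case using int_S2_cmult[of c "\<lambda>w. D w * poly p (x \<bullet> w)"] by (simp add: mult.left_commute)
  qed (rule orth)
  have "int_S2 (\<lambda>w. (D w)\<^sup>2) \<le> e" if e: "e > 0" for e
  proof -
    \<comment> \<open>The integrand below is at most \<open>(M + 1) e'\<close>, which integrates to \<open>e\<close>.\<close>
    define e' where "e' = e / (4 * pi * (M + 1))"
    have e': "e' > 0" using e M by (simp add: e'_def)
    obtain q0 where q0: "real_polynomial_function q0" "\<And>t. t \<in> {-1..1} \<Longrightarrow> \<bar>D (g t) - q0 t\<bar> < e'"
      using Stone_Weierstrass_real_polynomial_function[OF compact_Icc d e'] by blast
    obtain a n where an: "q0 = (\<lambda>t. \<Sum>i\<le>n. a i * t ^ i)"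
      using q0(1) real_polynomial_function_iff_sum by blast
    define q where "q = (\<Sum>i\<le>n. monom (a i) i)"
    have q: "poly q t = q0 t" for t by (simp add: q_def an poly_sum poly_monom)
    have "int_S2 (\<lambda>w. (D w)\<^sup>2) = int_S2 (\<lambda>w. (D w)\<^sup>2) - int_S2 (\<lambda>w. D w * poly q (x \<bullet> w))"
      by (simp add: orthq)
    also have "\<dots> = int_S2 (\<lambda>w. (D w)\<^sup>2 - D w * poly q (x \<bullet> w))"
      by (rule int_S2_diff[symmetric]) (auto intro!: continuous_intros D)
    also have "\<dots> \<le> int_S2 (\<lambda>w. (M + 1) * e')"
    proof (rule int_S2_mono)
      fix w assume w: "w \<in> S2"
      have "\<bar>D w - poly q (x \<bullet> w)\<bar> \<le> e'" using q0(2)[OF rng[OF w]] by (simp add: q Dg[OF w, symmetric])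
      then have "\<bar>D w\<bar> * \<bar>D w - poly q (x \<bullet> w)\<bar> \<le> (M + 1) * e'"
        using M(2)[OF w] M(1) by (intro mult_mono) auto
      then have "D w * (D w - poly q (x \<bullet> w)) \<le> (M + 1) * e'"
        by (metis abs_ge_self abs_mult order_trans)
      then show "(D w)\<^sup>2 - D w * poly q (x \<bullet> w) \<le> (M + 1) * e'" by (simp add: algebra_simps power2_eq_square)
    qed (auto intro!: continuous_intros D)
    also have "\<dots> = e" using M by (simp add: int_S2_const e'_def)
    finally show ?thesis .
  qed
  then have "int_S2 (\<lambda>w. (D w)\<^sup>2) \<le> 0" by (meson dense not_le)
  moreover have "0 \<le> int_S2 (\<lambda>w. (D w)\<^sup>2)" by (rule int_S2_nonneg) simp
  ultimately have "(D w)\<^sup>2 = 0"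
    by (intro int_S2_eq_0_imp[of "\<lambda>w. (D w)\<^sup>2"]) (auto intro!: continuous_intros D w)
  then show ?thesis by simp
qed

text \<open>
  As a function of \<open>w\<close> the integral depends only on \<open>x \<bullet> w\<close>: two points with the same inner
  product are exchanged by a reflection that fixes \<open>x\<close>. It is orthogonal to the zonal
  harmonics of all other degrees, so it is a multiple of \<open>P\<^sub>l\<close>, and the factor is found at
  \<open>w = x\<close>.
\<close>

lemma legendre_poly_reproducing:
  assumes x: "x \<in> S2" and w: "w \<in> S2"
  shows "int_S2 (\<lambda>y. legendre l (x \<bullet> y) * legendre l (y \<bullet> w)) = 4 * pi / (2 * real l + 1) * legendre l (x \<bullet> w)"
proof -
  define G where "G w = int_S2 (\<lambda>y. legendre l (x \<bullet> y) * legendre l (y \<bullet> w))" for w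
  define N where "N = 4 * pi / (2 * real l + 1)"
  have N: "N > 0" "int_S2 (\<lambda>y. (legendre l (x \<bullet> y))\<^sup>2) = N"
    using legendre_poly_norm[OF x, of l] by (auto simp: N_def inner_commute add_nonneg_pos)
  \<comment> \<open>With this factor the difference \<open>D\<close> is also orthogonal to the zonal harmonic of degree \<open>l\<close>.\<close>
  define c where "c = int_S2 (\<lambda>w. G w * legendre l (x \<bullet> w)) / N"
  define D where "D w = G w - c * legendre l (x \<bullet> w)" for w
  have kc: "continuous_on (S2 \<times> S2) (\<lambda>p. legendre l (x \<bullet> snd p) * legendre l (snd p \<bullet> fst p))"
    by (intro continuous_intros)
  have Gc: "continuous_on S2 G"
    unfolding G_def by (rule int_S2_param_continuous[where h = "\<lambda>w y. legendre l (x \<bullet> y) * legendre l (y \<bullet> w)"]) (rule kc)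
  have Gz: "G w = G w'" if "w \<in> S2" "w' \<in> S2" "x \<bullet> w = x \<bullet> w'" for w w'
  proof -
    have "norm w = norm w'" using that by (simp add: S2_iff)
    then obtain T where T: "orthogonal_transformation T" "T w = w'" and Tf: "\<And>v. v \<bullet> w = v \<bullet> w' \<Longrightarrow> T v = v"
      using reflection_exists by blast
    have Tx: "T x = x" by (rule Tf) (rule that(3))
    have ip: "T a \<bullet> T b = a \<bullet> b" for a b using T(1) by (simp add: orthogonal_transformation_def)
    have "G w' = int_S2 (\<lambda>y. legendre l (x \<bullet> T y) * legendre l (T y \<bullet> w'))"
      unfolding G_def by (rule int_S2_orth[OF T(1), symmetric, of "\<lambda>y. legendre l (x \<bullet> y) * legendre l (y \<bullet> w')"])
        (intro continuous_intros)
    also have "\<dots> = G w"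
    proof -
      have "x \<bullet> T y = x \<bullet> y" "T y \<bullet> w' = y \<bullet> w" for y
        using ip[of x y] ip[of y w] T(2) Tx by simp_all
      then show ?thesis by (simp add: G_def)
    qed
    finally show ?thesis by simp
  qed
  have G0: "int_S2 (\<lambda>w. G w * legendre j (x \<bullet> w)) = 0" if "j \<noteq> l" for j
  proof -
    have "int_S2 (\<lambda>w. G w * legendre j (x \<bullet> w)) = int_S2 (\<lambda>w. int_S2 (\<lambda>y. legendre l (x \<bullet> y) * legendre l (y \<bullet> w) * legendre j (x \<bullet> w)))"
    proof -
      have "G w * legendre j (x \<bullet> w) = int_S2 (\<lambda>y. legendre l (x \<bullet> y) * legendre l (y \<bullet> w) * legendre j (x \<bullet> w))" for w
        using int_S2_cmult[of "legendre j (x \<bullet> w)" "\<lambda>y. legendre l (x \<bullet> y) * legendre l (y \<bullet> w)"] by (simp add: G_def mult.commute)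
      then show ?thesis by simp
    qed
    also have "\<dots> = int_S2 (\<lambda>y. int_S2 (\<lambda>w. legendre l (x \<bullet> y) * legendre l (y \<bullet> w) * legendre j (x \<bullet> w)))"
      by (rule int_S2_fubini) (intro continuous_intros)
    also have "\<dots> = int_S2 (\<lambda>y. 0)"
    proof (rule int_S2_cong)
      fix y assume y: "y \<in> S2"
      have "int_S2 (\<lambda>w. legendre l (x \<bullet> y) * legendre l (y \<bullet> w) * legendre j (x \<bullet> w)) = legendre l (x \<bullet> y) * int_S2 (\<lambda>w. legendre l (w \<bullet> y) * legendre j (w \<bullet> x))"
        using int_S2_cmult[of "legendre l (x \<bullet> y)" "\<lambda>w. legendre l (w \<bullet> y) * legendre j (w \<bullet> x)"]
        by (simp add: mult.assoc inner_commute)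
      then show "int_S2 (\<lambda>w. legendre l (x \<bullet> y) * legendre l (y \<bullet> w) * legendre j (x \<bullet> w)) = 0"
        using legendre_poly_orthogonal[OF y x] that by simp
    qed
    finally show ?thesis by (simp add: int_S2_def)
  qed
  have Dorth: "int_S2 (\<lambda>w. D w * legendre j (x \<bullet> w)) = 0" for j
  proof -
    have "int_S2 (\<lambda>w. D w * legendre j (x \<bullet> w)) = int_S2 (\<lambda>w. G w * legendre j (x \<bullet> w) - c * (legendre l (x \<bullet> w) * legendre j (x \<bullet> w)))"
      by (simp add: D_def algebra_simps)
    also have "\<dots> = int_S2 (\<lambda>w. G w * legendre j (x \<bullet> w)) - c * int_S2 (\<lambda>w. legendre l (x \<bullet> w) * legendre j (x \<bullet> w))"
      by (subst int_S2_diff) (auto intro!: continuous_intros Gc simp: int_S2_cmult)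
    also have "\<dots> = 0"
    proof (cases "j = l")
      case True
      then show ?thesis using N by (simp add: c_def power2_eq_square)
    next
      case False
      then show ?thesis using G0 legendre_poly_orthogonal[OF x x, of l j] by (simp add: inner_commute)
    qed
    finally show ?thesis .
  qed
  have D0: "D w = 0" if "w \<in> S2" for w
    by (rule zonal_zero[OF x _ _ Dorth that])
      (auto simp: D_def intro!: continuous_intros Gc dest: Gz)
  have "G x = N" using N(2) by (simp add: G_def inner_commute power2_eq_square)
  moreover have "x \<bullet> x = 1" using x by (simp add: S2_iff norm_eq_1)
  ultimately have "c = N" using D0[OF x] by (simp add: D_def legendre_poly_1)
  then show ?thesis using D0[OF w] by (simp add: D_def G_def N_def)
qed

section \<open>Harmonic projections and Parseval's identity\<close>

text \<open>
  Orthogonal projection onto the spherical harmonics of degree \<open>l\<close>, as integral operator with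
  the zonal kernel.
\<close>

definition harmonic_proj :: "nat \<Rightarrow> (real^3 \<Rightarrow> real) \<Rightarrow> real^3 \<Rightarrow> real" where
  "harmonic_proj l f x = int_S2 (\<lambda>y. (2 * real l + 1) / (4 * pi) * legendre l (x \<bullet> y) * f y)"

lemma harmonic_proj_kernel_continuous:
  assumes "continuous_on S2 f"
  shows "continuous_on (S2 \<times> S2) (\<lambda>p. poly q (fst p \<bullet> snd p) * f (snd p))"
  using continuous_on_kernel[OF assms continuous_on_const[of S2 1]] by simp

lemma convolution_continuous:
  "continuous_on S2 f \<Longrightarrow> continuous_on S2 (\<lambda>x. int_S2 (\<lambda>y. poly q (x \<bullet> y) * f y))"
  by (rule int_S2_param_continuous) (rule harmonic_proj_kernel_continuous)

lemma harmonic_proj_eq: "harmonic_proj l f x = (2 * real l + 1) / (4 * pi) * int_S2 (\<lambda>y. legendre l (x \<bullet> y) * f y)"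
  unfolding harmonic_proj_def mult.assoc by (rule int_S2_cmult)

lemma harmonic_proj_continuous: "continuous_on S2 f \<Longrightarrow> continuous_on S2 (harmonic_proj l f)"
  unfolding harmonic_proj_eq[abs_def] by (intro continuous_intros convolution_continuous)

lemma harmonic_proj_sym:
  assumes f: "continuous_on S2 f" and g: "continuous_on S2 g"
  shows "int_S2 (\<lambda>x. g x * harmonic_proj l f x) = int_S2 (\<lambda>x. harmonic_proj l g x * f x)"
proof -
  define c where "c = (2 * real l + 1) / (4 * pi)"
  have he: "harmonic_proj l f x = c * int_S2 (\<lambda>y. legendre l (x \<bullet> y) * f y)" for f x
    by (simp add: harmonic_proj_eq c_def)
  have "int_S2 (\<lambda>x. g x * harmonic_proj l f x) = c * int_S2 (\<lambda>x. int_S2 (\<lambda>y. g x * (legendre l (x \<bullet> y) * f y)))"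
    by (simp add: he int_S2_cmult mult.left_commute)
  also have "int_S2 (\<lambda>x. int_S2 (\<lambda>y. g x * (legendre l (x \<bullet> y) * f y))) = int_S2 (\<lambda>y. int_S2 (\<lambda>x. g x * (legendre l (x \<bullet> y) * f y)))"
    by (rule int_S2_fubini) (rule continuous_on_kernel[OF f g])
  also have "\<dots> = int_S2 (\<lambda>y. f y * int_S2 (\<lambda>x. legendre l (y \<bullet> x) * g x))"
    by (simp add: int_S2_cmult[symmetric] inner_commute mult_ac)
  also have "c * \<dots> = int_S2 (\<lambda>x. harmonic_proj l g x * f x)"
    by (simp add: he int_S2_cmult[symmetric] mult_ac)
  finally show ?thesis .
qed

lemma harmonic_proj_harmonic_proj:
  assumes f: "continuous_on S2 f" and x: "x \<in> S2"
  shows "harmonic_proj l (harmonic_proj k f) x = (if l = k then harmonic_proj l f x else 0)"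
proof -
  define c where "c l = (2 * real l + 1) / (4 * pi)" for l
  have he: "harmonic_proj l f x = c l * int_S2 (\<lambda>y. legendre l (x \<bullet> y) * f y)" for l f x
    by (simp add: harmonic_proj_eq c_def)
  have c0: "c l \<noteq> 0" by (simp add: c_def add_nonneg_eq_0_iff)
  have "harmonic_proj l (harmonic_proj k f) x = c l * int_S2 (\<lambda>y. legendre l (x \<bullet> y) * (c k * int_S2 (\<lambda>w. legendre k (y \<bullet> w) * f w)))"
    by (simp add: he)
  also have "\<dots> = c l * c k * int_S2 (\<lambda>y. legendre l (x \<bullet> y) * int_S2 (\<lambda>w. legendre k (y \<bullet> w) * f w))"
    by (simp add: int_S2_cmult mult.left_commute)
  also have "int_S2 (\<lambda>y. legendre l (x \<bullet> y) * int_S2 (\<lambda>w. legendre k (y \<bullet> w) * f w))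
     = int_S2 (\<lambda>y. int_S2 (\<lambda>w. legendre l (x \<bullet> y) * (legendre k (y \<bullet> w) * f w)))"
    by (simp add: int_S2_cmult)
  also have "\<dots> = int_S2 (\<lambda>w. int_S2 (\<lambda>y. legendre l (x \<bullet> y) * (legendre k (y \<bullet> w) * f w)))"
    by (rule int_S2_fubini) (rule continuous_on_kernel[OF f zonal_continuous'])
  also have "\<dots> = int_S2 (\<lambda>w. f w * int_S2 (\<lambda>y. legendre l (x \<bullet> y) * legendre k (y \<bullet> w)))"
    by (simp add: int_S2_cmult[symmetric] mult_ac)
  also have "\<dots> = int_S2 (\<lambda>w. (if l = k then inverse (c l) else 0) * (legendre l (x \<bullet> w) * f w))"
  proof (rule int_S2_cong)
    fix w assume w: "w \<in> S2"
    have "int_S2 (\<lambda>y. legendre l (x \<bullet> y) * legendre k (y \<bullet> w)) = (if l = k then inverse (c l) * legendre l (x \<bullet> w) else 0)"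
      using legendre_poly_reproducing[OF x w, of l] legendre_poly_orthogonal[OF x w, of l k] by (cases "l = k") (auto simp: inner_commute c_def)
    then show "f w * int_S2 (\<lambda>y. legendre l (x \<bullet> y) * legendre k (y \<bullet> w)) = (if l = k then inverse (c l) else 0) * (legendre l (x \<bullet> w) * f w)"
      by simp
  qed
  also have "c l * c k * \<dots> = (if l = k then harmonic_proj l f x else 0)"
    using c0 by (auto simp: int_S2_cmult he)
  finally show ?thesis .
qed

definition harmonic_energy :: "nat \<Rightarrow> (real^3 \<Rightarrow> real) \<Rightarrow> real" where
  "harmonic_energy l f = int_S2 (\<lambda>x. (harmonic_proj l f x)\<^sup>2)"

lemma harmonic_energy_nonneg: "harmonic_energy l f \<ge> 0"
  unfolding harmonic_energy_def by (rule int_S2_nonneg) simp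

lemma int_S2_harmonic_proj_harmonic_proj:
  assumes f: "continuous_on S2 f" and g: "continuous_on S2 g"
  shows "int_S2 (\<lambda>x. harmonic_proj l f x * harmonic_proj k g x) = (if l = k then int_S2 (\<lambda>x. harmonic_proj l f x * g x) else 0)"
proof -
  have "int_S2 (\<lambda>x. harmonic_proj l f x * harmonic_proj k g x) = int_S2 (\<lambda>x. harmonic_proj k (harmonic_proj l f) x * g x)"
    by (rule harmonic_proj_sym[OF g harmonic_proj_continuous[OF f]])
  also have "\<dots> = int_S2 (\<lambda>x. (if l = k then harmonic_proj l f x else 0) * g x)"
    by (rule int_S2_cong) (use harmonic_proj_harmonic_proj[OF f] in auto)
  finally show ?thesis by (auto simp: int_S2_def)
qed

lemma harmonic_energy_eq: "continuous_on S2 f \<Longrightarrow> harmonic_energy l f = int_S2 (\<lambda>x. harmonic_proj l f x * f x)"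
  using int_S2_harmonic_proj_harmonic_proj[of f f l l] by (simp add: harmonic_energy_def power2_eq_square)

lemma int_S2_diff_harmonic_proj_sq:
  fixes b :: "nat \<Rightarrow> real"
  assumes f: "continuous_on S2 f"
  shows "int_S2 (\<lambda>x. (f x - (\<Sum>l<n. b l * harmonic_proj l f x))\<^sup>2) = int_S2 (\<lambda>x. (f x)\<^sup>2) - (\<Sum>l<n. (2 * b l - (b l)\<^sup>2) * harmonic_energy l f)"
proof -
  let ?g = "\<lambda>x. \<Sum>l<n. b l * harmonic_proj l f x"
  have hc: "continuous_on S2 (harmonic_proj l f)" for l by (rule harmonic_proj_continuous[OF f])
  have gc: "continuous_on S2 ?g" by (intro continuous_intros hc)
  have 1: "int_S2 (\<lambda>x. ?g x * f x) = (\<Sum>l<n. b l * harmonic_energy l f)"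
  proof -
    have "int_S2 (\<lambda>x. ?g x * f x) = int_S2 (\<lambda>x. \<Sum>l<n. b l * (harmonic_proj l f x * f x))"
      by (simp add: sum_distrib_right mult.assoc)
    also have "\<dots> = (\<Sum>l<n. b l * harmonic_energy l f)"
      by (subst int_S2_sum) (auto intro!: continuous_intros hc f simp: int_S2_cmult harmonic_energy_eq[OF f])
    finally show ?thesis .
  qed
  have 2: "int_S2 (\<lambda>x. (?g x)\<^sup>2) = (\<Sum>l<n. (b l)\<^sup>2 * harmonic_energy l f)"
  proof -
    have "int_S2 (\<lambda>x. (?g x)\<^sup>2) = int_S2 (\<lambda>x. \<Sum>l<n. \<Sum>k<n. b l * b k * (harmonic_proj l f x * harmonic_proj k f x))"
      by (simp add: power2_eq_square sum_product mult_ac)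
    also have "\<dots> = (\<Sum>l<n. \<Sum>k<n. b l * b k * int_S2 (\<lambda>x. harmonic_proj l f x * harmonic_proj k f x))"
    proof -
      have "int_S2 (\<lambda>x. \<Sum>l<n. \<Sum>k<n. b l * b k * (harmonic_proj l f x * harmonic_proj k f x))
          = (\<Sum>l<n. int_S2 (\<lambda>x. \<Sum>k<n. b l * b k * (harmonic_proj l f x * harmonic_proj k f x)))"
        by (rule int_S2_sum) (intro continuous_intros hc)
      moreover have "int_S2 (\<lambda>x. \<Sum>k<n. b l * b k * (harmonic_proj l f x * harmonic_proj k f x))
          = (\<Sum>k<n. b l * b k * int_S2 (\<lambda>x. harmonic_proj l f x * harmonic_proj k f x))" for l
        by (subst int_S2_sum) (auto intro!: continuous_intros hc simp: int_S2_cmult)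
      ultimately show ?thesis by simp
    qed
    also have "\<dots> = (\<Sum>l<n. \<Sum>k<n. if l = k then b l * b k * harmonic_energy l f else 0)"
      by (intro sum.cong refl) (simp add: int_S2_harmonic_proj_harmonic_proj[OF f f] harmonic_energy_eq[OF f])
    also have "\<dots> = (\<Sum>l<n. (b l)\<^sup>2 * harmonic_energy l f)"
      by (simp add: power2_eq_square)
    finally show ?thesis .
  qed
  have "int_S2 (\<lambda>x. (f x - ?g x)\<^sup>2) = int_S2 (\<lambda>x. (f x)\<^sup>2 - (2 * (?g x * f x) - (?g x)\<^sup>2))"
    by (simp add: power2_diff algebra_simps)
  also have "\<dots> = int_S2 (\<lambda>x. (f x)\<^sup>2) - (2 * int_S2 (\<lambda>x. ?g x * f x) - int_S2 (\<lambda>x. (?g x)\<^sup>2))"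
  proof -
    have c: "continuous_on S2 (\<lambda>x. 2 * (g x * f x) - (g x)\<^sup>2)" "continuous_on S2 (\<lambda>x. (f x)\<^sup>2)"
      "continuous_on S2 (\<lambda>x. (g x)\<^sup>2)" "continuous_on S2 (\<lambda>x. 2 * (g x * f x))" if "continuous_on S2 g" for g
      by (intro continuous_intros f that)+
    show ?thesis unfolding int_S2_diff[OF c(2,1)[OF gc]] int_S2_diff[OF c(4,3)[OF gc]] int_S2_cmult ..
  qed
  finally show ?thesis
    unfolding 1 2 by (simp add: sum_subtractf sum_distrib_left algebra_simps)
qed

lemma bessel:
  assumes "continuous_on S2 f"
  shows "(\<Sum>l<n. harmonic_energy l f) \<le> int_S2 (\<lambda>x. (f x)\<^sup>2)"
proof -
  have "0 \<le> int_S2 (\<lambda>x. (f x - (\<Sum>l<n. 1 * harmonic_proj l f x))\<^sup>2)" by (rule int_S2_nonneg) simp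
  then show ?thesis using int_S2_diff_harmonic_proj_sq[OF assms, where b = "\<lambda>_. 1" and n = n] by simp
qed

text \<open>Profile of a zonal kernel that concentrates at \<open>t = 1\<close> for large \<open>n\<close>.\<close>

definition peak_poly :: "nat \<Rightarrow> real poly" where "peak_poly n = [:1/2, 1/2:] ^ n"

lemma poly_peak_poly: "poly (peak_poly n) t = ((1 + t) / 2) ^ n"
  by (simp add: peak_poly_def poly_power field_simps)

lemma pderiv_peak_poly: "pderiv (peak_poly (Suc n)) = smult ((real n + 1) / 2) (peak_poly n)"
  unfolding peak_poly_def pderiv_power_Suc by (simp add: pderiv_pCons add.commute)

text \<open>
  The Laplacian of the zonal function of index \<open>n + 1\<close> is a combination of those of index \<open>n\<close>
  and \<open>n + 1\<close>, and its integral vanishes.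
\<close>

lemma int_S2_peak_poly:
  assumes w: "w \<in> S2"
  shows "int_S2 (\<lambda>y. poly (peak_poly n) (w \<bullet> y)) = 4 * pi / (real n + 1)"
proof (induction n)
  case 0 show ?case by (simp add: peak_poly_def int_S2_const)
next
  case (Suc n)
  let ?q = "peak_poly (Suc n)"
  have "int_S2 (\<lambda>x. 1 * lap_S2 (\<lambda>x. poly ?q (x \<bullet> w)) x) = 0"
    using int_S2_green[OF smooth_S2_const[of 1] smooth_S2_zonal[of ?q w]] by (simp add: int_S2_def)
  moreover have "lap_S2 (\<lambda>x. poly ?q (x \<bullet> w)) x =
     (real n + 1) * ((real n + 1) * poly (peak_poly n) (x \<bullet> w) - (real n + 2) * poly ?q (x \<bullet> w))" if x: "x \<in> S2" for x
  proof -
    define s where "s = (1 + x \<bullet> w) / 2"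
    have t: "x \<bullet> w = 2 * s - 1" by (simp add: s_def field_simps)
    have d1: "poly (pderiv ?q) (x \<bullet> w) = (real n + 1) / 2 * s ^ n"
      by (simp add: pderiv_peak_poly poly_peak_poly s_def)
    have d2: "(1 - (x \<bullet> w)\<^sup>2) * poly (pderiv (pderiv ?q)) (x \<bullet> w) = (real n + 1) * real n * (1 - s) * s ^ n"
    proof (cases n)
      case 0 then show ?thesis by (simp add: pderiv_peak_poly pderiv_smult) (simp add: peak_poly_def)
    next
      case (Suc m)
      have "poly (pderiv (pderiv ?q)) (x \<bullet> w) = (real n + 1) * real n / 4 * s ^ m"
        unfolding Suc by (simp add: pderiv_peak_poly pderiv_smult poly_peak_poly s_def)
      moreover have "1 - (x \<bullet> w)\<^sup>2 = 4 * s * (1 - s)" unfolding t by (simp add: power2_eq_square algebra_simps)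
      ultimately show ?thesis by (simp add: Suc)
    qed
    have "lap_S2 (\<lambda>x. poly ?q (x \<bullet> w)) x = (real n + 1) * real n * (1 - s) * s ^ n - 2 * (2 * s - 1) * ((real n + 1) / 2 * s ^ n)"
      unfolding lap_S2_zonal[OF x w] d1 d2 by (simp add: t)
    also have "\<dots> = (real n + 1) * ((real n + 1) * s ^ n - (real n + 2) * s ^ Suc n)"
      by (simp add: field_simps)
    finally show ?thesis by (simp only: poly_peak_poly s_def)
  qed
  ultimately have "0 = int_S2 (\<lambda>x. (real n + 1) * ((real n + 1) * poly (peak_poly n) (x \<bullet> w) - (real n + 2) * poly ?q (x \<bullet> w)))"
    by (simp cong: int_S2_cong)
  also have "\<dots> = (real n + 1) * ((real n + 1) * int_S2 (\<lambda>x. poly (peak_poly n) (x \<bullet> w)) - (real n + 2) * int_S2 (\<lambda>x. poly ?q (x \<bullet> w)))"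
    by (simp only: int_S2_cmult) (subst int_S2_diff, auto intro!: continuous_intros simp: int_S2_cmult)
  finally have "(real n + 2) * int_S2 (\<lambda>x. poly ?q (x \<bullet> w)) = (real n + 1) * int_S2 (\<lambda>x. poly (peak_poly n) (x \<bullet> w))"
    by auto
  then show ?case using Suc.IH by (simp add: inner_commute[of w] field_simps)
qed

text \<open>
  Where \<open>y\<close> is far from \<open>x\<close>, the kernel is at most \<open>r\<^sup>n\<close> with \<open>r < 1\<close>, which beats the
  normalising factor \<open>n + 1\<close>; where it is near, uniform continuity of \<open>f\<close> applies.
\<close>

lemma approx_identity:
  assumes f: "continuous_on S2 f" and e: "e > 0"
  shows "\<forall>\<^sub>F n in sequentially. \<forall>x \<in> S2.
     \<bar>(real n + 1) / (4 * pi) * int_S2 (\<lambda>y. poly (peak_poly n) (x \<bullet> y) * f y) - f x\<bar> \<le> e"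
proof -
  obtain M where M: "M \<ge> 0" "\<And>w. w \<in> S2 \<Longrightarrow> \<bar>f w\<bar> \<le> M" using S2_bounded_above[OF f] by blast
  have "uniformly_continuous_on S2 f" using f compact_S2 compact_uniformly_continuous by blast
  then obtain d where d: "d > 0" "\<And>x y. x \<in> S2 \<Longrightarrow> y \<in> S2 \<Longrightarrow> dist y x < d \<Longrightarrow> dist (f y) (f x) < e / 2"
    unfolding uniformly_continuous_on_def using e by (metis half_gt_zero)
  \<comment> \<open>At distance \<open>d\<close> on the sphere, \<open>(1 + x \<bullet> y) / 2 = 1 - d\<^sup>2 / 4\<close>.\<close>
  define r where "r = max 0 (1 - d\<^sup>2 / 4)"
  have r: "0 \<le> r" "r < 1" using d by (auto simp: r_def)
  have "(\<lambda>n. (real n + 1) * r ^ n * (2 * M)) \<longlonglongrightarrow> 0"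
  proof -
    have "(\<lambda>n. real n * r ^ n + r ^ n) \<longlonglongrightarrow> 0 + 0"
      using r by (intro tendsto_add powser_times_n_limit_0 LIMSEQ_realpow_zero) auto
    then show ?thesis using tendsto_mult_left_zero[of "\<lambda>n. real n * r ^ n + r ^ n" sequentially "2 * M"]
      by (simp add: distrib_right)
  qed
  then have "\<forall>\<^sub>F n in sequentially. (real n + 1) * r ^ n * (2 * M) < e / 2"
    using e by (intro order_tendstoD(2)) auto
  then show ?thesis
  proof eventually_elim
    case (elim n)
    show ?case
    proof
      fix x assume x: "x \<in> S2"
      let ?c = "(real n + 1) / (4 * pi)"
      let ?k = "\<lambda>y. poly (peak_poly n) (x \<bullet> y)"
      have c: "?c > 0" by (simp add: add_nonneg_pos)
      have kn: "?k y \<ge> 0" if "y \<in> S2" for y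
      proof -
        have "\<bar>x \<bullet> y\<bar> \<le> 1" using Cauchy_Schwarz_ineq2[of x y] x that by (simp add: S2_iff)
        then show ?thesis by (simp add: poly_peak_poly)
      qed
      have pt: "?k y * \<bar>f y - f x\<bar> \<le> e / 2 * ?k y + r ^ n * (2 * M)" if y: "y \<in> S2" for y
      proof (cases "dist y x < d")
        case True
        have "\<bar>f y - f x\<bar> \<le> e / 2" using d(2)[OF x y True] by (simp add: dist_real_def)
        then have "?k y * \<bar>f y - f x\<bar> \<le> ?k y * (e / 2)" using kn[OF y] by (rule mult_left_mono)
        moreover have "?k y * (e / 2) = e / 2 * ?k y" by simp
        moreover have "0 \<le> r ^ n * (2 * M)" using r M by simp
        ultimately show ?thesis by linarith
      next
        case False
        have xx: "x \<bullet> x = 1" "y \<bullet> y = 1" using x y by (auto simp: S2_iff norm_eq_1)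
        have "d\<^sup>2 \<le> (dist y x)\<^sup>2" using False d by (intro power_mono) auto
        also have "(dist y x)\<^sup>2 = 2 - 2 * (x \<bullet> y)"
          by (simp add: dist_norm power2_norm_eq_inner inner_diff_left inner_diff_right xx inner_commute[of y x])
        finally have "d\<^sup>2 \<le> 2 - 2 * (x \<bullet> y)" .
        moreover have "1 - d\<^sup>2 / 4 \<le> r" by (simp add: r_def)
        ultimately have "(1 + x \<bullet> y) / 2 \<le> r" by (simp add: field_simps)
        moreover have "0 \<le> (1 + x \<bullet> y) / 2"
        proof -
          have "\<bar>x \<bullet> y\<bar> \<le> 1" using Cauchy_Schwarz_ineq2[of x y] x y by (simp add: S2_iff)
          then show ?thesis by simp
        qed
        ultimately have "?k y \<le> r ^ n" unfolding poly_peak_poly by (rule power_mono)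
        moreover have "\<bar>f y - f x\<bar> \<le> 2 * M" using M(2)[OF x] M(2)[OF y] by linarith
        ultimately have "?k y * \<bar>f y - f x\<bar> \<le> r ^ n * (2 * M)" using r by (intro mult_mono) auto
        moreover have "0 \<le> e / 2 * ?k y" using e kn[OF y] by simp
        ultimately show ?thesis by linarith
      qed
      have one: "?c * int_S2 ?k = 1" unfolding int_S2_peak_poly[OF x] by (simp add: add_nonneg_eq_0_iff)
      have "?c * int_S2 (\<lambda>y. ?k y * f y) - f x = ?c * int_S2 (\<lambda>y. ?k y * f y) - ?c * int_S2 ?k * f x"
        by (simp only: one mult_1)
      also have "\<dots> = ?c * (int_S2 (\<lambda>y. ?k y * f y) - int_S2 (\<lambda>y. f x * ?k y))"
        unfolding int_S2_cmult by (simp add: algebra_simps)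
      also have "int_S2 (\<lambda>y. ?k y * f y) - int_S2 (\<lambda>y. f x * ?k y) = int_S2 (\<lambda>y. ?k y * (f y - f x))"
        by (subst int_S2_diff[symmetric]) (auto intro!: continuous_intros f simp: algebra_simps)
      finally have eq: "?c * int_S2 (\<lambda>y. ?k y * f y) - f x = ?c * int_S2 (\<lambda>y. ?k y * (f y - f x))" .
      have ab: "\<bar>int_S2 (\<lambda>y. ?k y * (f y - f x))\<bar> \<le> int_S2 (\<lambda>y. e / 2 * ?k y + r ^ n * (2 * M))"
      proof (rule abs_leI)
        show "int_S2 (\<lambda>y. ?k y * (f y - f x)) \<le> int_S2 (\<lambda>y. e / 2 * ?k y + r ^ n * (2 * M))"
        proof (rule int_S2_mono)
          fix y assume y: "y \<in> S2"
          have "?k y * (f y - f x) \<le> ?k y * \<bar>f y - f x\<bar>" using kn[OF y] by (intro mult_left_mono) auto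
          then show "?k y * (f y - f x) \<le> e / 2 * ?k y + r ^ n * (2 * M)" using pt[OF y] by linarith
        qed (auto intro!: continuous_intros f)
        show "- int_S2 (\<lambda>y. ?k y * (f y - f x)) \<le> int_S2 (\<lambda>y. e / 2 * ?k y + r ^ n * (2 * M))"
          unfolding int_S2_uminus[symmetric]
        proof (rule int_S2_mono)
          fix y assume y: "y \<in> S2"
          have "?k y * (- (f y - f x)) \<le> ?k y * \<bar>f y - f x\<bar>" using kn[OF y] by (intro mult_left_mono) auto
          then have "?k y * (- (f y - f x)) \<le> e / 2 * ?k y + r ^ n * (2 * M)" using pt[OF y] by linarith
          then show "- (?k y * (f y - f x)) \<le> e / 2 * ?k y + r ^ n * (2 * M)" by (simp only: mult_minus_right)
        qed (auto intro!: continuous_intros f)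
      qed
      also have "int_S2 (\<lambda>y. e / 2 * ?k y + r ^ n * (2 * M)) = e / 2 * int_S2 ?k + 4 * pi * (r ^ n * (2 * M))"
      proof -
        have "int_S2 (\<lambda>y. e / 2 * ?k y + r ^ n * (2 * M)) = int_S2 (\<lambda>y. e / 2 * ?k y) + int_S2 (\<lambda>y. r ^ n * (2 * M))"
          by (rule int_S2_add) (intro continuous_intros)+
        then show ?thesis unfolding int_S2_cmult[of "e / 2"] int_S2_const .
      qed
      finally have "?c * \<bar>int_S2 (\<lambda>y. ?k y * (f y - f x))\<bar> \<le> ?c * (e / 2 * int_S2 ?k + 4 * pi * (r ^ n * (2 * M)))"
        using c by (intro mult_left_mono) auto
      also have "\<dots> = e / 2 * (?c * int_S2 ?k) + (real n + 1) * r ^ n * (2 * M)"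
        by (simp add: field_simps)
      also have "\<dots> \<le> e" unfolding one using elim by simp
      finally show "\<bar>?c * int_S2 (\<lambda>y. ?k y * f y) - f x\<bar> \<le> e"
        unfolding eq abs_mult using c by simp
    qed
  qed
qed

text \<open>
  The partial sums are the squared norms of the best approximations of \<open>f\<close> by harmonics of
  bounded degree. Convolution with a polynomial zonal kernel is a combination of finitely many
  projections, so the approximate identity provides arbitrarily good approximations.
\<close>

lemma parseval:
  assumes f: "continuous_on S2 f"
  shows "(\<lambda>l. harmonic_energy l f) sums int_S2 (\<lambda>x. (f x)\<^sup>2)"
proof -
  have inc: "incseq (\<lambda>n. \<Sum>l<n. harmonic_energy l f)"
    by (rule incseq_SucI) (simp add: harmonic_energy_nonneg)
  have low: "\<exists>n. int_S2 (\<lambda>x. (f x)\<^sup>2) - e \<le> (\<Sum>l<n. harmonic_energy l f)" if e: "e > 0" for e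
  proof -
    \<comment> \<open>A uniform error of \<open>d\<close> has squared norm \<open>e\<close>.\<close>
    define d where "d = sqrt (e / (4 * pi))"
    have d: "d > 0" "4 * pi * d\<^sup>2 = e" using e by (auto simp: d_def)
    from approx_identity[OF f d(1)]
    obtain n where n: "\<And>x. x \<in> S2 \<Longrightarrow> \<bar>(real n + 1) / (4 * pi) * int_S2 (\<lambda>y. poly (peak_poly n) (x \<bullet> y) * f y) - f x\<bar> \<le> d"
      by (auto simp: eventually_sequentially)
    obtain a N where aN: "smult ((real n + 1) / (4 * pi)) (peak_poly n) = (\<Sum>j<N. smult (a j) (legendre_poly j))"
      using legendre_poly_expansion by blast
    \<comment> \<open>The projections contain the factor \<open>(2 l + 1) / (4 \<pi>)\<close>, the expansion does not.\<close>
    define b where "b l = a l * (4 * pi / (2 * real l + 1))" for l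
    have bc: "b l * ((2 * real l + 1) / (4 * pi)) = a l" for l
      by (simp add: b_def add_nonneg_eq_0_iff)
    have T: "(real n + 1) / (4 * pi) * int_S2 (\<lambda>y. poly (peak_poly n) (x \<bullet> y) * f y) = (\<Sum>l<N. b l * harmonic_proj l f x)" for x
    proof -
      have "(real n + 1) / (4 * pi) * int_S2 (\<lambda>y. poly (peak_poly n) (x \<bullet> y) * f y)
          = int_S2 (\<lambda>y. poly (smult ((real n + 1) / (4 * pi)) (peak_poly n)) (x \<bullet> y) * f y)"
        unfolding int_S2_cmult[symmetric] by (simp add: mult.assoc)
      also have "\<dots> = int_S2 (\<lambda>y. \<Sum>l<N. a l * (legendre l (x \<bullet> y) * f y))"
        unfolding aN by (simp add: poly_sum sum_distrib_right mult.assoc)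
      also have "\<dots> = (\<Sum>l<N. a l * int_S2 (\<lambda>y. legendre l (x \<bullet> y) * f y))"
        by (subst int_S2_sum) (auto intro!: continuous_intros f simp: int_S2_cmult)
      also have "\<dots> = (\<Sum>l<N. b l * harmonic_proj l f x)"
        unfolding harmonic_proj_eq by (simp add: bc[symmetric] mult.assoc)
      finally show ?thesis .
    qed
    have "(\<Sum>l<N. (2 * b l - (b l)\<^sup>2) * harmonic_energy l f) \<le> (\<Sum>l<N. harmonic_energy l f)"
    proof (rule sum_mono)
      fix l
      \<comment> \<open>With coefficients \<open>1\<close> the approximation would be the best one.\<close>
      have "2 * b l - (b l)\<^sup>2 \<le> 1" using zero_le_power2[of "b l - 1"] by (simp add: power2_diff)
      then show "(2 * b l - (b l)\<^sup>2) * harmonic_energy l f \<le> harmonic_energy l f"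
        using mult_right_mono[OF _ harmonic_energy_nonneg] by fastforce
    qed
    then have "int_S2 (\<lambda>x. (f x)\<^sup>2) - (\<Sum>l<N. harmonic_energy l f) \<le> int_S2 (\<lambda>x. (f x - (\<Sum>l<N. b l * harmonic_proj l f x))\<^sup>2)"
      unfolding int_S2_diff_harmonic_proj_sq[OF f] by simp
    also have "\<dots> \<le> int_S2 (\<lambda>x. d\<^sup>2)"
    proof (rule int_S2_mono)
      fix x assume "x \<in> S2"
      from n[OF this] have "\<bar>f x - (\<Sum>l<N. b l * harmonic_proj l f x)\<bar> \<le> \<bar>d\<bar>" unfolding T using d by simp
      then show "(f x - (\<Sum>l<N. b l * harmonic_proj l f x))\<^sup>2 \<le> d\<^sup>2" by (simp only: abs_le_square_iff)
    qed (auto intro!: continuous_intros f harmonic_proj_continuous)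
    also have "\<dots> = e" using d by (simp add: int_S2_const)
    finally show ?thesis by (intro exI[of _ N]) simp
  qed
  show ?thesis unfolding sums_def
  proof (rule LIMSEQ_I)
    fix e :: real assume e: "e > 0"
    obtain n0 where n0: "int_S2 (\<lambda>x. (f x)\<^sup>2) - e / 2 \<le> (\<Sum>l<n0. harmonic_energy l f)" using low[of "e / 2"] e by auto
    show "\<exists>no. \<forall>n\<ge>no. norm ((\<Sum>l<n. harmonic_energy l f) - int_S2 (\<lambda>x. (f x)\<^sup>2)) < e"
    proof (intro exI allI impI)
      fix n assume "n \<ge> n0"
      then have "(\<Sum>l<n0. harmonic_energy l f) \<le> (\<Sum>l<n. harmonic_energy l f)" using inc by (auto simp: incseq_def)
      then show "norm ((\<Sum>l<n. harmonic_energy l f) - int_S2 (\<lambda>x. (f x)\<^sup>2)) < e"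
        using n0 bessel[OF f, of n] e by simp
    qed
  qed
qed

lemma harmonic_proj_add: "continuous_on S2 f \<Longrightarrow> continuous_on S2 g \<Longrightarrow> harmonic_proj l (\<lambda>x. f x + g x) x = harmonic_proj l f x + harmonic_proj l g x"
  unfolding harmonic_proj_eq distrib_left
  by (subst int_S2_add) (auto intro!: continuous_intros simp: distrib_left)

text \<open>Polarisation of the identity for squares.\<close>

lemma parseval_bilinear:
  assumes f: "continuous_on S2 f" and g: "continuous_on S2 g"
  shows "(\<lambda>l. int_S2 (\<lambda>x. harmonic_proj l f x * harmonic_proj l g x)) sums int_S2 (\<lambda>x. f x * g x)"
proof -
  have fg: "continuous_on S2 (\<lambda>x. f x + g x)" by (intro continuous_intros f g)
  have sq: "int_S2 (\<lambda>x. u x * v x) = (int_S2 (\<lambda>x. (u x + v x)\<^sup>2) - int_S2 (\<lambda>x. (u x)\<^sup>2) - int_S2 (\<lambda>x. (v x)\<^sup>2)) / 2"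
    if u: "continuous_on S2 u" and v: "continuous_on S2 v" for u v
  proof -
    have "int_S2 (\<lambda>x. (u x + v x)\<^sup>2) = int_S2 (\<lambda>x. (u x)\<^sup>2 + (v x)\<^sup>2 + 2 * (u x * v x))"
      by (simp add: power2_sum mult.assoc)
    also have "\<dots> = int_S2 (\<lambda>x. (u x)\<^sup>2) + int_S2 (\<lambda>x. (v x)\<^sup>2) + 2 * int_S2 (\<lambda>x. u x * v x)"
      using u v by (simp add: int_S2_add int_S2_cmult continuous_on_add continuous_on_mult continuous_on_power)
    finally show ?thesis by simp
  qed
  have "(\<lambda>l. (harmonic_energy l (\<lambda>x. f x + g x) - harmonic_energy l f - harmonic_energy l g) / 2) sums
     ((int_S2 (\<lambda>x. (f x + g x)\<^sup>2) - int_S2 (\<lambda>x. (f x)\<^sup>2) - int_S2 (\<lambda>x. (g x)\<^sup>2)) / 2)"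
    by (intro sums_divide sums_diff parseval f g fg)
  then show ?thesis
    by (simp add: sq[OF f g] sq[OF harmonic_proj_continuous[OF f] harmonic_proj_continuous[OF g]] harmonic_energy_def harmonic_proj_add[OF f g])
qed

section \<open>The spectral inequality and the trapezoidal rule\<close>

text \<open>Eigenvalue of the negative Laplacian on the spherical harmonics of degree \<open>l\<close>.\<close>

definition sphere_ev :: "nat \<Rightarrow> real" where "sphere_ev l = real l * (real l + 1)"

lemma harmonic_proj_lap_S2:
  assumes f: "smooth_S2 f" and x: "x \<in> S2"
  shows "harmonic_proj l (lap_S2 f) x = - sphere_ev l * harmonic_proj l f x"
proof -
  have "int_S2 (\<lambda>y. legendre l (y \<bullet> x) * lap_S2 f y) = int_S2 (\<lambda>y. lap_S2 (\<lambda>y. legendre l (y \<bullet> x)) y * f y)"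
    by (rule int_S2_lap_S2_sym[OF smooth_S2_zonal f])
  also have "\<dots> = int_S2 (\<lambda>y. - sphere_ev l * (legendre l (y \<bullet> x) * f y))"
    by (rule int_S2_cong) (simp add: lap_S2_legendre_poly[OF _ x] sphere_ev_def)
  also have "\<dots> = - sphere_ev l * int_S2 (\<lambda>y. legendre l (y \<bullet> x) * f y)"
    by (rule int_S2_cmult)
  finally show ?thesis by (simp add: harmonic_proj_eq inner_commute[of x])
qed

text \<open>The Legendre polynomial of degree \<open>l\<close> has the parity of \<open>l\<close>.\<close>

lemma harmonic_proj_antipodal:
  assumes f: "continuous_on S2 f"
  shows "harmonic_proj l (\<lambda>x. f (- x)) x = (-1) ^ l * harmonic_proj l f x"
proof -
  have "int_S2 (\<lambda>y. legendre l (x \<bullet> y) * f (- y)) = int_S2 (\<lambda>y. legendre l (- (x \<bullet> - y)) * f (- y))" by simp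
  also have "\<dots> = int_S2 (\<lambda>y. legendre l (- (x \<bullet> y)) * f y)"
  proof (rule int_S2_orth[where T = uminus and f = "\<lambda>y. legendre l (- (x \<bullet> y)) * f y"])
    show "orthogonal_transformation (uminus :: real^3 \<Rightarrow> real^3)"
      using orthogonal_transformation_neg[of "\<lambda>x. x"] orthogonal_transformation_id by auto
    show "continuous_on S2 (\<lambda>y. legendre l (- (x \<bullet> y)) * f y)"
      unfolding legendre_poly_minus by (intro continuous_intros f)
  qed
  also have "\<dots> = (-1) ^ l * int_S2 (\<lambda>y. legendre l (x \<bullet> y) * f y)"
    unfolding legendre_poly_minus mult.assoc by (rule int_S2_cmult)
  finally show ?thesis by (simp add: harmonic_proj_eq)
qed

text \<open>
  The quadratic form of the \<open>p\<close>-th power of the negative Laplacian for \<open>p = 2\<close> and, otherwise,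
  for \<open>p = 3\<close>.
\<close>

definition smooth_form :: "nat \<Rightarrow> (real^3 \<Rightarrow> real) \<Rightarrow> real" where
  "smooth_form p f = (if p = 2 then int_S2 (\<lambda>x. (lap_S2 f x)\<^sup>2) else int_S2 (\<lambda>x. \<Sum>i\<in>UNIV. (sderiv i (lap_S2 f) x)\<^sup>2))"

lemma smooth_form_sums:
  assumes f: "smooth_S2 f" and p: "p \<in> {2, 3}"
  shows "(\<lambda>l. sphere_ev l ^ p * harmonic_energy l f) sums smooth_form p f"
proof -
  note fl = smooth_S2_lap_S2[OF f] and fll = smooth_S2_lap_S2[OF smooth_S2_lap_S2[OF f]]
  have e2: "int_S2 (\<lambda>x. harmonic_proj l (lap_S2 f) x * harmonic_proj l (lap_S2 f) x) = sphere_ev l ^ 2 * harmonic_energy l f" for l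
  proof -
    have "int_S2 (\<lambda>x. harmonic_proj l (lap_S2 f) x * harmonic_proj l (lap_S2 f) x) = int_S2 (\<lambda>x. sphere_ev l ^ 2 * (harmonic_proj l f x)\<^sup>2)"
      by (rule int_S2_cong) (simp add: harmonic_proj_lap_S2[OF f] power2_eq_square)
    then show ?thesis by (simp add: int_S2_cmult harmonic_energy_def)
  qed
  have e3: "int_S2 (\<lambda>x. harmonic_proj l (lap_S2 f) x * harmonic_proj l (lap_S2 (lap_S2 f)) x) = - (sphere_ev l ^ 3 * harmonic_energy l f)" for l
  proof -
    have "int_S2 (\<lambda>x. harmonic_proj l (lap_S2 f) x * harmonic_proj l (lap_S2 (lap_S2 f)) x) = int_S2 (\<lambda>x. - (sphere_ev l ^ 3) * (harmonic_proj l f x)\<^sup>2)"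
      by (rule int_S2_cong) (simp add: harmonic_proj_lap_S2[OF f] harmonic_proj_lap_S2[OF fl] power2_eq_square power3_eq_cube)
    then show ?thesis unfolding int_S2_cmult by (simp add: harmonic_energy_def)
  qed
  consider "p = 2" | "p = 3" using p by auto
  then show ?thesis
  proof cases
    case 1
    then show ?thesis
      using parseval_bilinear[OF smooth_S2_continuous[OF fl] smooth_S2_continuous[OF fl]]
      unfolding e2 by (simp add: smooth_form_def power2_eq_square)
  next
    case 2
    have "(\<lambda>l. - (sphere_ev l ^ 3 * harmonic_energy l f)) sums int_S2 (\<lambda>x. lap_S2 f x * lap_S2 (lap_S2 f) x)"
      using parseval_bilinear[OF smooth_S2_continuous[OF fl] smooth_S2_continuous[OF fll]] unfolding e3 .
    from sums_minus[OF this] show ?thesis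
      using 2 int_S2_green[OF fl fl] by (simp add: smooth_form_def power2_eq_square)
  qed
qed

lemma antipodal_sums:
  assumes f: "smooth_S2 f"
  shows "(\<lambda>l. (-1) ^ l * harmonic_energy l f) sums int_S2 (\<lambda>x. f x * f (- x))"
proof -
  have c: "continuous_on S2 f" by (rule smooth_S2_continuous[OF f])
  have c': "continuous_on S2 (\<lambda>x. f (- x))"
    by (rule continuous_on_compose2[OF c]) (auto intro!: continuous_intros simp: S2_iff)
  have "int_S2 (\<lambda>x. harmonic_proj l f x * harmonic_proj l (\<lambda>x. f (- x)) x) = (-1) ^ l * harmonic_energy l f" for l
  proof -
    have "int_S2 (\<lambda>x. harmonic_proj l f x * harmonic_proj l (\<lambda>x. f (- x)) x) = int_S2 (\<lambda>x. (-1) ^ l * (harmonic_proj l f x)\<^sup>2)"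
      unfolding harmonic_proj_antipodal[OF c] by (simp add: power2_eq_square mult_ac)
    then show ?thesis by (simp add: int_S2_cmult harmonic_energy_def)
  qed
  then show ?thesis using parseval_bilinear[OF c c'] by simp
qed

text \<open>
  All three quadratic expressions are diagonal in the harmonic decomposition. The antipodal
  product is zero, so it can be added with any factor \<open>\<mu>\<close> before the nonpositive tail is
  dropped.
\<close>

theorem spectral_inequality:
  assumes f: "smooth_S2 f" and p: "p \<in> {2, 3}"
    and antipodal: "int_S2 (\<lambda>x. f x * f (- x)) = 0"
    and tail: "\<And>l. l \<ge> M \<Longrightarrow> z - sphere_ev l ^ p + \<mu> * (-1) ^ l \<le> 0"
  shows "z * int_S2 (\<lambda>x. (f x)\<^sup>2) - smooth_form p f \<le> (\<Sum>l<M. (z - sphere_ev l ^ p + \<mu> * (-1) ^ l) * harmonic_energy l f)"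
proof -
  have "(\<lambda>l. z * harmonic_energy l f - sphere_ev l ^ p * harmonic_energy l f + \<mu> * ((-1) ^ l * harmonic_energy l f))
     sums (z * int_S2 (\<lambda>x. (f x)\<^sup>2) - smooth_form p f + \<mu> * 0)"
    using antipodal_sums[OF f] unfolding antipodal
    by (intro sums_add sums_diff sums_mult parseval smooth_S2_continuous f smooth_form_sums[OF f p])
  then have 1: "(\<lambda>l. (z - sphere_ev l ^ p + \<mu> * (-1) ^ l) * harmonic_energy l f) sums (z * int_S2 (\<lambda>x. (f x)\<^sup>2) - smooth_form p f)"
    by (simp add: algebra_simps)
  have 2: "(\<lambda>l. if l \<in> {..<M} then (z - sphere_ev l ^ p + \<mu> * (-1) ^ l) * harmonic_energy l f else 0) sums
     (\<Sum>l\<in>{..<M}. (z - sphere_ev l ^ p + \<mu> * (-1) ^ l) * harmonic_energy l f)"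
    by (rule sums_If_finite_set) simp
  show ?thesis
    by (rule sums_le[OF _ 1 2]) (use tail harmonic_energy_nonneg in \<open>auto intro!: mult_nonpos_nonneg\<close>)
qed

text \<open>The integral of \<open>z - s\<^sup>p\<close> over \<open>0 \<le> s \<le> z\<^bsup>1/p\<^esup>\<close>.\<close>

definition weyl_term :: "nat \<Rightarrow> real \<Rightarrow> real" where
  "weyl_term p z = real p / (real p + 1) * z powr (1 + 1 / real p)"

lemma alternating_sum: "(\<Sum>l<M. (2 * real l + 1) * (-1) ^ l) = - ((-1) ^ M * real M)"
  by (induction M) (auto simp: algebra_simps)

text \<open>
  The chord of the convex function \<open>s\<^sup>p\<close> lies above its graph; for the two exponents the
  difference of the sides is a power of \<open>b - a\<close> times a nonnegative factor.
\<close>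

lemma trapezoid_step:
  fixes a b :: real
  assumes "0 \<le> a" "a \<le> b" "p \<in> {2, 3}"
  shows "b ^ (p + 1) / (real p + 1) - a ^ (p + 1) / (real p + 1) \<le> (b - a) / 2 * (a ^ p + b ^ p)"
proof -
  consider "p = 2" | "p = 3" using assms(3) by auto
  then show ?thesis
  proof cases
    case 1
    have "(b - a) / 2 * (a ^ 2 + b ^ 2) - (b ^ 3 / 3 - a ^ 3 / 3) = (b - a) ^ 3 / 6"
      by (simp add: field_simps power2_eq_square power3_eq_cube)
    moreover have "(b - a) ^ 3 / 6 \<ge> 0" using assms by simp
    ultimately have "b ^ 3 / 3 - a ^ 3 / 3 \<le> (b - a) / 2 * (a ^ 2 + b ^ 2)" by linarith
    then show ?thesis using 1 by simp
  next
    case 2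
    have "(b - a) / 2 * (a ^ 3 + b ^ 3) - (b ^ 4 / 4 - a ^ 4 / 4) = (b - a) ^ 3 * (a + b) / 4"
      by (simp add: field_simps power4_eq_xxxx power3_eq_cube)
    moreover have "(b - a) ^ 3 * (a + b) / 4 \<ge> 0" using assms by simp
    ultimately have "b ^ 4 / 4 - a ^ 4 / 4 \<le> (b - a) / 2 * (a ^ 3 + b ^ 3)" by linarith
    then show ?thesis using 2 by simp
  qed
qed

text \<open>
  Consecutive nodes differ by \<open>2 (l + 1)\<close>, so the trapezoidal weights are \<open>2 l + 1\<close> inside and
  \<open>M\<close> at the last node.
\<close>

lemma trapezoid_sum:
  assumes p: "p \<in> {2, 3}"
  shows "(\<Sum>l<M. (2 * real l + 1) * (z - sphere_ev l ^ p)) + real M * (z - sphere_ev M ^ p)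
     \<le> z * sphere_ev M - sphere_ev M ^ (p + 1) / (real p + 1)"
proof (induction M)
  case 0
  show ?case by (simp add: sphere_ev_def)
next
  case (Suc M)
  have d: "sphere_ev (Suc M) - sphere_ev M = 2 * (real M + 1)" by (simp add: sphere_ev_def algebra_simps)
  have l0: "0 \<le> sphere_ev M" "sphere_ev M \<le> sphere_ev (Suc M)" using d by (simp_all add: sphere_ev_def)
  have t: "sphere_ev (Suc M) ^ (p + 1) / (real p + 1) - sphere_ev M ^ (p + 1) / (real p + 1) \<le> (real M + 1) * (sphere_ev M ^ p + sphere_ev (Suc M) ^ p)"
    proof -
    have h: "2 * (real M + 1) / 2 = real M + 1" by simp
    show ?thesis using trapezoid_step[OF l0 p] unfolding d h .
  qed
  have "(\<Sum>l<Suc M. (2 * real l + 1) * (z - sphere_ev l ^ p)) + real (Suc M) * (z - sphere_ev (Suc M) ^ p)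
     = ((\<Sum>l<M. (2 * real l + 1) * (z - sphere_ev l ^ p)) + real M * (z - sphere_ev M ^ p))
       + (z * (2 * (real M + 1)) - (real M + 1) * (sphere_ev M ^ p + sphere_ev (Suc M) ^ p))"
    by (simp add: algebra_simps)
  also have "\<dots> \<le> (z * sphere_ev M - sphere_ev M ^ (p + 1) / (real p + 1)) + (z * (sphere_ev (Suc M) - sphere_ev M) -
       (sphere_ev (Suc M) ^ (p + 1) / (real p + 1) - sphere_ev M ^ (p + 1) / (real p + 1)))"
    unfolding d by (intro add_mono Suc.IH diff_mono t order_refl)
  finally show ?case by (simp add: algebra_simps)
qed

text \<open>
  The left side is an antiderivative of \<open>z - s\<^sup>p\<close>, whose maximum is at the zero of this
  function.
\<close>

lemma weyl_term_max:
  assumes p: "p \<in> {2, 3}" and z: "z \<ge> 0" and s: "s \<ge> 0"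
  shows "z * s - s ^ (p + 1) / (real p + 1) \<le> weyl_term p z"
proof -
  define t where "t = z powr (1 / real p)"
  have t: "t \<ge> 0" by (simp add: t_def)
  have p0: "p > 0" using p by auto
  have tp: "t ^ p = z"
  proof (cases "z = 0")
    case False
    then have "t > 0" using z by (simp add: t_def)
    then show ?thesis using z p0 False by (simp add: t_def powr_realpow[symmetric] powr_powr)
  qed (use p0 in \<open>simp add: t_def\<close>)
  have w: "weyl_term p z = real p / (real p + 1) * (z * t)"
    using z by (cases "z = 0") (simp_all add: weyl_term_def t_def powr_add)
  consider "p = 2" | "p = 3" using p by auto
  then show ?thesis
  proof cases
    case 1
    have "2 / 3 * (t ^ 2 * t) - (t ^ 2 * s - s ^ 3 / 3) = (s - t)\<^sup>2 * (s + 2 * t) / 3"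
      by (simp add: field_simps power2_eq_square power3_eq_cube)
    moreover have "(s - t)\<^sup>2 * (s + 2 * t) / 3 \<ge> 0" using s t by simp
    ultimately have "t ^ 2 * s - s ^ 3 / 3 \<le> 2 / 3 * (t ^ 2 * t)" by linarith
    then show ?thesis unfolding w unfolding tp[symmetric] using 1 by simp
  next
    case 2
    have "3 / 4 * (t ^ 3 * t) - (t ^ 3 * s - s ^ 4 / 4) = (s - t)\<^sup>2 * (s ^ 2 + 2 * s * t + 3 * t ^ 2) / 4"
      by (simp add: field_simps power2_eq_square power3_eq_cube power4_eq_xxxx)
    moreover have "(s - t)\<^sup>2 * (s ^ 2 + 2 * s * t + 3 * t ^ 2) / 4 \<ge> 0" using s t by simp
    ultimately have "t ^ 3 * s - s ^ 4 / 4 \<le> 3 / 4 * (t ^ 3 * t)" by linarith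
    then show ?thesis unfolding w unfolding tp[symmetric] using 2 by simp
  qed
qed

lemma sphere_ev_mono: "l \<le> k \<Longrightarrow> sphere_ev l \<le> sphere_ev k" and sphere_ev_nonneg: "0 \<le> sphere_ev l"
  by (auto simp: sphere_ev_def intro!: mult_mono)

text \<open>
  The index \<open>M\<close> belongs to the level nearest to \<open>z\<close>, and \<open>\<mu>\<close> cancels the coefficient at \<open>M\<close>.
  Before this correction the coefficients below \<open>M\<close> are at least \<open>|\<mu>|\<close> and those beyond \<open>M\<close> at
  most \<open>-|\<mu>|\<close>, so the alternating correction does not change their signs.
\<close>

theorem cutoff_exists:
  assumes p: "p \<in> {2, 3}" and z: "z \<ge> 0"
  obtains M \<mu> where "\<And>l. l < M \<Longrightarrow> 0 \<le> z - sphere_ev l ^ p + \<mu> * (-1) ^ l"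
    and "\<And>l. M \<le> l \<Longrightarrow> z - sphere_ev l ^ p + \<mu> * (-1) ^ l \<le> 0"
    and "(\<Sum>l<M. (2 * real l + 1) * (z - sphere_ev l ^ p + \<mu> * (-1) ^ l)) \<le> weyl_term p z"
proof -
  have p0: "p > 0" using p by auto
  define f where "f l = z - sphere_ev l ^ p" for l
  have fmono: "f k \<le> f l" if "l \<le> k" for l k
    using sphere_ev_mono[OF that] sphere_ev_nonneg[of l] by (simp add: f_def power_mono)
  have ex: "\<exists>k. f k < 0"
  proof -
    obtain k where k: "z < real k" using reals_Archimedean2 by blast
    then have k1: "real k \<ge> 1" using z by (cases k) auto
    have "real k \<le> sphere_ev k" using k1 by (simp add: sphere_ev_def)
    also have "sphere_ev k \<le> sphere_ev k ^ p" using k1 p0 \<open>real k \<le> sphere_ev k\<close> by (intro self_le_power) auto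
    finally show ?thesis using k by (intro exI[of _ k]) (simp add: f_def)
  qed
  \<comment> \<open>The level \<open>K\<close> is the first above \<open>z\<close>, and \<open>N\<close> is the last that is not.\<close>
  define K where "K = (LEAST k. f k < 0)"
  have K: "f K < 0" unfolding K_def using ex by (rule LeastI_ex)
  have f0: "f 0 = z" using p0 by (simp add: f_def sphere_ev_def)
  have K0: "K > 0" using K f0 z by (cases K) auto
  define N where "N = K - 1"
  have N: "f N \<ge> 0" using not_less_Least[of N "\<lambda>k. f k < 0"] K0 by (auto simp: N_def K_def)
  have KN: "K = Suc N" using K0 by (simp add: N_def)
  \<comment> \<open>Of the two levels around \<open>z\<close>, the nearer one.\<close>
  obtain M where M1: "\<And>l. l < M \<Longrightarrow> \<bar>f M\<bar> \<le> f l" and M2: "\<And>l. M < l \<Longrightarrow> \<bar>f M\<bar> \<le> - f l"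
  proof (cases "f N \<le> - f K")
    case True
    show ?thesis
    proof (rule that[of N])
      show "\<bar>f N\<bar> \<le> f l" if "l < N" for l using fmono[of l N] that N by simp
      show "\<bar>f N\<bar> \<le> - f l" if "N < l" for l using fmono[of K l] that N True by (simp add: KN)
    qed
  next
    case False
    show ?thesis
    proof (rule that[of K])
      show "\<bar>f K\<bar> \<le> f l" if "l < K" for l using fmono[of l N] that K False by (simp add: KN)
      show "\<bar>f K\<bar> \<le> - f l" if "K < l" for l using fmono[of K l] that K by simp
    qed
  qed
  define \<mu> where "\<mu> = - ((-1) ^ M * f M)"
  have mu: "\<bar>\<mu> * (-1) ^ l\<bar> = \<bar>f M\<bar>" for l by (simp add: \<mu>_def abs_mult power_abs)
  have muM: "\<mu> * (-1) ^ M = - f M"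
    by (simp add: \<mu>_def power_add[symmetric] mult.commute mult.left_commute flip: power_mult_distrib)
  show ?thesis
  proof (rule that[of M \<mu>])
    show "0 \<le> z - sphere_ev l ^ p + \<mu> * (-1) ^ l" if "l < M" for l
      using M1[OF that] mu[of l] by (simp add: f_def)
    show "z - sphere_ev l ^ p + \<mu> * (-1) ^ l \<le> 0" if "M \<le> l" for l
    proof (cases "l = M")
      case True then show ?thesis using muM by (simp add: f_def)
    next
      case False then show ?thesis using M2[of l] mu[of l] that by (simp add: f_def)
    qed
    have "(\<Sum>l<M. (2 * real l + 1) * (z - sphere_ev l ^ p + \<mu> * (-1) ^ l))
       = (\<Sum>l<M. (2 * real l + 1) * (z - sphere_ev l ^ p)) + \<mu> * (\<Sum>l<M. (2 * real l + 1) * (-1) ^ l)"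
      by (simp add: sum.distrib[symmetric] sum_distrib_left algebra_simps)
    also have "\<mu> * (\<Sum>l<M. (2 * real l + 1) * (-1) ^ l) = real M * (z - sphere_ev M ^ p)"
    proof -
      have e: "\<mu> * (- ((-1) ^ M * real M)) = - (\<mu> * (-1) ^ M) * real M" by simp
      show ?thesis unfolding alternating_sum e muM f_def by simp
    qed
    also have "(\<Sum>l<M. (2 * real l + 1) * (z - sphere_ev l ^ p)) + real M * (z - sphere_ev M ^ p) \<le> weyl_term p z"
      using trapezoid_sum[OF p, where M = M and z = z] weyl_term_max[OF p z sphere_ev_nonneg, of M] by linarith
    finally show "(\<Sum>l<M. (2 * real l + 1) * (z - sphere_ev l ^ p + \<mu> * (-1) ^ l)) \<le> weyl_term p z" .
  qed
qed

section \<open>Bump functions\<close>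

lemma poly_exp_decay: "((\<lambda>y. poly q y * exp (- y)) \<longlongrightarrow> 0) (at_top :: real filter)"
proof -
  have "((\<lambda>y::real. \<Sum>i\<le>degree q. coeff q i * (y ^ i / exp y)) \<longlongrightarrow> (\<Sum>i\<le>degree q. coeff q i * 0)) at_top"
    by (intro tendsto_sum tendsto_mult tendsto_const tendsto_power_div_exp_0)
  then show ?thesis
    by (simp add: poly_altdef exp_minus sum_distrib_right divide_inverse mult.assoc)
qed

text \<open>
  The functions \<open>q(1/s) exp(-1/s)\<close> for polynomials \<open>q\<close>, extended by zero to \<open>s \<le> 0\<close>: a family
  that contains \<open>exp(-1/s)\<close> and is closed under differentiation.
\<close>

definition bump :: "real poly \<Rightarrow> real \<Rightarrow> real" where
  "bump q s = (if s > 0 then poly q (1 / s) * exp (- (1 / s)) else 0)"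

text \<open>
  At zero both one-sided difference quotients tend to zero, from the right because \<open>exp(-y)\<close>
  decays faster than any polynomial grows.
\<close>

lemma bump_deriv:
  "(bump q has_real_derivative bump ([:0, 0, 1:] * (q - pderiv q)) s) (at s)"
proof -
  consider "s > 0" | "s < 0" | "s = 0" by linarith
  then show ?thesis
  proof cases
    case 1
    have "((\<lambda>s. poly q (1 / s) * exp (- (1 / s))) has_real_derivative
        (1 / s * (1 / s)) * (poly q (1 / s) - poly (pderiv q) (1 / s)) * exp (- (1 / s))) (at s)"
      using 1 by (auto intro!: derivative_eq_intros poly_DERIV[THEN DERIV_chain2] simp: field_simps)
    then have "(bump q has_real_derivative
        (1 / s * (1 / s)) * (poly q (1 / s) - poly (pderiv q) (1 / s)) * exp (- (1 / s))) (at s)"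
      by (rule has_field_derivative_transform_within_open[of _ _ _ "{0<..}"]) (use 1 in \<open>auto simp: bump_def\<close>)
    then show ?thesis using 1 by (simp add: bump_def)
  next
    case 2
    have "(bump q has_real_derivative 0) (at s)"
      by (rule has_field_derivative_transform_within_open[of "\<lambda>_. 0" _ _ "{..<0}"]) (use 2 in \<open>auto simp: bump_def\<close>)
    then show ?thesis using 2 by (simp add: bump_def)
  next
    case 3
    have "((\<lambda>h. bump q h / h) \<longlongrightarrow> 0) (at_right 0)"
    proof -
      have "((\<lambda>h. poly ([:0, 1:] * q) (inverse h) * exp (- inverse h)) \<longlongrightarrow> 0) (at_right 0)"
        by (rule filterlim_compose[OF poly_exp_decay filterlim_inverse_at_top_right])
      moreover have "\<forall>\<^sub>F h in at_right 0. poly ([:0, 1:] * q) (inverse h) * exp (- inverse h) = bump q h / h"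
        by (auto simp: eventually_at_right_field bump_def divide_inverse intro!: exI[of _ 1])
      ultimately show ?thesis by (rule Lim_transform_eventually)
    qed
    moreover have "((\<lambda>h. bump q h / h) \<longlongrightarrow> 0) (at_left 0)"
      by (rule Lim_transform_eventually[OF tendsto_const])
        (auto simp: eventually_at_left_field bump_def intro!: exI[of _ "-1"])
    ultimately have "((\<lambda>h. bump q h / h) \<longlongrightarrow> 0) (at 0)"
      by (simp add: filterlim_split_at)
    then have "(bump q has_real_derivative 0) (at 0)"
      by (simp add: DERIV_def bump_def)
    then show ?thesis using 3 by (simp add: bump_def)
  qed
qed

abbreviation bump0 :: "real \<Rightarrow> real" where "bump0 \<equiv> bump 1"

lemma bump0_bounds: "0 \<le> bump0 s" "bump0 s \<le> 1"
  by (auto simp: bump_def)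

lemma bump0_nonpos: "s \<le> 0 \<Longrightarrow> bump0 s = 0"
  by (simp add: bump_def)

lemma bump0_limit: "s > 0 \<Longrightarrow> (\<lambda>n. bump0 (real n * s)) \<longlonglongrightarrow> 1"
proof -
  assume s: "s > 0"
  have "(\<lambda>n. exp (- (1 / s * (1 / real n)))) \<longlonglongrightarrow> exp (- (1 / s * 0))"
    by (intro tendsto_exp tendsto_minus tendsto_mult tendsto_const lim_const_over_n)
  then have "(\<lambda>n. exp (- (1 / s * (1 / real n)))) \<longlonglongrightarrow> 1" by simp
  moreover have "\<forall>\<^sub>F n in sequentially. exp (- (1 / s * (1 / real n))) = bump0 (real n * s)"
    using eventually_gt_at_top[of 0] by eventually_elim (use s in \<open>simp add: bump_def mult.commute\<close>)
  ultimately show ?thesis by (rule Lim_transform_eventually)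
qed

lemma smooth_S2_bump:
  assumes "smooth_S2 f" shows "smooth_S2 (\<lambda>x. bump0 (f x))"
  using smooth_S2_compose[where h = "\<lambda>n. bump (((\<lambda>q. [:0, 0, 1:] * (q - pderiv q)) ^^ n) 1)" and n = 0, OF _ assms]
    bump_deriv by simp

definition box_bump :: "nat \<Rightarrow> real^3 \<Rightarrow> real^3 \<Rightarrow> real^3 \<Rightarrow> real" where
  "box_bump n a b x = (\<Prod>i\<in>UNIV. bump0 (real n * (x $ i - a $ i)) * bump0 (real n * (b $ i - x $ i)))"

lemma smooth_S2_box_bump: "smooth_S2 (box_bump n a b)"
  unfolding box_bump_def[abs_def]
  by (intro smooth_S2_prod smooth_S2_mult smooth_S2_bump smooth_S2_diff smooth_S2_const smooth_S2_component)

lemma box_bump_bounds: "0 \<le> box_bump n a b x" "box_bump n a b x \<le> 1"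
  unfolding box_bump_def
  by (auto intro!: prod_nonneg prod_le_1 mult_nonneg_nonneg mult_le_one bump0_bounds)

lemma box_bump_outside: "x \<notin> box a b \<Longrightarrow> box_bump n a b x = 0"
proof -
  assume "x \<notin> box a b"
  then obtain i where "x $ i \<le> a $ i \<or> b $ i \<le> x $ i" by (auto simp: mem_box_cart not_less)
  then have "bump0 (real n * (x $ i - a $ i)) * bump0 (real n * (b $ i - x $ i)) = 0"
    by (auto simp: bump0_nonpos mult_nonneg_nonpos)
  then show ?thesis unfolding box_bump_def by (intro prod_zero) auto
qed

lemma box_bump_limit: "(\<lambda>n. box_bump n a b x) \<longlonglongrightarrow> indicator (box a b) x"
proof (cases "x \<in> box a b")
  case True
  then have "(\<lambda>n. box_bump n a b x) \<longlonglongrightarrow> (\<Prod>i\<in>(UNIV :: 3 set). 1 * 1)"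
    unfolding box_bump_def by (intro tendsto_prod tendsto_mult bump0_limit) (auto simp: mem_box_cart)
  then show ?thesis using True by simp
qed (simp add: box_bump_outside)

lemma test_fun_iff: "\<phi> \<in> test_fun \<Omega> \<longleftrightarrow> smooth_S2 \<phi> \<and> (\<exists>K. compact K \<and> K \<subseteq> \<Omega> \<and> (\<forall>x \<in> S2 - K. \<phi> x = 0))"
  by (simp add: test_fun_def smooth_S2_def)

lemma box_bump_test_fun:
  assumes "cbox a b \<inter> S2 \<subseteq> \<Omega>"
  shows "box_bump n a b \<in> test_fun \<Omega>"
  unfolding test_fun_iff
proof (intro conjI exI)
  show "compact (cbox a b \<inter> S2)" by (intro compact_Int_closed compact_cbox) (simp add: S2_def)
  show "\<forall>x\<in>S2 - cbox a b \<inter> S2. box_bump n a b x = 0"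
    using box_subset_cbox[of a b] by (auto intro!: box_bump_outside)
qed (use assms smooth_S2_box_bump in auto)

text \<open>
  Boxes are an intersection-stable generator of the Borel sets, so the positive and the
  negative part of \<open>g\<close> are densities of the same measure.
\<close>

lemma AE_zero_of_box_integrals:
  fixes g :: "real^3 \<Rightarrow> real"
  assumes g: "integrable surf g" and z: "\<And>a b. (\<integral>x. indicator (box a b) x * g x \<partial>surf) = 0"
  shows "AE x in surf. g x = 0"
proof -
  have [measurable]: "g \<in> borel_measurable borel"
    using g by (simp add: borel_measurable_integrable measurable_cong_sets[OF sets_surf refl, symmetric])
  define p where "p = density surf (\<lambda>x. ennreal (g x))"
  define m where "m = density surf (\<lambda>x. ennreal (- g x))"
  have eqb: "emeasure p (box a b) = emeasure m (box a b)" and finp: "emeasure p (box a b) \<noteq> \<infinity>" for a b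
  proof -
    have i: "integrable surf (\<lambda>x. indicator (box a b) x * g x)"
      using g by (intro integrable_real_mult_indicator[of "box a b" surf g, unfolded mult.commute[of "g _"]]) auto
    have "(\<integral>\<^sup>+x. ennreal (indicator (box a b) x * g x) \<partial>surf) = (\<integral>\<^sup>+x. ennreal (- (indicator (box a b) x * g x)) \<partial>surf)
       \<and> (\<integral>\<^sup>+x. ennreal (indicator (box a b) x * g x) \<partial>surf) \<noteq> \<infinity>"
    proof -
      let ?P = "\<integral>\<^sup>+x. ennreal (indicator (box a b) x * g x) \<partial>surf"
      let ?N = "\<integral>\<^sup>+x. ennreal (- (indicator (box a b) x * g x)) \<partial>surf"
      have fin: "?P \<noteq> \<infinity>" "?N \<noteq> \<infinity>" using i unfolding real_integrable_def by auto
      have "enn2real ?P = enn2real ?N" using real_lebesgue_integral_def[OF i] z[of a b] by simp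
      then have "ennreal (enn2real ?P) = ennreal (enn2real ?N)" by (rule arg_cong)
      moreover have lt: "?P < top" "?N < top" using fin by (simp_all add: less_top)
      ultimately have "?P = ?N" by (simp only: ennreal_enn2real[OF lt(1)] ennreal_enn2real[OF lt(2)])
      then show ?thesis using fin by simp
    qed
    moreover have "emeasure p (box a b) = (\<integral>\<^sup>+x. ennreal (indicator (box a b) x * g x) \<partial>surf)"
      unfolding p_def by (subst emeasure_density) (auto intro!: nn_integral_cong simp: indicator_def)
    moreover have "emeasure m (box a b) = (\<integral>\<^sup>+x. ennreal (- (indicator (box a b) x * g x)) \<partial>surf)"
      unfolding m_def by (subst emeasure_density) (auto intro!: nn_integral_cong simp: indicator_def)
    ultimately show "emeasure p (box a b) = emeasure m (box a b)" "emeasure p (box a b) \<noteq> \<infinity>" by auto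
  qed
  have "p = m"
  proof (rule measure_eqI_generator_eq[where E = "range (\<lambda>(a, b). box a b :: (real^3) set)" and \<Omega> = UNIV
        and A = "\<lambda>n. box (- (\<chi> i. real n)) (\<chi> i. real n)"])
    show "Int_stable (range (\<lambda>(a, b). box a b :: (real^3) set))"
    proof (rule Int_stableI)
      fix A B assume "A \<in> range (\<lambda>(a, b). box a b :: (real^3) set)" "B \<in> range (\<lambda>(a, b). box a b :: (real^3) set)"
      then obtain a b c d :: "real^3" where AB: "A = box a b" "B = box c d" by auto
      show "A \<inter> B \<in> range (\<lambda>(a, b). box a b :: (real^3) set)"
        unfolding AB box_Int_box by (rule image_eqI[OF _ UNIV_I]) (rule case_prod_conv[symmetric])
    qed
    show "sets p = sigma_sets UNIV (range (\<lambda>(a, b). box a b))" "sets m = sigma_sets UNIV (range (\<lambda>(a, b). box a b))"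
      by (simp_all add: p_def m_def borel_eq_box)
    show "(\<Union>n. box (- (\<chi> i. real n)) (\<chi> i. real n) :: (real^3) set) = UNIV"
    proof (intro equalityI subsetI UNIV_I)
      fix x :: "real^3"
      obtain n where n: "norm x < real n" using reals_Archimedean2 by blast
      have "- real n < x $ i \<and> x $ i < real n" for i using component_le_norm_cart[of x i] n by linarith
      then have "x \<in> box (- (\<chi> i. real n)) (\<chi> i. real n)" by (simp add: mem_box_cart)
      then show "x \<in> (\<Union>n. box (- (\<chi> i. real n)) (\<chi> i. real n))" by blast
    qed
    show "emeasure p X = emeasure m X" if "X \<in> range (\<lambda>(a, b). box a b :: (real^3) set)" for X
      using that eqb by auto
    show "range (\<lambda>n. box (- (\<chi> i. real n)) (\<chi> i. real n) :: (real^3) set) \<subseteq> range (\<lambda>(a, b). box a b)"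
      by auto
    show "emeasure p (box (- (\<chi> i. real n)) (\<chi> i. real n)) \<noteq> \<infinity>" for n :: nat
      by (rule finp)
  qed simp
  then have "AE x in surf. ennreal (g x) = ennreal (- g x)"
    unfolding p_def m_def by (intro surf.density_unique) auto
  then show ?thesis
  proof eventually_elim
    case (elim x)
    then show ?case by (cases "g x \<ge> 0") (auto simp: ennreal_neg ennreal_eq_0_iff dest: sym)
  qed
qed

section \<open>Square integrable functions on an open subset of the sphere\<close>

locale sphere_open =
  fixes \<Omega> :: "(real^3) set"
  assumes open_dom: "openin (top_of_set S2) \<Omega>"
begin

lemma dom_S2: "\<Omega> \<subseteq> S2"
  using open_dom openin_imp_subset by auto

lemma dom_borel [measurable]: "\<Omega> \<in> sets borel"
proof -
  obtain U where "open U" "\<Omega> = S2 \<inter> U" using open_dom by (auto simp: openin_open)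
  then show ?thesis by auto
qed

lemma L2_iff: "u \<in> L2 \<Omega> \<longleftrightarrow> (\<lambda>x. indicator \<Omega> x * u x) \<in> borel_measurable surf \<and>
    integrable surf (\<lambda>x. (indicator \<Omega> x * u x)\<^sup>2)"
proof -
  have "(\<lambda>x. indicator \<Omega> x *\<^sub>R (u x)\<^sup>2) = (\<lambda>x. (indicator \<Omega> x * u x)\<^sup>2)"
    by (auto simp: indicator_def)
  then show ?thesis by (simp add: L2_def set_borel_measurable_def set_integrable_def)
qed

lemma L2_integrable_mult:
  assumes "u \<in> L2 \<Omega>" "v \<in> L2 \<Omega>"
  shows "set_integrable surf \<Omega> (\<lambda>x. u x * v x)"
proof -
  let ?U = "\<lambda>x. indicator \<Omega> x * u x" and ?V = "\<lambda>x. indicator \<Omega> x * v x"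
  have "integrable surf (\<lambda>x. ?U x * ?V x)"
  proof (rule Bochner_Integration.integrable_bound)
    show "integrable surf (\<lambda>x. (?U x)\<^sup>2 + (?V x)\<^sup>2)" using assms by (simp add: L2_iff)
    show "(\<lambda>x. ?U x * ?V x) \<in> borel_measurable surf" using assms borel_measurable_times[of ?U surf ?V] by (simp add: L2_iff)
    have "\<bar>a * b\<bar> \<le> a\<^sup>2 + b\<^sup>2" for a b :: real
    proof -
      have "2 * \<bar>a\<bar> * \<bar>b\<bar> \<le> a\<^sup>2 + b\<^sup>2" using sum_squares_bound[of "\<bar>a\<bar>" "\<bar>b\<bar>"] by simp
      moreover have "0 \<le> \<bar>a\<bar> * \<bar>b\<bar>" by simp
      ultimately show ?thesis unfolding abs_mult by linarith
    qed
    then show "AE x in surf. norm (?U x * ?V x) \<le> norm ((?U x)\<^sup>2 + (?V x)\<^sup>2)" by simp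
  qed
  moreover have "(\<lambda>x. ?U x * ?V x) = (\<lambda>x. indicator \<Omega> x *\<^sub>R (u x * v x))" by (auto simp: indicator_def)
  ultimately show ?thesis by (simp add: set_integrable_def)
qed

lemma L2_add: "u \<in> L2 \<Omega> \<Longrightarrow> v \<in> L2 \<Omega> \<Longrightarrow> (\<lambda>x. u x + v x) \<in> L2 \<Omega>"
proof -
  assume uv: "u \<in> L2 \<Omega>" "v \<in> L2 \<Omega>"
  have "(\<lambda>x. indicator \<Omega> x * (u x + v x)) \<in> borel_measurable surf"
    using uv borel_measurable_add[of "\<lambda>x. indicator \<Omega> x * u x" surf "\<lambda>x. indicator \<Omega> x * v x"]
    by (simp add: L2_iff distrib_left)
  moreover have "set_integrable surf \<Omega> (\<lambda>x. u x * u x + v x * v x + 2 * (u x * v x))"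
    using uv by (intro set_integral_add set_integrable_mult_right L2_integrable_mult) auto
  then have "set_integrable surf \<Omega> (\<lambda>x. (u x + v x)\<^sup>2)"
    by (simp add: power2_eq_square algebra_simps)
  ultimately show ?thesis by (simp add: L2_def set_borel_measurable_def)
qed

lemma L2_cmult: "u \<in> L2 \<Omega> \<Longrightarrow> (\<lambda>x. c * u x) \<in> L2 \<Omega>"
proof -
  assume u: "u \<in> L2 \<Omega>"
  have "(\<lambda>x. c * (indicator \<Omega> x * u x)) \<in> borel_measurable surf"
    using u borel_measurable_times[OF borel_measurable_const, of "\<lambda>x. indicator \<Omega> x * u x" surf c] by (simp add: L2_iff)
  moreover have "set_integrable surf \<Omega> (\<lambda>x. c\<^sup>2 * (u x * u x))"
    using u by (intro set_integrable_mult_right L2_integrable_mult)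
  ultimately show ?thesis by (simp add: L2_def set_borel_measurable_def power2_eq_square mult_ac)
qed

lemma L2_diff: "u \<in> L2 \<Omega> \<Longrightarrow> v \<in> L2 \<Omega> \<Longrightarrow> (\<lambda>x. u x - v x) \<in> L2 \<Omega>"
  using L2_add[of u "\<lambda>x. - 1 * v x"] L2_cmult[of v "-1"] by simp

lemma L2_zero: "(\<lambda>x. 0) \<in> L2 \<Omega>"
  by (simp add: L2_iff)

lemma L2_sum: "(\<And>i. i \<in> I \<Longrightarrow> u i \<in> L2 \<Omega>) \<Longrightarrow> (\<lambda>x. \<Sum>i\<in>I. u i x) \<in> L2 \<Omega>"
  by (induction I rule: infinite_finite_induct) (auto simp: L2_zero L2_add)

lemma L2_continuous:
  assumes f: "continuous_on S2 f" shows "f \<in> L2 \<Omega>"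
proof -
  have sub: "set_integrable surf \<Omega> g" if "continuous_on S2 g" for g :: "real^3 \<Rightarrow> real"
    by (rule set_integrable_subset[OF S2_set_integrable[OF that]]) (use dom_S2 in auto)
  show ?thesis
    using sub[OF f] sub[of "\<lambda>x. (f x)\<^sup>2"] f
    by (auto simp: L2_def set_integrable_def set_borel_measurable_def intro!: continuous_intros)
qed

definition L2_inner :: "(real^3 \<Rightarrow> real) \<Rightarrow> (real^3 \<Rightarrow> real) \<Rightarrow> real" where
  "L2_inner u v = (LINT x:\<Omega>|surf. u x * v x)"

lemma L2_inner_sym: "L2_inner u v = L2_inner v u"
  by (simp add: L2_inner_def mult.commute)

lemma L2_inner_add: "u \<in> L2 \<Omega> \<Longrightarrow> v \<in> L2 \<Omega> \<Longrightarrow> w \<in> L2 \<Omega> \<Longrightarrow> L2_inner (\<lambda>x. u x + v x) w = L2_inner u w + L2_inner v w"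
  unfolding L2_inner_def distrib_right by (intro set_integral_add L2_integrable_mult)

lemma L2_inner_cmult: "L2_inner (\<lambda>x. c * u x) w = c * L2_inner u w"
  by (simp add: L2_inner_def mult.assoc)

lemma L2_inner_diff: "u \<in> L2 \<Omega> \<Longrightarrow> v \<in> L2 \<Omega> \<Longrightarrow> w \<in> L2 \<Omega> \<Longrightarrow> L2_inner (\<lambda>x. u x - v x) w = L2_inner u w - L2_inner v w"
  unfolding L2_inner_def left_diff_distrib by (intro set_integral_diff L2_integrable_mult)

lemma L2_inner_zero: "L2_inner (\<lambda>x. 0) w = 0"
  by (simp add: L2_inner_def)

lemma L2_inner_sum: "(\<And>i. i \<in> I \<Longrightarrow> u i \<in> L2 \<Omega>) \<Longrightarrow> w \<in> L2 \<Omega> \<Longrightarrow> L2_inner (\<lambda>x. \<Sum>i\<in>I. u i x) w = (\<Sum>i\<in>I. L2_inner (u i) w)"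
  by (induction I rule: infinite_finite_induct) (auto simp: L2_inner_zero L2_inner_add L2_sum)

lemma L2_inner_nonneg: "0 \<le> L2_inner u u"
  unfolding L2_inner_def set_lebesgue_integral_def by (rule integral_nonneg_AE) (auto simp: indicator_def)

definition ae_eq :: "(real^3 \<Rightarrow> real) \<Rightarrow> (real^3 \<Rightarrow> real) \<Rightarrow> bool" where
  "ae_eq u v \<longleftrightarrow> (AE x in surf. x \<in> \<Omega> \<longrightarrow> u x = v x)"

lemma L2_inner_cong: "ae_eq u u' \<Longrightarrow> u \<in> L2 \<Omega> \<Longrightarrow> u' \<in> L2 \<Omega> \<Longrightarrow> v \<in> L2 \<Omega> \<Longrightarrow> L2_inner u v = L2_inner u' v"
proof -
  assume *: "ae_eq u u'" "u \<in> L2 \<Omega>" "u' \<in> L2 \<Omega>" "v \<in> L2 \<Omega>"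
  show ?thesis
    unfolding L2_inner_def set_lebesgue_integral_def
  proof (rule integral_cong_AE)
    show "AE x in surf. indicator \<Omega> x *\<^sub>R (u x * v x) = indicator \<Omega> x *\<^sub>R (u' x * v x)"
      using *(1) unfolding ae_eq_def by eventually_elim (auto simp: indicator_def)
  qed (use L2_integrable_mult[OF *(2,4)] L2_integrable_mult[OF *(3,4)] in \<open>auto simp: set_integrable_def\<close>)
qed

lemma L2_inner_self_zero: "u \<in> L2 \<Omega> \<Longrightarrow> L2_inner u u = 0 \<Longrightarrow> ae_eq u (\<lambda>x. 0)"
proof -
  assume u: "u \<in> L2 \<Omega>" and 0: "L2_inner u u = 0"
  have "AE x in surf. indicator \<Omega> x *\<^sub>R (u x * u x) = 0"
    using L2_integrable_mult[OF u u] 0 unfolding L2_inner_def set_lebesgue_integral_def set_integrable_def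
    by (subst (asm) integral_nonneg_eq_0_iff_AE) (auto simp: indicator_def)
  then show ?thesis unfolding ae_eq_def by eventually_elim (auto simp: indicator_def)
qed

lemma L2_inner_cauchy_schwarz:
  assumes u: "u \<in> L2 \<Omega>" and v: "v \<in> L2 \<Omega>"
  shows "(L2_inner u v)\<^sup>2 \<le> L2_inner u u * L2_inner v v"
proof -
  have q: "0 \<le> L2_inner u u - 2 * t * L2_inner u v + t\<^sup>2 * L2_inner v v" for t
  proof -
    have tv: "(\<lambda>x. t * v x) \<in> L2 \<Omega>" by (rule L2_cmult[OF v])
    define d where "d x = u x - t * v x" for x
    have d: "d \<in> L2 \<Omega>" unfolding d_def by (rule L2_diff[OF u tv])
    have A: "L2_inner d w = L2_inner u w - t * L2_inner v w" if "w \<in> L2 \<Omega>" for w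
      unfolding d_def using L2_inner_diff[OF u tv that] by (simp add: L2_inner_cmult)
    have "0 \<le> L2_inner d d" by (rule L2_inner_nonneg)
    also have "L2_inner d d = L2_inner d u - t * L2_inner d v" using A[OF d] L2_inner_sym[of u d] L2_inner_sym[of v d] by simp
    also have "\<dots> = L2_inner u u - 2 * t * L2_inner u v + t\<^sup>2 * L2_inner v v"
      using L2_inner_sym[of v u] by (simp add: A u v power2_eq_square algebra_simps)
    finally show ?thesis .
  qed
  show ?thesis
  proof (cases "L2_inner v v = 0")
    case True
    have "L2_inner u v = 0"
    proof -
      have "L2_inner u v = L2_inner v u" by (rule L2_inner_sym)
      also have "\<dots> = L2_inner (\<lambda>x. 0) u" by (rule L2_inner_cong[OF L2_inner_self_zero[OF v True] v L2_zero u])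
      finally show ?thesis by (simp add: L2_inner_zero)
    qed
    then show ?thesis using True by simp
  next
    case False
    then have pos: "L2_inner v v > 0" using L2_inner_nonneg[of v] by simp
    have "0 \<le> L2_inner v v * (L2_inner u u - 2 * (L2_inner u v / L2_inner v v) * L2_inner u v + (L2_inner u v / L2_inner v v)\<^sup>2 * L2_inner v v)"
      using q[of "L2_inner u v / L2_inner v v"] pos by (intro mult_nonneg_nonneg) auto
    also have "\<dots> = L2_inner u u * L2_inner v v - (L2_inner u v)\<^sup>2"
      using False by (simp add: field_simps power2_eq_square)
    finally show ?thesis by simp
  qed
qed

text \<open>
  Smooth bump functions tend boundedly to the indicator function of any box whose closure
  meets the sphere inside \<open>\<Omega>\<close>. Countably many such boxes cover \<open>\<Omega>\<close>.
\<close>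

theorem fundamental_lemma:
  assumes w: "w \<in> L2 \<Omega>" and z: "\<And>\<phi>. \<phi> \<in> test_fun \<Omega> \<Longrightarrow> L2_inner w \<phi> = 0"
  shows "ae_eq w (\<lambda>x. 0)"
proof -
  define W where "W x = indicator \<Omega> x * w x" for x
  have Wm: "W \<in> borel_measurable surf" using w by (simp add: L2_iff W_def[abs_def])
  have Wi: "integrable surf W"
    using L2_integrable_mult[OF w L2_continuous[of "\<lambda>x. 1"]] by (simp add: set_integrable_def W_def[abs_def])
  obtain U where U: "open U" "\<Omega> = S2 \<inter> U" using open_dom by (auto simp: openin_open)
  have box0: "(\<integral>x. indicator (box a b) x * W x \<partial>surf) = 0" if ab: "cbox a b \<subseteq> U" for a b
  proof -
    have "(\<lambda>n. \<integral>x. box_bump n a b x * W x \<partial>surf) \<longlonglongrightarrow> (\<integral>x. indicator (box a b) x * W x \<partial>surf)"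
    proof (rule integral_dominated_convergence[where w = "\<lambda>x. \<bar>W x\<bar>"])
      show "(\<lambda>x. indicator (box a b) x * W x) \<in> borel_measurable surf"
        by (rule borel_measurable_times[OF _ Wm]) simp
      show "(\<lambda>x. box_bump n a b x * W x) \<in> borel_measurable surf" for n
      proof -
        have "(\<lambda>x. (indicator \<Omega> x * box_bump n a b x) * W x) \<in> borel_measurable surf"
          using L2_continuous[OF smooth_S2_continuous[OF smooth_S2_box_bump[of n a b]]]
          by (intro borel_measurable_times[OF _ Wm]) (simp add: L2_iff)
        moreover have "(\<lambda>x. (indicator \<Omega> x * box_bump n a b x) * W x) = (\<lambda>x. box_bump n a b x * W x)"
          by (auto simp: W_def indicator_def)
        ultimately show ?thesis by simp
      qed
      show "AE x in surf. (\<lambda>n. box_bump n a b x * W x) \<longlonglongrightarrow> indicator (box a b) x * W x"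
        by (intro AE_I2 tendsto_mult tendsto_const box_bump_limit)
      show "AE x in surf. norm (box_bump n a b x * W x) \<le> \<bar>W x\<bar>" for n
        using box_bump_bounds[of n a b] by (auto simp: abs_mult intro!: mult_left_le_one_le)
    qed (use Wi in auto)
    moreover have "(\<integral>x. box_bump n a b x * W x \<partial>surf) = 0" for n
    proof -
      have "cbox a b \<inter> S2 \<subseteq> \<Omega>" using ab U by auto
      from z[OF box_bump_test_fun[OF this, of n]] show ?thesis
        by (simp add: L2_inner_def set_lebesgue_integral_def W_def mult_ac)
    qed
    ultimately have "(\<lambda>n::nat. 0) \<longlonglongrightarrow> (\<integral>x. indicator (box a b) x * W x \<partial>surf)" by (simp only:)
    then show ?thesis using LIMSEQ_unique[OF _ tendsto_const] by blast
  qed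
  have AEbox: "AE x in surf. x \<in> box a b \<longrightarrow> W x = 0" if ab: "cbox a b \<subseteq> U" for a b
  proof -
    have "AE x in surf. indicator (box a b) x * W x = 0"
    proof (rule AE_zero_of_box_integrals)
      show "integrable surf (\<lambda>x. indicator (box a b) x * W x)"
        using integrable_real_mult_indicator[of "box a b" surf W] Wi by (simp add: mult.commute)
      fix c d :: "real^3"
      obtain e f where ef: "box c d \<inter> box a b = box e f" "cbox e f \<subseteq> cbox a b \<or> box e f = {}"
      proof -
        let ?e = "\<chi> i. max (c $ i) (a $ i)" and ?f = "\<chi> i. min (d $ i) (b $ i)"
        have "box c d \<inter> box a b = box ?e ?f" by (auto simp: mem_box_cart)
        moreover have "cbox ?e ?f \<subseteq> cbox a b" by (auto simp: mem_box_cart)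
        ultimately show ?thesis using that by blast
      qed
      have "(\<integral>x. indicator (box c d) x * (indicator (box a b) x * W x) \<partial>surf) = (\<integral>x. indicator (box e f) x * W x \<partial>surf)"
        unfolding ef(1)[symmetric] by (simp add: indicator_inter_arith mult.assoc)
      also have "\<dots> = 0"
      proof (cases "box e f = {}")
        case False
        then show ?thesis using ef(2) ab by (intro box0) auto
      qed simp
      finally show "(\<integral>x. indicator (box c d) x * (indicator (box a b) x * W x) \<partial>surf) = 0" .
    qed
    then show ?thesis by eventually_elim (auto simp: indicator_def)
  qed
  define F where "F = {box a b | a b :: real^3. cbox a b \<subseteq> U}"
  obtain F' where F': "F' \<subseteq> F" "countable F'" "\<Union>F' = \<Union>F"
    by (rule Lindelof[of F]) (auto simp: F_def)
  have cover: "U \<subseteq> \<Union>F"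
  proof
    fix x assume "x \<in> U"
    then obtain a b where "cbox a b \<subseteq> U" "x \<in> box a b" using U(1) open_contains_cbox by metis
    then show "x \<in> \<Union>F" by (auto simp: F_def)
  qed
  have "AE x in surf. \<forall>B\<in>F'. x \<in> B \<longrightarrow> W x = 0"
    using F' AEbox by (subst AE_ball_countable) (auto simp: F_def)
  then show ?thesis unfolding ae_eq_def
  proof eventually_elim
    case (elim x)
    show ?case
    proof
      assume x: "x \<in> \<Omega>"
      then have "x \<in> \<Union>F'" using cover U(2) F'(3) by auto
      then show "w x = 0" using elim x by (auto simp: W_def)
    qed
  qed
qed

end

section \<open>Weak derivatives and Sobolev functions\<close>

text \<open>
  Iterated surface derivatives; the head of the list is applied first, as in the recursion of
  the Sobolev norm.
\<close>

fun sderivs :: "3 list \<Rightarrow> (real^3 \<Rightarrow> real) \<Rightarrow> real^3 \<Rightarrow> real" where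
  "sderivs [] f = f"
| "sderivs (i # is) f = sderivs is (sderiv i f)"

lemma sderiv_zero_outside:
  assumes f: "smooth_S2 f" and K: "compact K" and z: "\<And>x. x \<in> S2 - K \<Longrightarrow> f x = 0" and x: "x \<in> S2 - K"
  shows "sderiv i f x = 0"
proof -
  let ?U = "(- {0}) \<inter> (\<lambda>y. y /\<^sub>R norm y) -` (- K)"
  have "open ?U"
  proof (rule continuous_open_preimage)
    show "continuous_on (- {0}) (\<lambda>y::real^3. y /\<^sub>R norm y)" by (intro continuous_intros) auto
    show "open (- K)" using K by (simp add: compact_imp_closed open_Compl)
  qed (rule open_punctured)
  moreover have "x \<in> ?U" using x by (auto simp: S2_iff)
  moreover have "0 = radial_ext f y" if "y \<in> ?U" for y
    using z[of "y /\<^sub>R norm y"] proj_S2[of y] that by (auto simp: radial_ext_def)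
  ultimately have "(radial_ext f has_derivative (\<lambda>_. 0)) (at x)"
    by (rule has_derivative_transform_within_open[OF has_derivative_const])
  from sderivI[OF this] show ?thesis .
qed

lemma test_fun_sderiv:
  assumes "\<phi> \<in> test_fun \<Omega>" shows "sderiv i \<phi> \<in> test_fun \<Omega>"
proof -
  obtain K where K: "compact K" "K \<subseteq> \<Omega>" "\<forall>x\<in>S2 - K. \<phi> x = 0" and s: "smooth_S2 \<phi>"
    using assms by (auto simp: test_fun_iff)
  have "\<forall>x\<in>S2 - K. sderiv i \<phi> x = 0" using sderiv_zero_outside[OF s K(1)] K(3) by blast
  then show ?thesis unfolding test_fun_iff using K smooth_S2_sderiv[OF s] by blast
qed

lemma test_fun_smooth_S2: "\<phi> \<in> test_fun \<Omega> \<Longrightarrow> smooth_S2 \<phi>"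
  by (simp add: test_fun_iff)

lemma test_fun_outside: "\<phi> \<in> test_fun \<Omega> \<Longrightarrow> x \<in> S2 - \<Omega> \<Longrightarrow> \<phi> x = 0"
  by (auto simp: test_fun_iff)

lemma test_fun_lin:
  assumes "\<phi> \<in> test_fun \<Omega>" "\<psi> \<in> test_fun \<Omega>"
  shows "(\<lambda>x. a * \<phi> x + b * \<psi> x) \<in> test_fun \<Omega>"
proof -
  obtain K L where K: "compact K" "K \<subseteq> \<Omega>" "\<forall>x\<in>S2 - K. \<phi> x = 0" and L: "compact L" "L \<subseteq> \<Omega>" "\<forall>x\<in>S2 - L. \<psi> x = 0"
    using assms by (auto simp: test_fun_iff)
  have "smooth_S2 (\<lambda>x. a * \<phi> x + b * \<psi> x)"
    by (intro smooth_S2_add smooth_S2_cmult assms[THEN test_fun_smooth_S2])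
  then show ?thesis unfolding test_fun_iff
    using K L by (intro conjI exI[of _ "K \<union> L"]) auto
qed

context sphere_open
begin

lemma lint_eq_int_S2:
  assumes "\<And>x. x \<in> S2 - \<Omega> \<Longrightarrow> g x = 0"
  shows "(LINT x:\<Omega>|surf. g x) = int_S2 g"
proof -
  have "indicator \<Omega> x *\<^sub>R g x = indicator S2 x *\<^sub>R g x" for x
    using assms[of x] dom_S2 by (auto simp: indicator_def)
  then show ?thesis unfolding int_S2_def set_lebesgue_integral_def by (simp only:)
qed

lemma test_fun_L2: "\<phi> \<in> test_fun \<Omega> \<Longrightarrow> \<phi> \<in> L2 \<Omega>"
  by (intro L2_continuous smooth_S2_continuous test_fun_smooth_S2)

lemma L2_inner_test: "\<phi> \<in> test_fun \<Omega> \<Longrightarrow> L2_inner f \<phi> = int_S2 (\<lambda>x. f x * \<phi> x)"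
  unfolding L2_inner_def by (rule lint_eq_int_S2) (simp add: test_fun_outside)

lemma L2_inner_lin:
  "u \<in> L2 \<Omega> \<Longrightarrow> v \<in> L2 \<Omega> \<Longrightarrow> w \<in> L2 \<Omega> \<Longrightarrow> L2_inner (\<lambda>x. a * u x + b * v x) w = a * L2_inner u w + b * L2_inner v w"
  by (simp add: L2_inner_add L2_inner_cmult L2_cmult)

lemma L2_lin: "u \<in> L2 \<Omega> \<Longrightarrow> v \<in> L2 \<Omega> \<Longrightarrow> (\<lambda>x. a * u x + b * v x) \<in> L2 \<Omega>"
  by (intro L2_add L2_cmult)

lemma ae_eq_refl: "ae_eq u u"
  by (simp add: ae_eq_def)

lemma ae_eq_sym: "ae_eq u v \<Longrightarrow> ae_eq v u"
  unfolding ae_eq_def by (elim AE_mp) auto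

lemma ae_eq_trans [trans]: "ae_eq u v \<Longrightarrow> ae_eq v w \<Longrightarrow> ae_eq u w"
  unfolding ae_eq_def by (elim AE_mp) (auto elim!: AE_mp)

lemma ae_eq_lin: "ae_eq u u' \<Longrightarrow> ae_eq v v' \<Longrightarrow> ae_eq (\<lambda>x. a * u x + b * v x) (\<lambda>x. a * u' x + b * v' x)"
proof -
  assume "ae_eq u u'" "ae_eq v v'"
  then show ?thesis unfolding ae_eq_def by eventually_elim auto
qed

lemma ae_eq_sum:
  "(\<And>i. i \<in> I \<Longrightarrow> ae_eq (u i) (v i)) \<Longrightarrow> ae_eq (\<lambda>x. \<Sum>i\<in>I. u i x) (\<lambda>x. \<Sum>i\<in>I. v i x)"
proof (induction I rule: infinite_finite_induct)
  case (insert i I)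
  have "ae_eq (u i) (v i)" "ae_eq (\<lambda>x. \<Sum>i\<in>I. u i x) (\<lambda>x. \<Sum>i\<in>I. v i x)" using insert by auto
  from ae_eq_lin[OF this, of 1 1] show ?case using insert.hyps by simp
qed (simp_all add: ae_eq_refl)

lemma has_weak_deriv_iff:
  "has_weak_deriv \<Omega> i u v \<longleftrightarrow> u \<in> L2 \<Omega> \<and> v \<in> L2 \<Omega> \<and>
    (\<forall>\<phi>\<in>test_fun \<Omega>. L2_inner u (sderiv i \<phi>) = - L2_inner v \<phi> + 2 * L2_inner u (\<lambda>x. \<phi> x * x $ i))"
  by (simp add: has_weak_deriv_def L2_inner_def mult.assoc)

lemma test_coord_L2: "\<phi> \<in> test_fun \<Omega> \<Longrightarrow> (\<lambda>x. \<phi> x * x $ i) \<in> L2 \<Omega>"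
  by (intro L2_continuous smooth_S2_continuous smooth_S2_mult test_fun_smooth_S2 smooth_S2_component)

lemma weak_deriv_lin:
  assumes "has_weak_deriv \<Omega> i u u'" "has_weak_deriv \<Omega> i v v'"
  shows "has_weak_deriv \<Omega> i (\<lambda>x. a * u x + b * v x) (\<lambda>x. a * u' x + b * v' x)"
  unfolding has_weak_deriv_iff
proof (intro conjI ballI)
  have L: "u \<in> L2 \<Omega>" "v \<in> L2 \<Omega>" "u' \<in> L2 \<Omega>" "v' \<in> L2 \<Omega>"
    using assms by (auto simp: has_weak_deriv_iff)
  show "(\<lambda>x. a * u x + b * v x) \<in> L2 \<Omega>" "(\<lambda>x. a * u' x + b * v' x) \<in> L2 \<Omega>"
    using L by (auto intro: L2_lin)
  fix \<phi> assume p: "\<phi> \<in> test_fun \<Omega>"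
  have "L2_inner u (sderiv i \<phi>) = - L2_inner u' \<phi> + 2 * L2_inner u (\<lambda>x. \<phi> x * x $ i)"
    "L2_inner v (sderiv i \<phi>) = - L2_inner v' \<phi> + 2 * L2_inner v (\<lambda>x. \<phi> x * x $ i)"
    using assms p by (auto simp: has_weak_deriv_iff)
  then show "L2_inner (\<lambda>x. a * u x + b * v x) (sderiv i \<phi>)
      = - L2_inner (\<lambda>x. a * u' x + b * v' x) \<phi> + 2 * L2_inner (\<lambda>x. a * u x + b * v x) (\<lambda>x. \<phi> x * x $ i)"
    unfolding L2_inner_lin[OF L(1,2) test_fun_L2[OF test_fun_sderiv[OF p]]] L2_inner_lin[OF L(3,4) test_fun_L2[OF p]]
      L2_inner_lin[OF L(1,2) test_coord_L2[OF p]] by algebra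
qed

lemma weak_deriv_zero: "has_weak_deriv \<Omega> i (\<lambda>x. 0) (\<lambda>x. 0)"
  by (simp add: has_weak_deriv_iff L2_zero L2_inner_zero)

lemma weak_deriv_sum:
  "(\<And>j. j \<in> J \<Longrightarrow> has_weak_deriv \<Omega> i (u j) (v j)) \<Longrightarrow>
    has_weak_deriv \<Omega> i (\<lambda>x. \<Sum>j\<in>J. u j x) (\<lambda>x. \<Sum>j\<in>J. v j x)"
proof (induction J rule: infinite_finite_induct)
  case (insert j J)
  have "has_weak_deriv \<Omega> i (u j) (v j)" "has_weak_deriv \<Omega> i (\<lambda>x. \<Sum>j\<in>J. u j x) (\<lambda>x. \<Sum>j\<in>J. v j x)"
    using insert by auto
  from weak_deriv_lin[OF this, of 1 1] show ?case using insert.hyps by simp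
qed (simp_all add: weak_deriv_zero)

lemma weak_deriv_cong:
  assumes "has_weak_deriv \<Omega> i u v" "ae_eq u u'" "ae_eq v v'" "u' \<in> L2 \<Omega>" "v' \<in> L2 \<Omega>"
  shows "has_weak_deriv \<Omega> i u' v'"
proof -
  have L: "u \<in> L2 \<Omega>" "v \<in> L2 \<Omega>" using assms(1) by (auto simp: has_weak_deriv_iff)
  have e: "L2_inner u f = L2_inner u' f" "L2_inner v f = L2_inner v' f" if "f \<in> L2 \<Omega>" for f
    using L2_inner_cong[OF assms(2) L(1) assms(4) that] L2_inner_cong[OF assms(3) L(2) assms(5) that] by auto
  show ?thesis unfolding has_weak_deriv_iff
  proof (intro conjI ballI assms(4,5))
    fix \<phi> assume p: "\<phi> \<in> test_fun \<Omega>"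
    have "L2_inner u (sderiv i \<phi>) = - L2_inner v \<phi> + 2 * L2_inner u (\<lambda>x. \<phi> x * x $ i)"
      using assms(1) p by (simp add: has_weak_deriv_iff)
    then show "L2_inner u' (sderiv i \<phi>) = - L2_inner v' \<phi> + 2 * L2_inner u' (\<lambda>x. \<phi> x * x $ i)"
      unfolding e(1)[OF test_fun_L2[OF test_fun_sderiv[OF p]]] e(2)[OF test_fun_L2[OF p]] e(1)[OF test_coord_L2[OF p]] .
  qed
qed

lemma weak_deriv_unique:
  assumes "has_weak_deriv \<Omega> i u v" "has_weak_deriv \<Omega> i u v'"
  shows "ae_eq v v'"
proof -
  have L: "v \<in> L2 \<Omega>" "v' \<in> L2 \<Omega>" using assms by (auto simp: has_weak_deriv_iff)
  have "ae_eq (\<lambda>x. v x - v' x) (\<lambda>x. 0)"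
  proof (rule fundamental_lemma)
    show "(\<lambda>x. v x - v' x) \<in> L2 \<Omega>" using L by (rule L2_diff)
    fix \<phi> assume p: "\<phi> \<in> test_fun \<Omega>"
    have "L2_inner v \<phi> = L2_inner v' \<phi>" using assms p unfolding has_weak_deriv_iff by force
    then show "L2_inner (\<lambda>x. v x - v' x) \<phi> = 0" using L2_inner_diff[OF L test_fun_L2[OF p]] by simp
  qed
  then show ?thesis unfolding ae_eq_def by (rule eventually_mono) auto
qed

lemma wderiv_works:
  assumes "has_weak_deriv \<Omega> i u v"
  shows "has_weak_deriv \<Omega> i u (wderiv \<Omega> i u)" "ae_eq (wderiv \<Omega> i u) v"
proof -
  show 1: "has_weak_deriv \<Omega> i u (wderiv \<Omega> i u)" unfolding wderiv_def by (rule someI[of "has_weak_deriv \<Omega> i u", OF assms])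
  show "ae_eq (wderiv \<Omega> i u) v" by (rule weak_deriv_unique[OF 1 assms])
qed

text \<open>The divergence theorem for the product of the two test functions.\<close>

lemma weak_deriv_test:
  assumes p: "\<phi> \<in> test_fun \<Omega>"
  shows "has_weak_deriv \<Omega> i \<phi> (sderiv i \<phi>)"
  unfolding has_weak_deriv_iff
proof (intro conjI ballI test_fun_L2 p test_fun_sderiv)
  fix \<psi> assume q: "\<psi> \<in> test_fun \<Omega>"
  note s = test_fun_smooth_S2[OF p] and t = test_fun_smooth_S2[OF q]
  have "int_S2 (\<lambda>x. \<phi> x * sderiv i \<psi> x + sderiv i \<phi> x * \<psi> x) = int_S2 (sderiv i (\<lambda>x. \<phi> x * \<psi> x))"
    by (rule int_S2_cong) (simp add: sderiv_mult[OF s t])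
  also have "\<dots> = 2 * int_S2 (\<lambda>x. \<phi> x * \<psi> x * x $ i)"
    by (rule int_S2_sderiv[OF smooth_S2_mult[OF s t]])
  also have "int_S2 (\<lambda>x. \<phi> x * sderiv i \<psi> x + sderiv i \<phi> x * \<psi> x)
      = int_S2 (\<lambda>x. \<phi> x * sderiv i \<psi> x) + int_S2 (\<lambda>x. sderiv i \<phi> x * \<psi> x)"
    by (intro int_S2_add smooth_S2_continuous smooth_S2_mult smooth_S2_sderiv s t)
  finally have e: "int_S2 (\<lambda>x. \<phi> x * sderiv i \<psi> x) + int_S2 (\<lambda>x. sderiv i \<phi> x * \<psi> x) = 2 * int_S2 (\<lambda>x. \<phi> x * \<psi> x * x $ i)" .
  have "L2_inner \<phi> (\<lambda>x. \<psi> x * x $ i) = int_S2 (\<lambda>x. \<phi> x * \<psi> x * x $ i)"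
    unfolding L2_inner_def mult.assoc[symmetric] by (rule lint_eq_int_S2) (simp add: test_fun_outside[OF q])
  then show "L2_inner \<phi> (sderiv i \<psi>) = - L2_inner (sderiv i \<phi>) \<psi> + 2 * L2_inner \<phi> (\<lambda>x. \<psi> x * x $ i)"
    using e by (simp add: L2_inner_test q test_fun_sderiv)
qed

lemma Sob_L2: "u \<in> Sob p \<Omega> \<Longrightarrow> u \<in> L2 \<Omega>"
  by (cases p) auto

lemma Sob_cong: "u \<in> Sob p \<Omega> \<Longrightarrow> ae_eq u u' \<Longrightarrow> u' \<in> L2 \<Omega> \<Longrightarrow> u' \<in> Sob p \<Omega>"
proof (cases p)
  case (Suc q)
  assume *: "u \<in> Sob p \<Omega>" "ae_eq u u'" "u' \<in> L2 \<Omega>"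
  have "\<exists>v\<in>Sob q \<Omega>. has_weak_deriv \<Omega> i u' v" for i
  proof -
    obtain v where "v \<in> Sob q \<Omega>" "has_weak_deriv \<Omega> i u v" using *(1) by (auto simp: Suc)
    then show ?thesis using weak_deriv_cong[OF _ *(2) ae_eq_refl *(3)] Sob_L2 by blast
  qed
  then show ?thesis using *(3) by (simp add: Suc)
qed simp

text \<open>
  The derivative chosen by \<open>wderiv\<close> may differ on a null set from the witness in the
  definition of the space; this does not affect its own weak derivatives.
\<close>

lemma Sob_wderiv:
  assumes "u \<in> Sob (Suc p) \<Omega>"
  shows "has_weak_deriv \<Omega> i u (wderiv \<Omega> i u)" "wderiv \<Omega> i u \<in> Sob p \<Omega>"
proof -
  obtain v where v: "v \<in> Sob p \<Omega>" "has_weak_deriv \<Omega> i u v" using assms by auto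
  show 1: "has_weak_deriv \<Omega> i u (wderiv \<Omega> i u)" by (rule wderiv_works(1)[OF v(2)])
  show "wderiv \<Omega> i u \<in> Sob p \<Omega>"
    by (rule Sob_cong[OF v(1) ae_eq_sym[OF wderiv_works(2)[OF v(2)]]]) (use 1 in \<open>simp add: has_weak_deriv_iff\<close>)
qed

lemma Sob_lin: "u \<in> Sob p \<Omega> \<Longrightarrow> v \<in> Sob p \<Omega> \<Longrightarrow> (\<lambda>x. a * u x + b * v x) \<in> Sob p \<Omega>"
proof (induction p arbitrary: u v)
  case 0 then show ?case by (simp add: L2_lin)
next
  case (Suc p)
  have "\<exists>w\<in>Sob p \<Omega>. has_weak_deriv \<Omega> i (\<lambda>x. a * u x + b * v x) w" for i
    using Suc.IH[OF Sob_wderiv(2)[OF Suc.prems(1)] Sob_wderiv(2)[OF Suc.prems(2)]]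
      weak_deriv_lin[OF Sob_wderiv(1)[OF Suc.prems(1)] Sob_wderiv(1)[OF Suc.prems(2)]] by blast
  then show ?case using L2_lin[OF Sob_L2[OF Suc.prems(1)] Sob_L2[OF Suc.prems(2)]] by simp
qed

lemma Sob_test: "\<phi> \<in> test_fun \<Omega> \<Longrightarrow> \<phi> \<in> Sob p \<Omega>"
proof (induction p arbitrary: \<phi>)
  case (Suc p)
  have "\<exists>v\<in>Sob p \<Omega>. has_weak_deriv \<Omega> i \<phi> v" for i
    by (rule bexI[of _ "sderiv i \<phi>"], rule weak_deriv_test[OF Suc.prems], rule Suc.IH[OF test_fun_sderiv[OF Suc.prems]])
  then show ?case by (simp add: test_fun_L2[OF Suc.prems])
qed (simp add: test_fun_L2)

fun wderivs :: "3 list \<Rightarrow> (real^3 \<Rightarrow> real) \<Rightarrow> real^3 \<Rightarrow> real" where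
  "wderivs [] u = u"
| "wderivs (i # is) u = wderivs is (wderiv \<Omega> i u)"

lemma wderivs_Sob: "u \<in> Sob (length is + p) \<Omega> \<Longrightarrow> wderivs is u \<in> Sob p \<Omega>"
proof (induction "is" arbitrary: u)
  case (Cons i "is")
  have "u \<in> Sob (Suc (length is + p)) \<Omega>" using Cons.prems by (simp only: list.size add_Suc_right add_0_right add_Suc)
  from Cons.IH[OF Sob_wderiv(2)[OF this]] show ?case by simp
qed simp

lemma wderivs_L2: "u \<in> Sob (length is) \<Omega> \<Longrightarrow> wderivs is u \<in> L2 \<Omega>"
  using wderivs_Sob[of u "is" 0] by simp

text \<open>
  Iterated weak derivatives are determined up to null sets only, so every identity between
  them is an almost everywhere statement.
\<close>

lemma wderivs_cong: "u \<in> Sob (length is) \<Omega> \<Longrightarrow> ae_eq u u' \<Longrightarrow> u' \<in> L2 \<Omega> \<Longrightarrow> ae_eq (wderivs is u) (wderivs is u')"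
proof (induction "is" arbitrary: u u')
  case (Cons i "is")
  have u: "u \<in> Sob (Suc (length is)) \<Omega>" using Cons.prems(1) by (simp only: list.size add_Suc_right add_0_right)
  have w: "has_weak_deriv \<Omega> i u' (wderiv \<Omega> i u)"
    using weak_deriv_cong[OF Sob_wderiv(1)[OF u] Cons.prems(2) ae_eq_refl Cons.prems(3)] Sob_L2[OF Sob_wderiv(2)[OF u]] by blast
  have "ae_eq (wderivs is (wderiv \<Omega> i u)) (wderivs is (wderiv \<Omega> i u'))"
    by (rule Cons.IH[OF Sob_wderiv(2)[OF u] ae_eq_sym[OF wderiv_works(2)[OF w]]])
      (use wderiv_works(1)[OF w] in \<open>simp add: has_weak_deriv_iff\<close>)
  then show ?case by simp
qed simp

lemma wderivs_lin:
  "u \<in> Sob (length is) \<Omega> \<Longrightarrow> v \<in> Sob (length is) \<Omega> \<Longrightarrow>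
    ae_eq (wderivs is (\<lambda>x. a * u x + b * v x)) (\<lambda>x. a * wderivs is u x + b * wderivs is v x)"
proof (induction "is" arbitrary: u v)
  case (Cons i "is")
  have u: "u \<in> Sob (Suc (length is)) \<Omega>" and v: "v \<in> Sob (Suc (length is)) \<Omega>" using Cons.prems by (simp_all only: list.size add_Suc_right add_0_right)
  have w: "has_weak_deriv \<Omega> i (\<lambda>x. a * u x + b * v x) (\<lambda>x. a * wderiv \<Omega> i u x + b * wderiv \<Omega> i v x)"
    by (rule weak_deriv_lin[OF Sob_wderiv(1)[OF u] Sob_wderiv(1)[OF v]])
  have S: "(\<lambda>x. a * wderiv \<Omega> i u x + b * wderiv \<Omega> i v x) \<in> Sob (length is) \<Omega>"
    by (rule Sob_lin[OF Sob_wderiv(2)[OF u] Sob_wderiv(2)[OF v]])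
  have "ae_eq (wderivs is (wderiv \<Omega> i (\<lambda>x. a * u x + b * v x))) (wderivs is (\<lambda>x. a * wderiv \<Omega> i u x + b * wderiv \<Omega> i v x))"
    by (rule ae_eq_sym, rule wderivs_cong[OF S ae_eq_sym[OF wderiv_works(2)[OF w]]])
      (use wderiv_works(1)[OF w] in \<open>simp add: has_weak_deriv_iff\<close>)
  also have "ae_eq \<dots> (\<lambda>x. a * wderivs is (wderiv \<Omega> i u) x + b * wderivs is (wderiv \<Omega> i v) x)"
    by (rule Cons.IH[OF Sob_wderiv(2)[OF u] Sob_wderiv(2)[OF v]])
  finally show ?case by simp
qed (simp add: ae_eq_refl)

lemma wderivs_test: "\<phi> \<in> test_fun \<Omega> \<Longrightarrow> ae_eq (wderivs is \<phi>) (sderivs is \<phi>)"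
proof (induction "is" arbitrary: \<phi>)
  case (Cons i "is")
  note w = weak_deriv_test[OF Cons.prems, of i]
  have "ae_eq (wderivs is (wderiv \<Omega> i \<phi>)) (wderivs is (sderiv i \<phi>))"
    by (rule ae_eq_sym, rule wderivs_cong[OF Sob_test[OF test_fun_sderiv[OF Cons.prems]] ae_eq_sym[OF wderiv_works(2)[OF w]]])
      (use wderiv_works(1)[OF w] in \<open>simp add: has_weak_deriv_iff\<close>)
  also have "ae_eq \<dots> (sderivs is (sderiv i \<phi>))" by (rule Cons.IH[OF test_fun_sderiv[OF Cons.prems]])
  finally show ?case by simp
qed (simp add: ae_eq_refl)

lemma Sob_norm_sq_nonneg: "0 \<le> Sob_norm_sq p \<Omega> u"
proof (induction p arbitrary: u)
  case 0 then show ?case using L2_inner_nonneg[of u] by (simp add: L2_inner_def power2_eq_square)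
next
  case (Suc p)
  then show ?case using L2_inner_nonneg[of u] by (simp add: L2_inner_def power2_eq_square sum_nonneg)
qed

lemma Sob_norm_sq_ge: "L2_inner u u \<le> Sob_norm_sq p \<Omega> u"
  by (cases p) (simp_all add: L2_inner_def power2_eq_square sum_nonneg Sob_norm_sq_nonneg)

lemma wderivs_norm: "L2_inner (wderivs is u) (wderivs is u) \<le> Sob_norm_sq (length is) \<Omega> u"
proof (induction "is" arbitrary: u)
  case Nil then show ?case using Sob_norm_sq_ge[of u 0] by simp
next
  case (Cons i "is")
  have "Sob_norm_sq (length is) \<Omega> (wderiv \<Omega> i u) \<le> (\<Sum>i\<in>UNIV. Sob_norm_sq (length is) \<Omega> (wderiv \<Omega> i u))"
    by (rule member_le_sum) (auto simp: Sob_norm_sq_nonneg)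
  also have "\<dots> \<le> Sob_norm_sq (length (i # is)) \<Omega> u"
    using L2_inner_nonneg[of u] by (simp add: L2_inner_def power2_eq_square)
  finally show ?case using Cons.IH[of "wderiv \<Omega> i u"] by simp
qed

definition L2_conv :: "(nat \<Rightarrow> real^3 \<Rightarrow> real) \<Rightarrow> (real^3 \<Rightarrow> real) \<Rightarrow> bool" where
  "L2_conv f g \<longleftrightarrow> (\<forall>n. f n \<in> L2 \<Omega>) \<and> g \<in> L2 \<Omega> \<and> (\<lambda>n. L2_inner (\<lambda>x. g x - f n x) (\<lambda>x. g x - f n x)) \<longlonglongrightarrow> 0"

lemma L2_inner_self_cong:
  assumes "ae_eq u v" "u \<in> L2 \<Omega>" "v \<in> L2 \<Omega>" shows "L2_inner u u = L2_inner v v"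
  using L2_inner_cong[OF assms assms(2)] L2_inner_cong[OF assms assms(3)] L2_inner_sym by metis

lemma L2_conv_cong:
  assumes "L2_conv f g" "\<And>n. ae_eq (f n) (f' n)" "ae_eq g g'" "\<And>n. f' n \<in> L2 \<Omega>" "g' \<in> L2 \<Omega>"
  shows "L2_conv f' g'"
proof -
  have "L2_inner (\<lambda>x. g x - f n x) (\<lambda>x. g x - f n x) = L2_inner (\<lambda>x. g' x - f' n x) (\<lambda>x. g' x - f' n x)" for n
    by (rule L2_inner_self_cong) (use assms ae_eq_lin[OF assms(3) assms(2)[of n], of 1 "-1"] in \<open>auto simp: L2_conv_def intro: L2_diff\<close>)
  then show ?thesis using assms by (simp add: L2_conv_def)
qed

lemma L2_inner_lin_self_le:
  assumes "u \<in> L2 \<Omega>" "v \<in> L2 \<Omega>"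
  shows "L2_inner (\<lambda>x. a * u x + b * v x) (\<lambda>x. a * u x + b * v x) \<le> 2 * a\<^sup>2 * L2_inner u u + 2 * b\<^sup>2 * L2_inner v v"
proof -
  have e: "L2_inner (\<lambda>x. a * u x + c * v x) (\<lambda>x. a * u x + c * v x) = a\<^sup>2 * L2_inner u u + 2 * a * c * L2_inner u v + c\<^sup>2 * L2_inner v v" for c
    using L2_inner_lin[OF assms L2_lin[OF assms], of a c a c]
      L2_inner_lin[OF assms assms(1), of a c] L2_inner_lin[OF assms assms(2), of a c]
      L2_inner_sym[of u "\<lambda>x. a * u x + c * v x"] L2_inner_sym[of v "\<lambda>x. a * u x + c * v x"] L2_inner_sym[of v u]
    by (simp add: power2_eq_square algebra_simps)
  have "0 \<le> L2_inner (\<lambda>x. a * u x + (- b) * v x) (\<lambda>x. a * u x + (- b) * v x)" by (rule L2_inner_nonneg)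
  then have q: "0 \<le> a\<^sup>2 * L2_inner u u - 2 * a * b * L2_inner u v + b\<^sup>2 * L2_inner v v" unfolding e by simp
  have "a\<^sup>2 * L2_inner u u + 2 * a * b * L2_inner u v + b\<^sup>2 * L2_inner v v = (2 * a\<^sup>2 * L2_inner u u + 2 * b\<^sup>2 * L2_inner v v)
      - (a\<^sup>2 * L2_inner u u - 2 * a * b * L2_inner u v + b\<^sup>2 * L2_inner v v)" by algebra
  then show ?thesis unfolding e using q by linarith
qed

lemma L2_conv_lin:
  assumes "L2_conv f g" "L2_conv f' g'"
  shows "L2_conv (\<lambda>n x. a * f n x + b * f' n x) (\<lambda>x. a * g x + b * g' x)"
proof -
  let ?d = "\<lambda>n x. g x - f n x" and ?d' = "\<lambda>n x. g' x - f' n x"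
  have L: "?d n \<in> L2 \<Omega>" "?d' n \<in> L2 \<Omega>" for n using assms by (auto simp: L2_conv_def intro: L2_diff)
  have "(\<lambda>n. 2 * a\<^sup>2 * L2_inner (?d n) (?d n) + 2 * b\<^sup>2 * L2_inner (?d' n) (?d' n)) \<longlonglongrightarrow> 2 * a\<^sup>2 * 0 + 2 * b\<^sup>2 * 0"
    using assms unfolding L2_conv_def by (intro tendsto_add tendsto_mult tendsto_const) auto
  then have lim: "(\<lambda>n. 2 * a\<^sup>2 * L2_inner (?d n) (?d n) + 2 * b\<^sup>2 * L2_inner (?d' n) (?d' n)) \<longlonglongrightarrow> 0" by simp
  have "(\<lambda>n. L2_inner (\<lambda>x. a * ?d n x + b * ?d' n x) (\<lambda>x. a * ?d n x + b * ?d' n x)) \<longlonglongrightarrow> 0"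
    by (rule tendsto_sandwich[OF _ _ tendsto_const lim]) (auto simp: L2_inner_nonneg L2_inner_lin_self_le[OF L])
  moreover have "(\<lambda>x. a * ?d n x + b * ?d' n x) = (\<lambda>x. (a * g x + b * g' x) - (a * f n x + b * f' n x))" for n
    by (simp add: fun_eq_iff algebra_simps)
  ultimately show ?thesis using assms by (simp add: L2_conv_def L2_lin)
qed

lemma L2_conv_zero: "L2_conv (\<lambda>n x. 0) (\<lambda>x. 0)"
  by (simp add: L2_conv_def L2_zero L2_inner_zero)

lemma L2_conv_sum:
  "(\<And>i. i \<in> I \<Longrightarrow> L2_conv (f i) (g i)) \<Longrightarrow> L2_conv (\<lambda>n x. \<Sum>i\<in>I. f i n x) (\<lambda>x. \<Sum>i\<in>I. g i x)"
proof (induction I rule: infinite_finite_induct)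
  case (insert i I)
  have "L2_conv (f i) (g i)" "L2_conv (\<lambda>n x. \<Sum>i\<in>I. f i n x) (\<lambda>x. \<Sum>i\<in>I. g i x)" using insert by auto
  from L2_conv_lin[OF this, of 1 1] show ?case using insert.hyps by simp
qed (simp_all add: L2_conv_zero)

lemma L2_inner_tendsto_zero:
  assumes "\<And>n. f n \<in> L2 \<Omega>" "\<And>n. g n \<in> L2 \<Omega>" "(\<lambda>n. L2_inner (f n) (f n) * L2_inner (g n) (g n)) \<longlonglongrightarrow> 0"
  shows "(\<lambda>n. L2_inner (f n) (g n)) \<longlonglongrightarrow> 0"
proof -
  have "(\<lambda>n. (L2_inner (f n) (g n))\<^sup>2) \<longlonglongrightarrow> 0"
    by (rule tendsto_sandwich[OF _ _ tendsto_const assms(3)]) (auto simp: L2_inner_cauchy_schwarz assms)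
  from tendsto_real_sqrt[OF this] show ?thesis by (simp add: tendsto_rabs_zero_iff)
qed

text \<open>
  Expand around the limits; each error term is bounded by the Cauchy-Schwarz inequality.
\<close>

lemma L2_conv_ip:
  assumes "L2_conv f g" "L2_conv f' g'"
  shows "(\<lambda>n. L2_inner (f n) (f' n)) \<longlonglongrightarrow> L2_inner g g'"
proof -
  let ?d = "\<lambda>n x. g x - f n x" and ?d' = "\<lambda>n x. g' x - f' n x"
  have F: "f n \<in> L2 \<Omega>" "f' n \<in> L2 \<Omega>" "g \<in> L2 \<Omega>" "g' \<in> L2 \<Omega>" for n using assms by (auto simp: L2_conv_def)
  have L: "?d n \<in> L2 \<Omega>" "?d' n \<in> L2 \<Omega>" for n using F by (auto intro: L2_diff)
  have z: "(\<lambda>n. L2_inner (?d n) (?d n)) \<longlonglongrightarrow> 0" "(\<lambda>n. L2_inner (?d' n) (?d' n)) \<longlonglongrightarrow> 0" using assms by (auto simp: L2_conv_def)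
  have 1: "(\<lambda>n. L2_inner (?d n) g') \<longlonglongrightarrow> 0"
    using tendsto_mult_left_zero[OF z(1)] by (intro L2_inner_tendsto_zero L F)
  have 2: "(\<lambda>n. L2_inner (?d' n) g) \<longlonglongrightarrow> 0"
    using tendsto_mult_left_zero[OF z(2)] by (intro L2_inner_tendsto_zero L F)
  have 3: "(\<lambda>n. L2_inner (?d n) (?d' n)) \<longlonglongrightarrow> 0"
    using tendsto_mult_zero[OF z] by (intro L2_inner_tendsto_zero L)
  have "(\<lambda>n. L2_inner g g' - L2_inner (?d n) g' - L2_inner (?d' n) g + L2_inner (?d n) (?d' n)) \<longlonglongrightarrow> L2_inner g g' - 0 - 0 + 0"
    by (intro tendsto_add tendsto_diff tendsto_const 1 2 3)
  moreover have "L2_inner g g' - L2_inner (?d n) g' - L2_inner (?d' n) g + L2_inner (?d n) (?d' n) = L2_inner (f n) (f' n)" for n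
  proof -
    have "L2_inner (?d n) (?d' n) = L2_inner g (?d' n) - L2_inner (f n) (?d' n)" by (rule L2_inner_diff[OF F(3,1) L(2)])
    also have "\<dots> = (L2_inner g' g - L2_inner (f' n) g) - (L2_inner g' (f n) - L2_inner (f' n) (f n))"
      using L2_inner_diff[OF F(4,2) F(3)] L2_inner_diff[OF F(4,2) F(1)] L2_inner_sym[of g "?d' n"] L2_inner_sym[of "f n" "?d' n"] by simp
    finally show ?thesis
      using L2_inner_diff[OF F(3,1) F(4)] L2_inner_diff[OF F(4,2) F(3)] L2_inner_sym[of g' g] L2_inner_sym[of g' "f n"] L2_inner_sym[of "f' n" "f n"] by simp
  qed
  ultimately show ?thesis by simp
qed

text \<open>Every derivative of top order of \<open>u - \<phi>\<^sub>n\<close> is one of the terms of the Sobolev norm.\<close>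

lemma Sob0_conv:
  assumes "u \<in> Sob0 p \<Omega>"
  obtains \<phi> where "\<And>n. \<phi> n \<in> test_fun \<Omega>" "L2_conv \<phi> u"
    "\<And>is. length is = p \<Longrightarrow> L2_conv (\<lambda>n. wderivs is (\<phi> n)) (wderivs is u)"
proof -
  obtain \<phi> where u: "u \<in> Sob p \<Omega>" and t: "\<And>n. \<phi> n \<in> test_fun \<Omega>"
    and lim: "(\<lambda>n. Sob_norm p \<Omega> (\<lambda>x. u x - \<phi> n x)) \<longlonglongrightarrow> 0"
    using assms by (auto simp: Sob0_def)
  have "(\<lambda>n. (Sob_norm p \<Omega> (\<lambda>x. u x - \<phi> n x))\<^sup>2) \<longlonglongrightarrow> 0\<^sup>2" by (intro tendsto_power lim)
  then have sq: "(\<lambda>n. Sob_norm_sq p \<Omega> (\<lambda>x. u x - \<phi> n x)) \<longlonglongrightarrow> 0"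
    by (simp add: Sob_norm_def Sob_norm_sq_nonneg)
  have "(\<lambda>n. L2_inner (\<lambda>x. u x - \<phi> n x) (\<lambda>x. u x - \<phi> n x)) \<longlonglongrightarrow> 0"
    by (rule tendsto_sandwich[OF _ _ tendsto_const sq]) (auto simp: L2_inner_nonneg Sob_norm_sq_ge)
  then have c: "L2_conv \<phi> u" using t u by (simp add: L2_conv_def test_fun_L2 Sob_L2)
  have "L2_conv (\<lambda>n. wderivs is (\<phi> n)) (wderivs is u)" if l: "length is = p" for "is"
  proof -
    have uS: "u \<in> Sob (length is) \<Omega>" and pS: "\<phi> n \<in> Sob (length is) \<Omega>" for n using u t l Sob_test by auto
    have dS: "(\<lambda>x. u x - \<phi> n x) \<in> Sob (length is) \<Omega>" for n
      using Sob_lin[OF uS pS, of 1 "-1"] by simp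
    have e: "ae_eq (wderivs is (\<lambda>x. u x - \<phi> n x)) (\<lambda>x. wderivs is u x - wderivs is (\<phi> n) x)" for n
      using wderivs_lin[OF uS pS, of 1 "-1"] by simp
    have "(\<lambda>n. L2_inner (wderivs is (\<lambda>x. u x - \<phi> n x)) (wderivs is (\<lambda>x. u x - \<phi> n x))) \<longlonglongrightarrow> 0"
      by (rule tendsto_sandwich[OF _ _ tendsto_const sq]) (auto simp: L2_inner_nonneg wderivs_norm l[symmetric])
    moreover have "L2_inner (wderivs is (\<lambda>x. u x - \<phi> n x)) (wderivs is (\<lambda>x. u x - \<phi> n x)) =
        L2_inner (\<lambda>x. wderivs is u x - wderivs is (\<phi> n) x) (\<lambda>x. wderivs is u x - wderivs is (\<phi> n) x)" for n
      by (rule L2_inner_self_cong[OF e wderivs_L2[OF dS] L2_diff[OF wderivs_L2[OF uS] wderivs_L2[OF pS]]])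
    ultimately show ?thesis unfolding L2_conv_def using wderivs_L2[OF uS] wderivs_L2[OF pS] by simp
  qed
  then show ?thesis using that t c by blast
qed

end

section \<open>Riesz means of the Dirichlet eigenvalues\<close>

context sphere_open
begin

text \<open>
  The operator of the Dirichlet form is a sum over \<open>i\<close> of iterated derivatives: the Laplacian
  for \<open>p = 2\<close>, component \<open>k\<close> of the gradient of the Laplacian for \<open>p = 3\<close>.
\<close>

definition form_derivs :: "nat \<Rightarrow> 3 \<Rightarrow> 3 \<Rightarrow> 3 list" where
  "form_derivs p k i = (if p = 2 then [i, i] else [i, i, k])"

definition form_op :: "nat \<Rightarrow> 3 \<Rightarrow> (real^3 \<Rightarrow> real) \<Rightarrow> real^3 \<Rightarrow> real" where
  "form_op p k u x = (\<Sum>i\<in>UNIV. wderivs (form_derivs p k i) u x)"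

text \<open>The range of \<open>k\<close>; for \<open>p = 2\<close> there is one operator and the index is a dummy.\<close>

definition form_index :: "nat \<Rightarrow> 3 set" where
  "form_index p = (if p = 2 then {1} else UNIV)"

lemma length_form_derivs: "p \<in> {2, 3} \<Longrightarrow> length (form_derivs p k i) = p"
  by (auto simp: form_derivs_def)

lemma form_op_L2: "p \<in> {2, 3} \<Longrightarrow> u \<in> Sob p \<Omega> \<Longrightarrow> form_op p k u \<in> L2 \<Omega>"
  unfolding form_op_def[abs_def] by (intro L2_sum wderivs_L2) (simp add: length_form_derivs)

lemma form_op_lin:
  assumes "p \<in> {2, 3}" "u \<in> Sob p \<Omega>" "v \<in> Sob p \<Omega>"
  shows "ae_eq (form_op p k (\<lambda>x. a * u x + b * v x)) (\<lambda>x. a * form_op p k u x + b * form_op p k v x)"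
proof -
  have "ae_eq (\<lambda>x. \<Sum>i\<in>UNIV. wderivs (form_derivs p k i) (\<lambda>x. a * u x + b * v x) x)
      (\<lambda>x. \<Sum>i\<in>UNIV. a * wderivs (form_derivs p k i) u x + b * wderivs (form_derivs p k i) v x)"
    by (intro ae_eq_sum wderivs_lin) (use assms in \<open>simp_all add: length_form_derivs\<close>)
  then show ?thesis by (simp add: form_op_def[abs_def] sum.distrib sum_distrib_left)
qed

lemma L2_inner_cong2:
  assumes "ae_eq u u'" "ae_eq v v'" "u \<in> L2 \<Omega>" "u' \<in> L2 \<Omega>" "v \<in> L2 \<Omega>" "v' \<in> L2 \<Omega>"
  shows "L2_inner u v = L2_inner u' v'"
  using L2_inner_cong[OF assms(1,3,4,5)] L2_inner_cong[OF assms(2,5,6,4)] L2_inner_sym[of u' v] L2_inner_sym[of u' v'] by simp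

text \<open>
  This form is a sum of inner products of operators that are linear up to null sets. For
  \<open>p = 3\<close> the gradient of the weak Laplacian has to be identified with a sum of third
  derivatives.
\<close>

lemma dirichlet_form_eq:
  assumes p: "p \<in> {2, 3}" and u: "u \<in> Sob p \<Omega>" and v: "v \<in> Sob p \<Omega>"
  shows "dirichlet_form p \<Omega> u v = (\<Sum>k\<in>form_index p. L2_inner (form_op p k u) (form_op p k v))"
proof -
  consider "p = 2" | "p = 3" using p by auto
  then show ?thesis
  proof cases
    case 1
    have "form_op 2 1 w = wlap \<Omega> w" for w by (simp add: form_op_def[abs_def] wlap_def[abs_def] form_derivs_def)
    then show ?thesis by (simp add: 1 dirichlet_form_2 form_index_def L2_inner_def)
  next
    case 2
    have w: "has_weak_deriv \<Omega> k (wlap \<Omega> w) (form_op 3 k w)" if "w \<in> Sob 3 \<Omega>" for w k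
    proof -
      have "has_weak_deriv \<Omega> k (\<lambda>x. \<Sum>i\<in>UNIV. wderivs [i, i] w x) (\<lambda>x. \<Sum>i\<in>UNIV. wderivs [i, i, k] w x)"
      proof (rule weak_deriv_sum)
        fix i
        have "wderivs [i, i] w \<in> Sob (Suc 0) \<Omega>"
          using that wderivs_Sob[of w "[i, i]" "Suc 0"] by (simp add: numeral_3_eq_3)
        from Sob_wderiv(1)[OF this] show "has_weak_deriv \<Omega> k (wderivs [i, i] w) (wderivs [i, i, k] w)" by simp
      qed
      then show ?thesis by (simp add: form_op_def[abs_def] wlap_def[abs_def] form_derivs_def)
    qed
    have L: "wderiv \<Omega> k (wlap \<Omega> w) \<in> L2 \<Omega>" if "w \<in> Sob 3 \<Omega>" for w k
      using wderiv_works(1)[OF w[OF that]] by (simp add: has_weak_deriv_iff)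
    note uv = u[unfolded 2] v[unfolded 2]
    have "dirichlet_form 3 \<Omega> u v = (LINT x:\<Omega>|surf. \<Sum>k\<in>UNIV. wderiv \<Omega> k (wlap \<Omega> u) x * wderiv \<Omega> k (wlap \<Omega> v) x)"
      by (simp add: dirichlet_form_3 inner_vec_def wgrad_def)
    also have "\<dots> = (\<Sum>k\<in>UNIV. L2_inner (wderiv \<Omega> k (wlap \<Omega> u)) (wderiv \<Omega> k (wlap \<Omega> v)))"
      unfolding L2_inner_def set_lebesgue_integral_def scaleR_sum_right
      by (rule Bochner_Integration.integral_sum)
        (use L2_integrable_mult[OF L[OF uv(1)] L[OF uv(2)]] in \<open>simp add: set_integrable_def\<close>)
    also have "\<dots> = (\<Sum>k\<in>UNIV. L2_inner (form_op 3 k u) (form_op 3 k v))"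
      by (intro sum.cong refl L2_inner_cong2 wderiv_works(2) w L form_op_L2 uv) auto
    finally show ?thesis by (simp add: 2 form_index_def)
  qed
qed

definition smooth_form_op :: "nat \<Rightarrow> 3 \<Rightarrow> (real^3 \<Rightarrow> real) \<Rightarrow> real^3 \<Rightarrow> real" where
  "smooth_form_op p k f = (if p = 2 then lap_S2 f else sderiv k (lap_S2 f))"

lemma test_fun_lap_S2:
  assumes "\<phi> \<in> test_fun \<Omega>" shows "lap_S2 \<phi> \<in> test_fun \<Omega>"
proof -
  obtain K where K: "compact K" "K \<subseteq> \<Omega>" "\<And>x. x \<in> S2 - K \<Longrightarrow> \<phi> x = 0" and s: "smooth_S2 \<phi>"
    using assms by (auto simp: test_fun_iff)
  have "\<forall>x\<in>S2 - K. lap_S2 \<phi> x = 0"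
    unfolding lap_S2_def
    by (intro ballI sum.neutral sderiv_zero_outside[OF smooth_S2_sderiv[OF s] K(1)] sderiv_zero_outside[OF s K(1)] K(3))
  then show ?thesis unfolding test_fun_iff using K smooth_S2_lap_S2[OF s] by blast
qed

lemma form_op_test:
  assumes p: "p \<in> {2, 3}" and t: "\<phi> \<in> test_fun \<Omega>"
  shows "ae_eq (form_op p k \<phi>) (smooth_form_op p k \<phi>)"
proof -
  have "ae_eq (form_op p k \<phi>) (\<lambda>x. \<Sum>i\<in>UNIV. sderivs (form_derivs p k i) \<phi> x)"
    unfolding form_op_def[abs_def] by (intro ae_eq_sum wderivs_test t)
  also have "ae_eq \<dots> (smooth_form_op p k \<phi>)"
    unfolding ae_eq_def
  proof (intro AE_I2 impI)
    fix x assume "x \<in> \<Omega>"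
    then have x: "x \<in> S2" using dom_S2 by auto
    consider "p = 2" | "p = 3" using p by auto
    then show "(\<Sum>i\<in>UNIV. sderivs (form_derivs p k i) \<phi> x) = smooth_form_op p k \<phi> x"
    proof cases
      case 2
      have "sderiv k (lap_S2 \<phi>) x = (\<Sum>i\<in>UNIV. sderiv k (sderiv i (sderiv i \<phi>)) x)"
        unfolding lap_S2_def[abs_def] by (rule sderiv_sum[OF _ x]) (intro smooth_S2_sderiv test_fun_smooth_S2[OF t])
      then show ?thesis by (simp add: 2 smooth_form_op_def form_derivs_def)
    qed (simp add: smooth_form_op_def form_derivs_def lap_S2_def)
  qed
  finally show ?thesis .
qed

lemma smooth_form_op_test_fun: "\<phi> \<in> test_fun \<Omega> \<Longrightarrow> smooth_form_op p k \<phi> \<in> test_fun \<Omega>"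
  by (simp add: smooth_form_op_def test_fun_lap_S2 test_fun_sderiv)

lemma smooth_form_eq:
  assumes p: "p \<in> {2, 3}" and t: "\<phi> \<in> test_fun \<Omega>"
  shows "smooth_form p \<phi> = (\<Sum>k\<in>form_index p. L2_inner (form_op p k \<phi>) (form_op p k \<phi>))"
proof -
  have e: "L2_inner (form_op p k \<phi>) (form_op p k \<phi>) = int_S2 (\<lambda>x. (smooth_form_op p k \<phi> x)\<^sup>2)" for k
  proof -
    have "L2_inner (form_op p k \<phi>) (form_op p k \<phi>) = L2_inner (smooth_form_op p k \<phi>) (smooth_form_op p k \<phi>)"
      by (rule L2_inner_self_cong[OF form_op_test[OF p t] form_op_L2[OF p Sob_test[OF t]] test_fun_L2[OF smooth_form_op_test_fun[OF t]]])
    then show ?thesis by (simp add: L2_inner_test smooth_form_op_test_fun[OF t] power2_eq_square)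
  qed
  consider "p = 2" | "p = 3" using p by auto
  then show ?thesis
  proof cases
    case 1
    then show ?thesis unfolding e by (simp add: smooth_form_def form_index_def smooth_form_op_def)
  next
    case 2
    have "int_S2 (\<lambda>x. \<Sum>i\<in>UNIV. (sderiv i (lap_S2 \<phi>) x)\<^sup>2) = (\<Sum>i\<in>UNIV. int_S2 (\<lambda>x. (sderiv i (lap_S2 \<phi>) x)\<^sup>2))"
      by (rule int_S2_sum) (intro continuous_intros smooth_S2_continuous smooth_S2_sderiv smooth_S2_lap_S2 test_fun_smooth_S2[OF t])
    then show ?thesis using 2 unfolding e by (simp add: smooth_form_def form_index_def smooth_form_op_def)
  qed
qed

text \<open>
  Some test functions tend to \<open>v\<close> while the operators of the form, applied to them, tend to
  \<open>A\<close>. Unlike membership in \<open>Sob0\<close>, this is visibly stable under linear combinations.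
\<close>

definition approximable :: "nat \<Rightarrow> (real^3 \<Rightarrow> real) \<Rightarrow> (3 \<Rightarrow> real^3 \<Rightarrow> real) \<Rightarrow> bool" where
  "approximable p v A \<longleftrightarrow> (\<exists>\<phi>. (\<forall>n. \<phi> n \<in> test_fun \<Omega>) \<and> L2_conv \<phi> v \<and> (\<forall>k. L2_conv (\<lambda>n. form_op p k (\<phi> n)) (A k)))"

lemma approximable_Sob0:
  assumes p: "p \<in> {2, 3}" and u: "u \<in> Sob0 p \<Omega>"
  shows "approximable p u (\<lambda>k. form_op p k u)"
proof -
  obtain \<phi> where "\<And>n. \<phi> n \<in> test_fun \<Omega>" "L2_conv \<phi> u"
    and c: "\<And>is. length is = p \<Longrightarrow> L2_conv (\<lambda>n. wderivs is (\<phi> n)) (wderivs is u)"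
    by (rule Sob0_conv[OF u], rule that, assumption+)
  moreover have "L2_conv (\<lambda>n. form_op p k (\<phi> n)) (form_op p k u)" for k
    unfolding form_op_def[abs_def] by (intro L2_conv_sum c length_form_derivs[OF p])
  ultimately show ?thesis unfolding approximable_def by blast
qed

lemma approximable_lin:
  assumes p: "p \<in> {2, 3}" and 1: "approximable p v A" and 2: "approximable p v' A'"
  shows "approximable p (\<lambda>x. a * v x + b * v' x) (\<lambda>k x. a * A k x + b * A' k x)"
proof -
  obtain \<phi> where f: "\<And>n. \<phi> n \<in> test_fun \<Omega>" "L2_conv \<phi> v" "\<And>k. L2_conv (\<lambda>n. form_op p k (\<phi> n)) (A k)"
    using 1 by (auto simp: approximable_def)
  obtain \<psi> where g: "\<And>n. \<psi> n \<in> test_fun \<Omega>" "L2_conv \<psi> v'" "\<And>k. L2_conv (\<lambda>n. form_op p k (\<psi> n)) (A' k)"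
    using 2 by (auto simp: approximable_def)
  let ?h = "\<lambda>n x. a * \<phi> n x + b * \<psi> n x"
  have t: "?h n \<in> test_fun \<Omega>" for n by (rule test_fun_lin[OF f(1) g(1)])
  have "L2_conv (\<lambda>n. form_op p k (?h n)) (\<lambda>x. a * A k x + b * A' k x)" for k
  proof (rule L2_conv_cong[OF L2_conv_lin[OF f(3)[of k] g(3)[of k]] _ ae_eq_refl])
    show "ae_eq (\<lambda>x. a * form_op p k (\<phi> n) x + b * form_op p k (\<psi> n) x) (form_op p k (?h n))" for n
      by (rule ae_eq_sym[OF form_op_lin[OF p Sob_test[OF f(1)] Sob_test[OF g(1)]]])
    show "form_op p k (?h n) \<in> L2 \<Omega>" for n by (rule form_op_L2[OF p Sob_test[OF t]])
    show "(\<lambda>x. a * A k x + b * A' k x) \<in> L2 \<Omega>" using f(3)[of k] g(3)[of k] by (auto simp: L2_conv_def intro: L2_lin)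
  qed
  then show ?thesis unfolding approximable_def
    by (intro exI[of _ ?h] conjI allI t L2_conv_lin[OF f(2) g(2)])
qed

lemma test_fun_zero: "(\<lambda>x. 0) \<in> test_fun \<Omega>"
  unfolding test_fun_iff by (auto simp: smooth_S2_const intro!: exI[of _ "{}"])

lemma approximable_zero:
  assumes p: "p \<in> {2, 3}" shows "approximable p (\<lambda>x. 0) (\<lambda>k x. 0)"
proof -
  have "L2_conv (\<lambda>n. form_op p k (\<lambda>x. 0)) (\<lambda>x. 0)" for k
  proof (rule L2_conv_cong[OF L2_conv_zero _ ae_eq_refl])
    show "ae_eq (\<lambda>x. 0) (form_op p k (\<lambda>x. 0))"
      using form_op_lin[OF p Sob_test[OF test_fun_zero] Sob_test[OF test_fun_zero], of k 0 0] by (simp add: ae_eq_sym)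
  qed (rule form_op_L2[OF p Sob_test[OF test_fun_zero]] L2_zero)+
  then show ?thesis unfolding approximable_def using test_fun_zero L2_conv_zero by (intro exI[of _ "\<lambda>n x. 0"]) auto
qed

lemma approximable_sum:
  assumes p: "p \<in> {2, 3}" and u: "\<And>i. i < (n::nat) \<Longrightarrow> approximable p (u i) (A i)"
  shows "approximable p (\<lambda>x. \<Sum>i<n. c i * u i x) (\<lambda>k x. \<Sum>i<n. c i * A i k x)"
  using u
proof (induction n)
  case 0 then show ?case using approximable_zero[OF p] by simp
next
  case (Suc n)
  have "approximable p (\<lambda>x. \<Sum>i<n. c i * u i x) (\<lambda>k x. \<Sum>i<n. c i * A i k x)" using Suc by simp
  from approximable_lin[OF p this Suc.prems[of n], of 1 "c n"] show ?case by simp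
qed

lemma param_continuous:
  assumes h: "continuous_on (S2 \<times> S2) (\<lambda>p. h (fst p) (snd p))" and v: "v \<in> L2 \<Omega>"
  shows "continuous_on S2 (\<lambda>x. L2_inner (h x) v)"
  unfolding continuous_on_sequentially comp_def
proof (intro allI ballI impI)
  fix u a assume a: "a \<in> S2" and u: "(\<forall>n. u n \<in> S2) \<and> u \<longlonglongrightarrow> a"
  obtain B where B: "B \<ge> 0" "\<And>x y. x \<in> S2 \<Longrightarrow> y \<in> S2 \<Longrightarrow> \<bar>h x y\<bar> \<le> B"
    using S2xS2_bounded[OF h] by blast
  have m: "set_integrable surf \<Omega> (\<lambda>y. h x y * v y)" if "x \<in> S2" for x
    by (rule L2_integrable_mult[OF L2_continuous[OF continuous_on_section(1)[OF h that]] v])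
  show "(\<lambda>n. L2_inner (h (u n)) v) \<longlonglongrightarrow> L2_inner (h a) v"
    unfolding L2_inner_def set_lebesgue_integral_def
  proof (rule integral_dominated_convergence[where w = "\<lambda>y. B * \<bar>indicator \<Omega> y *\<^sub>R v y\<bar>"])
    show "integrable surf (\<lambda>y. B * \<bar>indicator \<Omega> y *\<^sub>R v y\<bar>)"
      using L2_integrable_mult[OF v L2_continuous[of "\<lambda>x. 1"]] by (intro integrable_mult_right integrable_abs) (simp add: set_integrable_def)
    show "AE y in surf. (\<lambda>n. indicator \<Omega> y *\<^sub>R (h (u n) y * v y)) \<longlonglongrightarrow> indicator \<Omega> y *\<^sub>R (h a y * v y)"
    proof (rule AE_I2)
      fix y
      show "(\<lambda>n. indicator \<Omega> y *\<^sub>R (h (u n) y * v y)) \<longlonglongrightarrow> indicator \<Omega> y *\<^sub>R (h a y * v y)"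
      proof (cases "y \<in> \<Omega>")
        case True
        then have "y \<in> S2" using dom_S2 by auto
        then have "(\<lambda>n. h (u n) y) \<longlonglongrightarrow> h a y"
          using continuous_on_section(2)[OF h] a u unfolding continuous_on_sequentially comp_def by blast
        then show ?thesis by (intro tendsto_intros)
      qed simp
    qed
    show "AE y in surf. norm (indicator \<Omega> y *\<^sub>R (h (u n) y * v y)) \<le> B * \<bar>indicator \<Omega> y *\<^sub>R v y\<bar>" for n
    proof (rule AE_I2)
      fix y
      show "norm (indicator \<Omega> y *\<^sub>R (h (u n) y * v y)) \<le> B * \<bar>indicator \<Omega> y *\<^sub>R v y\<bar>"
        using B(2)[of "u n" y] u dom_S2 by (auto simp: indicator_def abs_mult intro!: mult_right_mono)
    qed
  qed (use m a u in \<open>auto simp: set_integrable_def\<close>)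
qed

definition zonal_kernel :: "nat \<Rightarrow> real^3 \<Rightarrow> real^3 \<Rightarrow> real" where
  "zonal_kernel l x y = (2 * real l + 1) / (4 * pi) * legendre l (x \<bullet> y)"

lemma zonal_kernel_continuous: "continuous_on (S2 \<times> S2) (\<lambda>p. zonal_kernel l (fst p) (snd p))"
  unfolding zonal_kernel_def by (intro continuous_intros)

lemma zonal_kernel_continuous': "continuous_on S2 (zonal_kernel l x)"
  unfolding zonal_kernel_def[abs_def] by (intro continuous_intros)

lemma int_S2_zonal_kernel_sq:
  assumes x: "x \<in> S2"
  shows "int_S2 (\<lambda>y. (zonal_kernel l x y)\<^sup>2) = (2 * real l + 1) / (4 * pi)" "int_S2 (\<lambda>y. (zonal_kernel l y x)\<^sup>2) = (2 * real l + 1) / (4 * pi)"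
proof -
  define c where "c = (2 * real l + 1) / (4 * pi)"
  have c: "c > 0" by (simp add: c_def add_nonneg_pos)
  have "int_S2 (\<lambda>y. (zonal_kernel l y x)\<^sup>2) = int_S2 (\<lambda>y. c\<^sup>2 * (legendre l (y \<bullet> x))\<^sup>2)"
  proof -
    have "zonal_kernel l y x = c * legendre l (y \<bullet> x)" for y by (simp add: zonal_kernel_def c_def)
    then show ?thesis by (simp add: power_mult_distrib)
  qed
  also have "\<dots> = c\<^sup>2 * (4 * pi / (2 * real l + 1))" by (simp only: int_S2_cmult legendre_poly_norm[OF x])
  also have "4 * pi / (2 * real l + 1) = inverse c" by (simp add: c_def)
  finally show 1: "int_S2 (\<lambda>y. (zonal_kernel l y x)\<^sup>2) = (2 * real l + 1) / (4 * pi)"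
    using c by (simp add: power2_eq_square c_def[symmetric])
  have "zonal_kernel l x y = zonal_kernel l y x" for y by (simp add: zonal_kernel_def inner_commute)
  then show "int_S2 (\<lambda>y. (zonal_kernel l x y)\<^sup>2) = (2 * real l + 1) / (4 * pi)" using 1 by simp
qed

lemma L2_inner_le_int_S2:
  assumes f: "continuous_on S2 f"
  shows "L2_inner f f \<le> int_S2 (\<lambda>x. (f x)\<^sup>2)"
  unfolding L2_inner_def int_S2_def set_lebesgue_integral_def
proof (rule integral_mono)
  show "integrable surf (\<lambda>x. indicator \<Omega> x *\<^sub>R (f x * f x))"
    using L2_integrable_mult[OF L2_continuous[OF f] L2_continuous[OF f]] by (simp add: set_integrable_def)
  show "integrable surf (\<lambda>x. indicator S2 x *\<^sub>R (f x)\<^sup>2)"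
    using S2_set_integrable[of "\<lambda>x. (f x)\<^sup>2"] f by (simp add: set_integrable_def continuous_on_power)
qed (use dom_S2 in \<open>auto simp: indicator_def power2_eq_square\<close>)

text \<open>
  The counterpart of \<open>harmonic_energy\<close> for square integrable functions on \<open>\<Omega>\<close>, extended by
  zero to the sphere.
\<close>

definition dom_energy :: "nat \<Rightarrow> (real^3 \<Rightarrow> real) \<Rightarrow> real" where
  "dom_energy l v = int_S2 (\<lambda>x. (L2_inner (zonal_kernel l x) v)\<^sup>2)"

lemma dom_energy_nonneg: "0 \<le> dom_energy l v"
  unfolding dom_energy_def by (rule int_S2_nonneg) simp

lemma dom_energy_test: "\<phi> \<in> test_fun \<Omega> \<Longrightarrow> dom_energy l \<phi> = harmonic_energy l \<phi>"
  by (simp add: dom_energy_def harmonic_energy_def L2_inner_test harmonic_proj_def zonal_kernel_def)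

text \<open>
  By the Cauchy-Schwarz inequality the squares are bounded uniformly in \<open>x\<close>, since the kernel
  has the same norm at each point.
\<close>

lemma dom_energy_limit:
  assumes c: "L2_conv \<phi> v"
  shows "(\<lambda>n. dom_energy l (\<phi> n)) \<longlonglongrightarrow> dom_energy l v"
proof -
  let ?k = "(2 * real l + 1) / (4 * pi)"
  have L: "\<phi> n \<in> L2 \<Omega>" "v \<in> L2 \<Omega>" for n using c by (auto simp: L2_conv_def)
  have "convergent (\<lambda>n. L2_inner (\<phi> n) (\<phi> n))" using L2_conv_ip[OF c c] by (auto simp: convergent_def)
  then have "Bseq (\<lambda>n. L2_inner (\<phi> n) (\<phi> n))" by (rule convergent_imp_Bseq)
  then obtain B where B: "\<And>n. norm (L2_inner (\<phi> n) (\<phi> n)) \<le> B" unfolding Bseq_def by blast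
  show ?thesis unfolding dom_energy_def
  proof (rule int_S2_limit[where B = "?k * B"])
    show "continuous_on S2 (\<lambda>x. (L2_inner (zonal_kernel l x) (\<phi> n))\<^sup>2)" "continuous_on S2 (\<lambda>x. (L2_inner (zonal_kernel l x) v)\<^sup>2)" for n
      by (intro continuous_intros param_continuous[OF zonal_kernel_continuous] L)+
    fix x assume x: "x \<in> S2"
    have kL: "zonal_kernel l x \<in> L2 \<Omega>" by (rule L2_continuous[OF zonal_kernel_continuous'])
    have "L2_conv (\<lambda>n. zonal_kernel l x) (zonal_kernel l x)" using kL by (simp add: L2_conv_def L2_inner_zero)
    from L2_conv_ip[OF this c] show "(\<lambda>n. (L2_inner (zonal_kernel l x) (\<phi> n))\<^sup>2) \<longlonglongrightarrow> (L2_inner (zonal_kernel l x) v)\<^sup>2"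
      by (rule tendsto_power)
    fix n
    have k: "L2_inner (zonal_kernel l x) (zonal_kernel l x) \<le> ?k" using L2_inner_le_int_S2[OF zonal_kernel_continuous'[of l x]] int_S2_zonal_kernel_sq(1)[OF x] by simp
    have "(L2_inner (zonal_kernel l x) (\<phi> n))\<^sup>2 \<le> L2_inner (zonal_kernel l x) (zonal_kernel l x) * L2_inner (\<phi> n) (\<phi> n)"
      by (rule L2_inner_cauchy_schwarz[OF kL L(1)])
    also have "\<dots> \<le> ?k * B"
      using B[of n] by (intro mult_mono k) (auto simp: L2_inner_nonneg add_nonneg_nonneg)
    finally show "\<bar>(L2_inner (zonal_kernel l x) (\<phi> n))\<^sup>2\<bar> \<le> ?k * B" by simp
  qed
qed

text \<open>
  A test function in the hemisphere vanishes at \<open>x\<close> or at \<open>-x\<close>, so the antipodal condition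
  holds and the spectral inequality passes to the limit.
\<close>

lemma approximable_spectral:
  assumes p: "p \<in> {2, 3}" and hemi: "\<Omega> \<subseteq> S2_plus"
    and tail: "\<And>l. l \<ge> M \<Longrightarrow> z - sphere_ev l ^ p + \<mu> * (-1) ^ l \<le> 0"
    and a: "approximable p v A"
  shows "z * L2_inner v v - (\<Sum>k\<in>form_index p. L2_inner (A k) (A k)) \<le> (\<Sum>l<M. (z - sphere_ev l ^ p + \<mu> * (-1) ^ l) * dom_energy l v)"
proof -
  obtain \<phi> where f: "\<And>n. \<phi> n \<in> test_fun \<Omega>" "L2_conv \<phi> v" "\<And>k. L2_conv (\<lambda>n. form_op p k (\<phi> n)) (A k)"
    using a by (auto simp: approximable_def)
  have "z * L2_inner (\<phi> n) (\<phi> n) - (\<Sum>k\<in>form_index p. L2_inner (form_op p k (\<phi> n)) (form_op p k (\<phi> n)))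
      \<le> (\<Sum>l<M. (z - sphere_ev l ^ p + \<mu> * (-1) ^ l) * dom_energy l (\<phi> n))" for n
  proof -
    have "int_S2 (\<lambda>x. \<phi> n x * \<phi> n (- x)) = int_S2 (\<lambda>x. 0)"
    proof (rule int_S2_cong)
      fix x assume x: "x \<in> S2"
      show "\<phi> n x * \<phi> n (- x) = 0"
      proof (cases "x \<in> \<Omega>")
        case True
        have "- x \<notin> \<Omega>"
        proof
          assume "- x \<in> \<Omega>"
          then show False using subsetD[OF hemi True] subsetD[OF hemi, of "- x"] by (simp add: S2_plus_def)
        qed
        then show ?thesis using test_fun_outside[OF f(1), of "- x" n] x by (simp add: S2_iff)
      next
        case False
        then show ?thesis using test_fun_outside[OF f(1), of x n] x by simp
      qed
    qed
    then have "int_S2 (\<lambda>x. \<phi> n x * \<phi> n (- x)) = 0" by (simp add: int_S2_def)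
    from spectral_inequality[OF test_fun_smooth_S2[OF f(1)] p this tail]
    have "z * int_S2 (\<lambda>x. (\<phi> n x)\<^sup>2) - smooth_form p (\<phi> n) \<le> (\<Sum>l<M. (z - sphere_ev l ^ p + \<mu> * (-1) ^ l) * harmonic_energy l (\<phi> n))" .
    then show ?thesis using smooth_form_eq[OF p f(1)] by (simp add: L2_inner_test f(1) dom_energy_test power2_eq_square)
  qed
  then show ?thesis
    by (intro LIMSEQ_le[of "\<lambda>n. z * L2_inner (\<phi> n) (\<phi> n) - (\<Sum>k\<in>form_index p. L2_inner (form_op p k (\<phi> n)) (form_op p k (\<phi> n)))" _
          "\<lambda>n. \<Sum>l<M. (z - sphere_ev l ^ p + \<mu> * (-1) ^ l) * dom_energy l (\<phi> n)"]
        tendsto_diff tendsto_mult tendsto_sum tendsto_const L2_conv_ip f(2,3) dom_energy_limit) auto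
qed

lemma L2_inner_sum_sum:
  assumes "\<And>i. i < (n::nat) \<Longrightarrow> a i \<in> L2 \<Omega>" "\<And>j. j < (m::nat) \<Longrightarrow> b j \<in> L2 \<Omega>"
  shows "L2_inner (\<lambda>x. \<Sum>i<n. c i * a i x) (\<lambda>x. \<Sum>j<m. d j * b j x) = (\<Sum>i<n. \<Sum>j<m. c i * d j * L2_inner (a i) (b j))"
proof -
  have bL: "(\<lambda>x. \<Sum>j<m. d j * b j x) \<in> L2 \<Omega>" by (intro L2_sum L2_cmult assms) auto
  have "L2_inner (\<lambda>x. \<Sum>i<n. c i * a i x) (\<lambda>x. \<Sum>j<m. d j * b j x) = (\<Sum>i<n. c i * L2_inner (a i) (\<lambda>x. \<Sum>j<m. d j * b j x))"
    by (subst L2_inner_sum) (auto intro!: L2_cmult assms bL simp: L2_inner_cmult)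
  also have "\<dots> = (\<Sum>i<n. c i * (\<Sum>j<m. d j * L2_inner (a i) (b j)))"
  proof (intro sum.cong refl)
    fix i assume "i \<in> {..<n}"
    then have "L2_inner (\<lambda>x. \<Sum>j<m. d j * b j x) (a i) = (\<Sum>j<m. d j * L2_inner (b j) (a i))"
      by (subst L2_inner_sum) (auto intro!: L2_cmult assms simp: L2_inner_cmult)
    then show "c i * L2_inner (a i) (\<lambda>x. \<Sum>j<m. d j * b j x) = c i * (\<Sum>j<m. d j * L2_inner (a i) (b j))"
      using L2_inner_sym by simp
  qed
  finally show ?thesis by (simp add: sum_distrib_left mult.assoc)
qed

lemma L2_inner_bessel:
  assumes F: "finite F" and v: "\<And>f. f \<in> F \<Longrightarrow> v f \<in> L2 \<Omega>" and g: "g \<in> L2 \<Omega>"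
    and o: "\<And>f h. f \<in> F \<Longrightarrow> h \<in> F \<Longrightarrow> L2_inner (v f) (v h) = (if f = h then 1 else 0)"
  shows "(\<Sum>f\<in>F. (L2_inner g (v f))\<^sup>2) \<le> L2_inner g g"
proof -
  define c where "c f = L2_inner g (v f)" for f
  define s where "s x = (\<Sum>f\<in>F. c f * v f x)" for x
  have cv: "(\<lambda>x. c f * v f x) \<in> L2 \<Omega>" if "f \<in> F" for f by (rule L2_cmult[OF v[OF that]])
  have s: "s \<in> L2 \<Omega>" unfolding s_def[abs_def] by (rule L2_sum[OF cv])
  have sip: "L2_inner s w = (\<Sum>f\<in>F. c f * L2_inner (v f) w)" if "w \<in> L2 \<Omega>" for w
    unfolding s_def[abs_def] by (subst L2_inner_sum[OF cv that]) (auto simp: L2_inner_cmult)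
  have sg: "L2_inner s g = (\<Sum>f\<in>F. (c f)\<^sup>2)"
    unfolding sip[OF g] by (simp add: c_def power2_eq_square L2_inner_sym[of _ g])
  have sv: "L2_inner s (v h) = c h" if "h \<in> F" for h
  proof -
    have "L2_inner s (v h) = (\<Sum>f\<in>F. if f = h then c f else 0)"
      unfolding sip[OF v[OF that]] by (intro sum.cong refl) (simp add: o that)
    then show ?thesis using F that by simp
  qed
  have ss: "L2_inner s s = (\<Sum>f\<in>F. (c f)\<^sup>2)"
    unfolding sip[OF s] by (intro sum.cong refl) (simp add: L2_inner_sym[of _ s] sv power2_eq_square)
  have "0 \<le> L2_inner (\<lambda>x. g x - s x) (\<lambda>x. g x - s x)" by (rule L2_inner_nonneg)
  also have "\<dots> = L2_inner g (\<lambda>x. g x - s x) - L2_inner s (\<lambda>x. g x - s x)" by (rule L2_inner_diff[OF g s L2_diff[OF g s]])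
  also have "\<dots> = (L2_inner g g - L2_inner s g) - (L2_inner g s - L2_inner s s)"
    using L2_inner_diff[OF g s g] L2_inner_diff[OF g s s] L2_inner_sym[of g "\<lambda>x. g x - s x"] L2_inner_sym[of s "\<lambda>x. g x - s x"] by simp
  finally show ?thesis using sg ss L2_inner_sym[of g s] by (simp add: c_def)
qed

text \<open>
  Bessel's inequality for the kernel at \<open>x\<close>, integrated over \<open>x\<close>. Exchanging the integrals
  leaves the squared norm of the kernel at each point of \<open>\<Omega>\<close>.
\<close>

lemma trace_bound:
  assumes F: "finite F" and v: "\<And>f. f \<in> F \<Longrightarrow> v f \<in> L2 \<Omega>"
    and o: "\<And>f h. f \<in> F \<Longrightarrow> h \<in> F \<Longrightarrow> L2_inner (v f) (v h) = (if f = h then 1 else 0)"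
  shows "(\<Sum>f\<in>F. dom_energy l (v f)) \<le> (2 * real l + 1) / (4 * pi) * measure surf \<Omega>"
proof -
  have cf: "continuous_on S2 (\<lambda>x. (L2_inner (zonal_kernel l x) (v f))\<^sup>2)" if "f \<in> F" for f
    by (intro continuous_intros param_continuous[OF zonal_kernel_continuous] v[OF that])
  have hc: "continuous_on (S2 \<times> S2) (\<lambda>p. zonal_kernel l (fst p) (snd p) * zonal_kernel l (fst p) (snd p))"
    by (intro continuous_intros zonal_kernel_continuous)
  have zc: "continuous_on S2 (\<lambda>x. L2_inner (zonal_kernel l x) (zonal_kernel l x))"
    using param_continuous[OF hc L2_continuous[of "\<lambda>_. 1"]] by (simp add: L2_inner_def)
  have "(\<Sum>f\<in>F. dom_energy l (v f)) = int_S2 (\<lambda>x. \<Sum>f\<in>F. (L2_inner (zonal_kernel l x) (v f))\<^sup>2)"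
    unfolding dom_energy_def by (rule int_S2_sum[symmetric]) (rule cf)
  also have "\<dots> \<le> int_S2 (\<lambda>x. L2_inner (zonal_kernel l x) (zonal_kernel l x))"
    by (rule int_S2_mono[OF continuous_on_sum[OF cf] zc L2_inner_bessel[OF F v L2_continuous[OF zonal_kernel_continuous'] o]])
  also have "\<dots> = (LINT y:\<Omega>|surf. int_S2 (\<lambda>x. zonal_kernel l x y * zonal_kernel l x y))"
    unfolding L2_inner_def by (rule int_S2_fubini_on[OF hc dom_borel dom_S2])
  also have "\<dots> = (LINT y:\<Omega>|surf. (2 * real l + 1) / (4 * pi))"
    by (rule set_lebesgue_integral_cong) (use int_S2_zonal_kernel_sq(2) dom_S2 in \<open>auto simp: power2_eq_square\<close>)
  also have "\<dots> = (2 * real l + 1) / (4 * pi) * measure surf \<Omega>"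
    by (simp add: set_lebesgue_integral_def)
  finally show ?thesis .
qed

text \<open>
  Orthonormalisation is expressed by coefficients. They are kept triangular so that the
  residual of the next function has coefficient \<open>1\<close> at this function, whence it is nonzero by
  independence.
\<close>

lemma gram_schmidt:
  assumes u: "\<And>i. i < n \<Longrightarrow> u i \<in> L2 \<Omega>" and ind: "independent_ae \<Omega> n u"
  shows "\<exists>C. \<forall>j<n. \<forall>k<n. L2_inner (\<lambda>x. \<Sum>i<n. C j i * u i x) (\<lambda>x. \<Sum>i<n. C k i * u i x) = (if j = k then 1 else 0)"
proof -
  have comb: "(\<lambda>x. \<Sum>i<n. c i * u i x) \<in> L2 \<Omega>" for c by (intro L2_sum L2_cmult u) auto
  have "\<exists>C. (\<forall>j<m. \<forall>k<m. L2_inner (\<lambda>x. \<Sum>i<n. C j i * u i x) (\<lambda>x. \<Sum>i<n. C k i * u i x) = (if j = k then 1 else 0))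
      \<and> (\<forall>j<m. \<forall>i>j. C j i = 0)" if "m \<le> n" for m
    using that
  proof (induction m)
    case (Suc m)
    then obtain C where C0: "\<forall>j<m. \<forall>k<m. L2_inner (\<lambda>x. \<Sum>i<n. C j i * u i x) (\<lambda>x. \<Sum>i<n. C k i * u i x) = (if j = k then 1 else 0)"
      and tri0: "\<forall>j<m. \<forall>i>j. C j i = 0" using Suc_leD by blast
    have tri: "C j i = 0" if "j < m" "j < i" for i j using tri0 that by simp
    have m: "m < n" using Suc.prems by simp
    define w where "w j x = (\<Sum>i<n. C j i * u i x)" for j x
    have wL: "w j \<in> L2 \<Omega>" for j unfolding w_def[abs_def] by (rule comb)
    have wo: "L2_inner (w j) (w k) = (if j = k then 1 else 0)" if "j < m" "k < m" for j k
      using C0 that unfolding w_def[abs_def] by simp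
    define D where "D i = (if i = m then 1 else 0) - (\<Sum>j<m. L2_inner (u m) (w j) * C j i)" for i
    define d where "d x = (\<Sum>i<n. D i * u i x)" for x
    have dL: "d \<in> L2 \<Omega>" unfolding d_def[abs_def] by (rule comb)
    have d_eq: "d x = u m x - (\<Sum>j<m. L2_inner (u m) (w j) * w j x)" for x
    proof -
      have "(\<Sum>i<n. (\<Sum>j<m. L2_inner (u m) (w j) * C j i) * u i x) = (\<Sum>j<m. L2_inner (u m) (w j) * w j x)"
        unfolding w_def sum_distrib_left sum_distrib_right by (subst sum.swap) (simp add: mult.assoc)
      moreover have "(\<Sum>i<n. (if i = m then 1 else 0) * u i x) = u m x"
        using m by (simp add: if_distrib[of "\<lambda>c. c * _"] cong: if_cong)
      ultimately show ?thesis by (simp add: d_def D_def left_diff_distrib sum_subtractf)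
    qed
    have sL: "(\<lambda>x. \<Sum>j<m. L2_inner (u m) (w j) * w j x) \<in> L2 \<Omega>" by (intro L2_sum L2_cmult wL)
    have dw: "L2_inner d (w k) = 0" if k: "k < m" for k
    proof -
      have "L2_inner d (w k) = L2_inner (u m) (w k) - L2_inner (\<lambda>x. \<Sum>j<m. L2_inner (u m) (w j) * w j x) (w k)"
        unfolding d_eq[abs_def] by (rule L2_inner_diff[OF u[OF m] sL wL])
      also have "L2_inner (\<lambda>x. \<Sum>j<m. L2_inner (u m) (w j) * w j x) (w k) = (\<Sum>j<m. L2_inner (u m) (w j) * L2_inner (w j) (w k))"
        by (subst L2_inner_sum) (auto intro!: L2_cmult wL simp: L2_inner_cmult)
      also have "\<dots> = (\<Sum>j<m. if j = k then L2_inner (u m) (w j) else 0)"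
        by (intro sum.cong refl) (simp add: wo k)
      also have "\<dots> = L2_inner (u m) (w k)" using k by simp
      finally show ?thesis by simp
    qed
    have Dm: "D m = 1" by (simp add: D_def tri)
    have pos: "L2_inner d d > 0"
    proof (rule ccontr)
      assume "\<not> L2_inner d d > 0"
      then have "L2_inner d d = 0" using L2_inner_nonneg[of d] by simp
      from L2_inner_self_zero[OF dL this] have "AE x in surf. x \<in> \<Omega> \<longrightarrow> (\<Sum>i<n. D i * u i x) = 0"
        by (simp add: ae_eq_def d_def)
      then have "D m = 0" using ind m unfolding independent_ae_def by blast
      then show False using Dm by simp
    qed
    define r where "r = 1 / sqrt (L2_inner d d)"
    have r: "r * (r * L2_inner d d) = 1" using pos by (simp add: r_def)
    define C' where "C' j i = (if j = m then r * D i else C j i)" for j i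
    have w': "(\<lambda>x. \<Sum>i<n. C' j i * u i x) = (if j = m then (\<lambda>x. r * d x) else w j)" for j
      by (auto simp: C'_def fun_eq_iff d_def w_def sum_distrib_left mult.assoc)
    have dd: "L2_inner (\<lambda>x. r * d x) (\<lambda>x. r * d x) = 1"
      unfolding L2_inner_cmult L2_inner_sym[of d "\<lambda>x. r * d x"] by (rule r)
    have wd: "L2_inner (\<lambda>x. r * d x) (w k) = 0" if "k < m" for k
      unfolding L2_inner_cmult dw[OF that] by simp
    have wd': "L2_inner (w k) (\<lambda>x. r * d x) = 0" if "k < m" for k
      using wd[OF that] unfolding L2_inner_sym[of "w k" "\<lambda>x. r * d x"] .
    show ?case
    proof (intro exI[of _ C'] conjI allI impI)
      fix j k assume jk: "j < Suc m" "k < Suc m"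
      show "L2_inner (\<lambda>x. \<Sum>i<n. C' j i * u i x) (\<lambda>x. \<Sum>i<n. C' k i * u i x) = (if j = k then 1 else 0)"
        using jk dd wd wd' wo unfolding w' by (auto simp: less_Suc_eq)
    next
      fix j i assume "j < Suc m" "j < i"
      then show "C' j i = 0" using tri by (auto simp: C'_def D_def less_Suc_eq)
    qed
  qed simp
  from this[of n, OF order_refl] show ?thesis by blast
qed

lemma Sob0_Sob: "u \<in> Sob0 p \<Omega> \<Longrightarrow> u \<in> Sob p \<Omega>"
  by (simp add: Sob0_def)

lemma dirichlet_form_sym:
  "p \<in> {2, 3} \<Longrightarrow> u \<in> Sob p \<Omega> \<Longrightarrow> v \<in> Sob p \<Omega> \<Longrightarrow> dirichlet_form p \<Omega> u v = dirichlet_form p \<Omega> v u"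
  by (simp add: dirichlet_form_eq L2_inner_sym)

lemma eigenspace_form:
  "u \<in> eigenspace p \<Omega> \<Lambda> \<Longrightarrow> v \<in> Sob0 p \<Omega> \<Longrightarrow> dirichlet_form p \<Omega> u v = \<Lambda> * L2_inner u v"
  by (simp add: eigenspace_def L2_inner_def)

lemma eigenspace_Sob0: "u \<in> eigenspace p \<Omega> \<Lambda> \<Longrightarrow> u \<in> Sob0 p \<Omega>"
  by (simp add: eigenspace_def)

lemma eigenspace_orthogonal:
  assumes p: "p \<in> {2, 3}" and u: "u \<in> eigenspace p \<Omega> \<Lambda>" and v: "v \<in> eigenspace p \<Omega> \<Lambda>'" and ne: "\<Lambda> \<noteq> \<Lambda>'"
  shows "L2_inner u v = 0"
proof -
  note S = eigenspace_Sob0[OF u] eigenspace_Sob0[OF v]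
  have "\<Lambda> * L2_inner u v = \<Lambda>' * L2_inner v u"
    using eigenspace_form[OF u S(2)] eigenspace_form[OF v S(1)] dirichlet_form_sym[OF p Sob0_Sob[OF S(1)] Sob0_Sob[OF S(2)]] by simp
  then have "(\<Lambda> - \<Lambda>') * L2_inner u v = 0" using L2_inner_sym[of u v] by (simp add: left_diff_distrib)
  then show ?thesis using ne by simp
qed

text \<open>On one eigenspace the form is the multiple \<open>\<Lambda>\<close> of the inner product, by bilinearity.\<close>

lemma eigenspace_comb_form:
  assumes p: "p \<in> {2, 3}" and u: "\<And>i. i < (n::nat) \<Longrightarrow> u i \<in> eigenspace p \<Omega> \<Lambda>"
  shows "(\<Sum>k\<in>form_index p. L2_inner (\<lambda>x. \<Sum>i<n. c i * form_op p k (u i) x) (\<lambda>x. \<Sum>i<n. c i * form_op p k (u i) x))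
     = \<Lambda> * L2_inner (\<lambda>x. \<Sum>i<n. c i * u i x) (\<lambda>x. \<Sum>i<n. c i * u i x)"
proof -
  have S0: "u i \<in> Sob0 p \<Omega>" and S: "u i \<in> Sob p \<Omega>" if "i < n" for i
    using eigenspace_Sob0[OF u[OF that]] Sob0_Sob by auto
  have "(\<Sum>k\<in>form_index p. L2_inner (\<lambda>x. \<Sum>i<n. c i * form_op p k (u i) x) (\<lambda>x. \<Sum>i<n. c i * form_op p k (u i) x))
     = (\<Sum>k\<in>form_index p. \<Sum>i<n. \<Sum>j<n. c i * c j * L2_inner (form_op p k (u i)) (form_op p k (u j)))"
    by (intro sum.cong refl L2_inner_sum_sum form_op_L2[OF p] S)
  also have "\<dots> = (\<Sum>i<n. \<Sum>j<n. \<Sum>k\<in>form_index p. c i * c j * L2_inner (form_op p k (u i)) (form_op p k (u j)))"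
    by (subst sum.swap, intro sum.cong refl, rule sum.swap)
  also have "\<dots> = (\<Sum>i<n. \<Sum>j<n. \<Lambda> * (c i * c j * L2_inner (u i) (u j)))"
  proof (intro sum.cong refl)
    fix i j assume "i \<in> {..<n}" "j \<in> {..<n}"
    then have ij: "i < n" "j < n" by auto
    have "(\<Sum>k\<in>form_index p. c i * c j * L2_inner (form_op p k (u i)) (form_op p k (u j))) = c i * c j * dirichlet_form p \<Omega> (u i) (u j)"
      by (simp add: dirichlet_form_eq[OF p S[OF ij(1)] S[OF ij(2)]] sum_distrib_left)
    then show "(\<Sum>k\<in>form_index p. c i * c j * L2_inner (form_op p k (u i)) (form_op p k (u j))) = \<Lambda> * (c i * c j * L2_inner (u i) (u j))"
      by (simp add: eigenspace_form[OF u[OF ij(1)] S0[OF ij(2)]])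
  qed
  also have "\<dots> = \<Lambda> * L2_inner (\<lambda>x. \<Sum>i<n. c i * u i x) (\<lambda>x. \<Sum>i<n. c i * u i x)"
    by (subst L2_inner_sum_sum) (auto simp: Sob_L2[OF S] sum_distrib_left)
  finally show ?thesis .
qed

text \<open>
  A finite part of the sum involves finitely many eigenvalues with finitely many independent
  eigenfunctions each. Orthonormalise them within each eigenspace, bound each summand by
  \<open>approximable_spectral\<close> and add up with \<open>trace_bound\<close>.
\<close>

theorem riesz_mean_bound:
  assumes p: "p \<in> {2, 3}" and hemi: "\<Omega> \<subseteq> S2_plus" and z: "z \<ge> 0"
  shows "riesz_mean p \<Omega> z \<le> ennreal (measure surf \<Omega> / (4 * pi) * weyl_term p z)"
proof -
  obtain M \<mu> where cpos: "\<And>l. l < M \<Longrightarrow> 0 \<le> z - sphere_ev l ^ p + \<mu> * (-1) ^ l"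
    and tail: "\<And>l. M \<le> l \<Longrightarrow> z - sphere_ev l ^ p + \<mu> * (-1) ^ l \<le> 0"
    and total: "(\<Sum>l<M. (2 * real l + 1) * (z - sphere_ev l ^ p + \<mu> * (-1) ^ l)) \<le> weyl_term p z"
    by (rule cutoff_exists[OF p z]) blast
  define c where "c l = z - sphere_ev l ^ p + \<mu> * (-1) ^ l" for l
  define A where "A = {(\<Lambda>, k). dirichlet_eigenvalue p \<Omega> \<Lambda> \<and> enat k < eig_mult p \<Omega> \<Lambda>}"
  have fin: "(\<Sum>(\<Lambda>, k)\<in>F. ennreal (max (z - \<Lambda>) 0)) \<le> ennreal (measure surf \<Omega> / (4 * pi) * weyl_term p z)"
    if F: "finite F" "F \<subseteq> A" for F
  proof -
    have "\<exists>n u. (\<forall>k. (\<Lambda>, k) \<in> F \<longrightarrow> k < n) \<and> (\<forall>i<n. u i \<in> eigenspace p \<Omega> \<Lambda>) \<and> independent_ae \<Omega> n u" for \<Lambda>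
    proof (cases "\<exists>k. (\<Lambda>, k) \<in> F")
      case False
      then show ?thesis by (intro exI[of _ 0]) (auto simp: independent_ae_def)
    next
      case True
      have fS: "finite {k. (\<Lambda>, k) \<in> F}"
        by (rule finite_subset[OF _ finite_imageI[OF F(1), of snd]]) force
      define m where "m = Max {k. (\<Lambda>, k) \<in> F}"
      have "m \<in> {k. (\<Lambda>, k) \<in> F}" unfolding m_def by (rule Max_in[OF fS]) (use True in auto)
      then have "enat m < eig_mult p \<Omega> \<Lambda>" using F(2) by (auto simp: A_def)
      then obtain n u where nu: "m < n" "\<forall>i<n. u i \<in> eigenspace p \<Omega> \<Lambda>" "independent_ae \<Omega> n u"
        unfolding eig_mult_def less_Sup_iff by auto
      have "k < n" if "(\<Lambda>, k) \<in> F" for k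
        using Max_ge[OF fS, of k] that nu(1) by (simp add: m_def)
      then show ?thesis using nu by blast
    qed
    then obtain n u where nF: "\<And>\<Lambda> k. (\<Lambda>, k) \<in> F \<Longrightarrow> k < n \<Lambda>"
      and uE: "\<And>\<Lambda> i. i < n \<Lambda> \<Longrightarrow> u \<Lambda> i \<in> eigenspace p \<Omega> \<Lambda>" and uI: "\<And>\<Lambda>. independent_ae \<Omega> (n \<Lambda>) (u \<Lambda>)"
      by metis
    have uL: "u \<Lambda> i \<in> L2 \<Omega>" if "i < n \<Lambda>" for \<Lambda> i
      by (rule Sob_L2[OF Sob0_Sob[OF eigenspace_Sob0[OF uE[OF that]]]])
    have "\<exists>C. \<forall>\<Lambda>. \<forall>j<n \<Lambda>. \<forall>k<n \<Lambda>.
        L2_inner (\<lambda>x. \<Sum>i<n \<Lambda>. C \<Lambda> j i * u \<Lambda> i x) (\<lambda>x. \<Sum>i<n \<Lambda>. C \<Lambda> k i * u \<Lambda> i x) = (if j = k then 1 else 0)"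
      by (rule choice, rule allI, rule gram_schmidt[OF uL uI])
    then obtain C where C0: "\<forall>\<Lambda>. \<forall>j<n \<Lambda>. \<forall>k<n \<Lambda>.
        L2_inner (\<lambda>x. \<Sum>i<n \<Lambda>. C \<Lambda> j i * u \<Lambda> i x) (\<lambda>x. \<Sum>i<n \<Lambda>. C \<Lambda> k i * u \<Lambda> i x) = (if j = k then 1 else 0)"
      by (rule exE)
    have C: "L2_inner (\<lambda>x. \<Sum>i<n \<Lambda>. C \<Lambda> j i * u \<Lambda> i x) (\<lambda>x. \<Sum>i<n \<Lambda>. C \<Lambda> k i * u \<Lambda> i x) = (if j = k then 1 else 0)"
      if "j < n \<Lambda>" "k < n \<Lambda>" for \<Lambda> j k using C0 that by blast
    define v where "v f x = (\<Sum>i<n (fst f). C (fst f) (snd f) i * u (fst f) i x)" for f x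
    have vL: "v f \<in> L2 \<Omega>" for f unfolding v_def[abs_def] by (intro L2_sum L2_cmult uL) auto
    have vo: "L2_inner (v f) (v h) = (if f = h then 1 else 0)" if "f \<in> F" "h \<in> F" for f h
    proof (cases "fst f = fst h")
      case True
      have "snd f < n (fst f)" using nF[of "fst f" "snd f"] that(1) by simp
      moreover have "snd h < n (fst f)" using nF[of "fst h" "snd h"] that(2) True by simp
      ultimately show ?thesis using C[of "snd f" "fst f" "snd h"] True
        by (simp add: v_def[abs_def] prod_eq_iff)
    next
      case False
      have "L2_inner (v f) (v h) = (\<Sum>i<n (fst f). \<Sum>j<n (fst h). C (fst f) (snd f) i * C (fst h) (snd h) j * L2_inner (u (fst f) i) (u (fst h) j))"
        unfolding v_def[abs_def] by (rule L2_inner_sum_sum) (auto intro: uL)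
      also have "\<dots> = 0"
        by (intro sum.neutral ballI) (use eigenspace_orthogonal[OF p uE uE False] in auto)
      finally show ?thesis using False by auto
    qed
    have each: "max (z - fst f) 0 \<le> (\<Sum>l<M. c l * dom_energy l (v f))" if f: "f \<in> F" for f
    proof -
      let ?a = "\<lambda>i. C (fst f) (snd f) i"
      have ap: "approximable p (v f) (\<lambda>k x. \<Sum>i<n (fst f). ?a i * form_op p k (u (fst f) i) x)"
        unfolding v_def[abs_def] by (rule approximable_sum[OF p approximable_Sob0[OF p eigenspace_Sob0[OF uE]]])
      have "z * L2_inner (v f) (v f) - fst f * L2_inner (v f) (v f) \<le> (\<Sum>l<M. c l * dom_energy l (v f))"
        using approximable_spectral[OF p hemi tail ap] eigenspace_comb_form[where n = "n (fst f)" and u = "u (fst f)" and \<Lambda> = "fst f" and c = ?a, OF p uE]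
        by (simp add: c_def v_def[abs_def])
      then have "z - fst f \<le> (\<Sum>l<M. c l * dom_energy l (v f))" using vo[OF f f] by simp
      moreover have "0 \<le> (\<Sum>l<M. c l * dom_energy l (v f))"
        by (intro sum_nonneg mult_nonneg_nonneg dom_energy_nonneg) (simp add: c_def cpos)
      ultimately show ?thesis by simp
    qed
    have "(\<Sum>f\<in>F. max (z - fst f) 0) \<le> (\<Sum>f\<in>F. \<Sum>l<M. c l * dom_energy l (v f))"
      by (rule sum_mono) (rule each)
    also have "\<dots> = (\<Sum>l<M. c l * (\<Sum>f\<in>F. dom_energy l (v f)))"
      by (subst sum.swap) (simp add: sum_distrib_left)
    also have "\<dots> \<le> (\<Sum>l<M. c l * ((2 * real l + 1) / (4 * pi) * measure surf \<Omega>))"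
      by (intro sum_mono mult_left_mono trace_bound F(1) vL vo) (auto simp: c_def cpos)
    also have "\<dots> = measure surf \<Omega> / (4 * pi) * (\<Sum>l<M. (2 * real l + 1) * c l)"
      by (simp add: sum_distrib_left mult_ac)
    also have "\<dots> \<le> measure surf \<Omega> / (4 * pi) * weyl_term p z"
      using total by (intro mult_left_mono) (auto simp: c_def)
    finally have "(\<Sum>f\<in>F. max (z - fst f) 0) \<le> measure surf \<Omega> / (4 * pi) * weyl_term p z" .
    moreover have "(\<Sum>(\<Lambda>, k)\<in>F. ennreal (max (z - \<Lambda>) 0)) = ennreal (\<Sum>f\<in>F. max (z - fst f) 0)"
      by (subst sum_ennreal[symmetric]) (auto simp: split_beta)
    ultimately show ?thesis by (simp add: ennreal_leI)
  qed
  show ?thesis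
    unfolding riesz_mean_def A_def[symmetric]
    by (intro infsum_le_finite_sums nonneg_summable_on_complete fin) auto
qed

end

theorem theorem6p2p2:
  fixes \<Omega> :: "(real^3) set" and z :: real
  assumes "openin (top_of_set S2) \<Omega>" and "connected \<Omega>" and "\<Omega> \<subseteq> S2_plus"
    and "z \<ge> 0"
  shows "riesz_mean 2 \<Omega> z \<le> ennreal (measure surf \<Omega> / (6 * pi) * z powr (3/2)) \<and>
         riesz_mean 3 \<Omega> z \<le> ennreal (3 * measure surf \<Omega> / (16 * pi) * z powr (4/3))"
proof -
  interpret sphere_open \<Omega> by unfold_locales (rule assms(1))
  have "measure surf \<Omega> / (4 * pi) * weyl_term 2 z = measure surf \<Omega> / (6 * pi) * z powr (3/2)"
    by (simp add: weyl_term_def)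
  moreover have "measure surf \<Omega> / (4 * pi) * weyl_term 3 z = 3 * measure surf \<Omega> / (16 * pi) * z powr (4/3)"
    by (simp add: weyl_term_def)
  ultimately show ?thesis
    using riesz_mean_bound[OF _ assms(3,4), of 2] riesz_mean_bound[OF _ assms(3,4), of 3] by simp
qed

end
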